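(* For every positive integer $d$ and every integer $s$ with $0\le s\le \lfloor d/2\rfloor$, $$\frac{v_d^{(s)}}{v_d^{(0)}}=\sum_{K\subseteq\{1,\dots,\lfloor d/2\rfloor\}}\binom{\lfloor d/2\rfloor-|K|}{s-|K|}(-1)^{s+|K|}\left(\prod_{k\in K}\frac12\binom{d+2k}{d-2k,\ 2k,\ 2k}\right)\prod_{\substack{j<k\\ j,k\in K}}\frac{(k-j)^2}{(k+j)^2}$$ $$=\sum_{K\subseteq\{1,\dots,\lfloor d/2\rfloor\}}\binom{\lfloor d/2\rfloor-|K|}{s-|K|}(-1)^{s+|K|}\left(\prod_{k\in K}\binom{d+2k}{4k}\binom{4k-1}{2k-1}2k\right)\det\left(\frac{1}{j+k}\right)_{j,k\in K}$$ $$=\sum_{K\subseteq\{1,\dots,\lfloor d/2\rfloor\}}\binom{\lfloor d/2\rfloor-|K|}{s-|K|}(-1)^{s+|K|}\det\left(\binom{d+2j}{2j+2k}\binom{2j+2k-1}{2j-1}\right)_{j,k\in K}.$$ In particular, $v_d^{(s)}/v_d^{(0)}$ is an integer.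
   Context: For a positive integer $d$ and an integer $s$ with $0\le s\le d/2$, let $\mathcal{E}_d^{(s)}$ be the set of all $(a_1,\dots,a_d)\in\mathbb{R}^d$ such that every complex root $\xi$ of the polynomial $X^d+a_1X^{d-1}+\cdots+a_{d-1}X+a_d$ satisfies $|\xi|<1$ and this polynomial has exactly $s$ pairs of complex conjugate nonreal roots (roots counted with multiplicity; so it has $d-2s$ real roots). Let $v_d^{(s)}=\lambda_d(\mathcal{E}_d^{(s)})$, where $\lambda_d$ is $d$-dimensional Lebesgue measure. Conventions: $\binom{n}{k}=0$ for $k<0$; $\binom{a+b+c}{a,\,b,\,c}=\frac{(a+b+c)!}{a!\,b!\,c!}$ is the trinomial coefficient; for $K=\emptyset$ the determinants and products have the value $1$. Sums run over all subsets $K$, including the empty set. *)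

theory Defs
  imports "HOL-Analysis.Analysis" "Jordan_Normal_Form.Determinant"
begin

text \<open>A vector \<open>(a\<^sub>1, \<dots>, a\<^sub>d)\<close> of \<open>\<real>\<^sup>d\<close> is a function on \<open>{1..d}\<close>, that is, an element of
  \<open>{1..d} \<rightarrow>\<^sub>E UNIV\<close>, the space of the product measure below. The completion makes the measure
  the Lebesgue measure and not only its restriction to the Borel sets.\<close>

definition lebesgue_dim :: "nat \<Rightarrow> (nat \<Rightarrow> real) measure" where
  "lebesgue_dim d = completion (Pi\<^sub>M {1..d} (\<lambda>_. lborel))"

definition coeff_poly :: "nat \<Rightarrow> (nat \<Rightarrow> real) \<Rightarrow> complex poly" where
  "coeff_poly d a = monom 1 d + (\<Sum>i = 1..d. monom (complex_of_real (a i)) (d - i))"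

text \<open>The polynomial has real coefficients, so its nonreal roots come in conjugate pairs of
  equal multiplicity, and \<open>s\<close> pairs are \<open>2 * s\<close> nonreal roots.\<close>

definition E_set :: "nat \<Rightarrow> nat \<Rightarrow> (nat \<Rightarrow> real) set" where
  "E_set d s = {a \<in> {1..d} \<rightarrow>\<^sub>E UNIV.
     (\<forall>\<xi>. poly (coeff_poly d a) \<xi> = 0 \<longrightarrow> cmod \<xi> < 1) \<and>
     size (filter_mset (\<lambda>\<xi>. \<xi> \<notin> \<real>) (proots (coeff_poly d a))) = 2 * s}"

definition vol :: "nat \<Rightarrow> nat \<Rightarrow> real" where
  "vol d s = measure (lebesgue_dim d) (E_set d s)"

text \<open>The lower index is an integer because \<open>s - |K|\<close> can be negative; truncated subtraction
  would give the value \<open>1\<close> there instead of \<open>0\<close>.\<close>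

definition binom :: "nat \<Rightarrow> int \<Rightarrow> real" where
  "binom n k = (if k < 0 then 0 else real (n choose nat k))"

definition trinomial :: "nat \<Rightarrow> nat \<Rightarrow> nat \<Rightarrow> real" where
  "trinomial a b c = fact (a + b + c) / (fact a * fact b * fact c)"

text \<open>The matrix with entries \<open>f j k\<close> for \<open>j, k \<in> K\<close>, rows and columns taken in increasing order.\<close>

definition mat_on :: "nat set \<Rightarrow> (nat \<Rightarrow> nat \<Rightarrow> real) \<Rightarrow> real mat" where
  "mat_on K f = mat (card K) (card K)
     (\<lambda>(i, l). f (sorted_list_of_set K ! i) (sorted_list_of_set K ! l))"

abbreviation det_on :: "nat set \<Rightarrow> (nat \<Rightarrow> nat \<Rightarrow> real) \<Rightarrow> real" where
  "det_on K f \<equiv> Determinant.det (mat_on K f)"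

end

theory Submission
  imports Defs "HOL-Computational_Algebra.Fundamental_Theorem_Algebra"
begin

text \<open>For fixed \<open>d\<close>, let \<open>W(t) = (\<Sum>s. vol d s * t^s)\<close>. This is the integral over the coefficient space of the
weight that is \<open>t^s\<close> at a Schur stable polynomial with simple roots and \<open>s\<close> pairs of conjugate roots, and \<open>0\<close>
elsewhere; polynomials with a multiple root form a null set. It suffices to find the polynomial \<open>W\<close> up to a
nonzero constant factor.

The idea is to split off quadratic factors. Let \<open>p\<close> be a real polynomial of degree \<open>d\<close> with simple roots, and
let \<open>q\<close> run over its monic real quadratic divisors. Then the signs of the resultants \<open>Res(q, p / q)\<close> add up to
\<open>d div 2\<close>, whatever the number of real roots is (lemma \<open>sum_sgn_res\<close>). On the other hand the
map \<open>(q, h) \<mapsto> q h\<close> has Jacobian \<open>Res(q, h)\<close>, so the area formula with that sign inserted turns \<open>d div 2\<close> times a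
weighted integral of \<open>g\<close> into the integral of \<open>Res(q, h) g(q h)\<close> over \<open>q\<close> and \<open>h\<close>, without an absolute value
(theorem \<open>pair_removal\<close>).

Without the absolute value the integrand is polynomial apart from the weights, and it can be separated: if \<open>g\<close> is a minor of the matrix
with the columns \<open>h, X h, X\<^sup>2 h, ...\<close>, then \<open>Res(q, h) g(q h)\<close> is a bilinear combination of larger minors for \<open>h\<close>
alone, with coefficients that depend on \<open>q\<close> alone (lemma \<open>minor_quad\<close>). Starting with the empty minor and
removing all pairs, one obtains that \<open>W(t)\<close> is a nonzero constant times the determinant of a matrix of moments
of quadratic factors (theorem \<open>weighted_integral_eq_det\<close>). These moments are elementary (theorem
\<open>pair_moment_value\<close>): with \<open>x = 2 l + 1\<close> and \<open>y = 2 i\<close> they are \<open>4 / x * ((1 - t) / (x + y) + t / (y - x))\<close>.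

For \<open>t = 0\<close> the rows are those of a Cauchy matrix. Partial fractions in \<open>x\<close> express \<open>1 / (y - x)\<close> through the functions
\<open>1 / (x + 2 k)\<close>, so that the matrix at \<open>t\<close> is the one at \<open>0\<close> multiplied by \<open>(1 - t) I + t M\<close> for
an explicit \<open>M\<close>, with one more row and column if \<open>d\<close> is odd. The determinant of this factor is the sum of
\<open>(1 - t)^(d div 2 - |K|) t^|K| det M\<^sub>K\<close> over the principal minors of \<open>M\<close> (lemma \<open>det_moment_mat\<close>), and comparing coefficients of \<open>t^s\<close> gives the binomial coefficients and the signs.
Finally \<open>M\<close> arises from the matrix \<open>1 / (2 j + 2 k)\<close> by scaling rows and columns, and the three expressions for the
minors are Cauchy's determinant and two ways to distribute the scaling factors; the last one has integer entries.\<close>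

hide_const (open) Module.smult
no_notation Matrix.vec_index (infixl "$" 100)

section \<open>The area formula\<close>

text \<open>On a set where \<open>f\<close> is injective each fiber sum has at most one term, and it vanishes off the image. This rewrites
the change of variables formula in a shape that can be added up over a partition.\<close>

lemma change_of_variables_fiber_sum:
  fixes f :: "real^'n::{finite,wellorder} \<Rightarrow> real^'n::_" and \<psi> :: "real^'n::_ \<Rightarrow> real"
  assumes B: "B \<in> sets lebesgue"
    and der: "\<And>x. x \<in> B \<Longrightarrow> (f has_derivative f' x) (at x within B)"
    and inj: "inj_on f B"
    and int: "(\<lambda>x. \<bar>Determinants.det (matrix (f' x))\<bar> * \<psi> x) absolutely_integrable_on B"
  shows "integrable lebesgue (\<lambda>y. \<Sum>x | x \<in> B \<and> f x = y. \<psi> x)"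
    and "(\<integral>y. (\<Sum>x | x \<in> B \<and> f x = y. \<psi> x) \<partial>lebesgue) =
      (LINT x:B|lebesgue. \<bar>Determinants.det (matrix (f' x))\<bar> * \<psi> x)"
proof -
  let ?F = "\<lambda>y. \<Sum>x | x \<in> B \<and> f x = y. \<psi> x"
  have F: "?F (f x) = \<psi> x" if "x \<in> B" for x
  proof -
    have "{x'. x' \<in> B \<and> f x' = f x} = {x}" using inj that by (auto dest: inj_onD)
    then show ?thesis by simp
  qed
  \<comment> \<open>The change of variables theorem needs vector values; real functions are seen as having values in \<open>real^1\<close>.\<close>
  have *: "(\<lambda>x. \<bar>Determinants.det (matrix (f' x))\<bar> *\<^sub>R (Finite_Cartesian_Product.vec (?F (f x)) :: real^1)) absolutely_integrable_on B"
    "integral B (\<lambda>x. \<bar>Determinants.det (matrix (f' x))\<bar> *\<^sub>R (Finite_Cartesian_Product.vec (?F (f x)) :: real^1)) =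
     Finite_Cartesian_Product.vec (integral B (\<lambda>x. \<bar>Determinants.det (matrix (f' x))\<bar> * \<psi> x))"
  proof -
    let ?h = "\<lambda>x. \<bar>Determinants.det (matrix (f' x))\<bar> * \<psi> x"
    have e: "\<bar>Determinants.det (matrix (f' x))\<bar> *\<^sub>R (Finite_Cartesian_Product.vec (?F (f x)) :: real^1) = Finite_Cartesian_Product.vec (?h x)" if "x \<in> B" for x
      using F[OF that] by (simp add: Finite_Cartesian_Product.vec_eq_iff)
    have bl: "bounded_linear (Finite_Cartesian_Product.vec :: real \<Rightarrow> real^1)"
      by (simp add: linear_conv_bounded_linear[symmetric] linear_vec)
    have "(\<lambda>x. Finite_Cartesian_Product.vec (?h x) :: real^1) absolutely_integrable_on B"
      using absolutely_integrable_linear[OF int bl] by (simp add: o_def)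
    moreover have "integral B (\<lambda>x. Finite_Cartesian_Product.vec (?h x) :: real^1) = Finite_Cartesian_Product.vec (integral B ?h)"
      using integral_linear[OF _ bl, of ?h B] int
      by (simp add: o_def absolutely_integrable_on_def)
    moreover have "(\<lambda>x. \<bar>Determinants.det (matrix (f' x))\<bar> *\<^sub>R (Finite_Cartesian_Product.vec (?F (f x)) :: real^1)) absolutely_integrable_on B
        \<longleftrightarrow> (\<lambda>x. Finite_Cartesian_Product.vec (?h x) :: real^1) absolutely_integrable_on B"
      by (rule set_integrable_cong[OF refl refl e])
    moreover have "integral B (\<lambda>x. \<bar>Determinants.det (matrix (f' x))\<bar> *\<^sub>R (Finite_Cartesian_Product.vec (?F (f x)) :: real^1))
        = integral B (\<lambda>x. Finite_Cartesian_Product.vec (?h x) :: real^1)"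
      by (rule Henstock_Kurzweil_Integration.integral_cong[OF e])
    ultimately show "(\<lambda>x. \<bar>Determinants.det (matrix (f' x))\<bar> *\<^sub>R (Finite_Cartesian_Product.vec (?F (f x)) :: real^1)) absolutely_integrable_on B"
      "integral B (\<lambda>x. \<bar>Determinants.det (matrix (f' x))\<bar> *\<^sub>R (Finite_Cartesian_Product.vec (?F (f x)) :: real^1)) =
       Finite_Cartesian_Product.vec (integral B (\<lambda>x. \<bar>Determinants.det (matrix (f' x))\<bar> * \<psi> x))"
      by simp_all
  qed
  have **: "(\<lambda>y. Finite_Cartesian_Product.vec (?F y) :: real^1) absolutely_integrable_on f ` B"
    "integral (f ` B) (\<lambda>y. Finite_Cartesian_Product.vec (?F y) :: real^1) = Finite_Cartesian_Product.vec (integral B (\<lambda>x. \<bar>Determinants.det (matrix (f' x))\<bar> * \<psi> x))"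
    using has_absolute_integral_change_of_variables[OF B der inj, of "\<lambda>y. Finite_Cartesian_Product.vec (?F y)"] * by blast+
  have bl1: "bounded_linear (\<lambda>v::real^1. vec_nth v 1)" by (rule bounded_linear_vec_nth)
  have a: "?F absolutely_integrable_on f ` B"
    using absolutely_integrable_linear[OF **(1) bl1] by (simp add: o_def)
  have i: "integral (f ` B) ?F = integral B (\<lambda>x. \<bar>Determinants.det (matrix (f' x))\<bar> * \<psi> x)"
    using integral_linear[OF _ bl1, of "\<lambda>y. Finite_Cartesian_Product.vec (?F y)" "f ` B"] **
    by (simp add: o_def absolutely_integrable_on_def)
  have z: "indicator (f ` B) y *\<^sub>R ?F y = ?F y" for y
  proof (cases "y \<in> f ` B")
    case False
    then have "{x. x \<in> B \<and> f x = y} = {}" by auto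
    then show ?thesis by (simp only: sum.empty) simp
  qed simp
  show "integrable lebesgue ?F" using a unfolding set_integrable_def z .
  have "integral\<^sup>L lebesgue ?F = (LINT y:f ` B|lebesgue. ?F y)"
    unfolding set_lebesgue_integral_def z ..
  also have "\<dots> = integral (f ` B) ?F" by (rule set_lebesgue_integral_eq_integral(2)[OF a])
  also have "\<dots> = (LINT x:B|lebesgue. \<bar>Determinants.det (matrix (f' x))\<bar> * \<psi> x)"
    unfolding i by (rule set_lebesgue_integral_eq_integral(2)[OF int, symmetric])
  finally show "integral\<^sup>L lebesgue ?F = (LINT x:B|lebesgue. \<bar>Determinants.det (matrix (f' x))\<bar> * \<psi> x)" .
qed

text \<open>Only finitely many parts meet \<open>X\<close>, so all but finitely many terms of the series vanish.\<close>

lemma sums_over_partition: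
  fixes g :: "'a \<Rightarrow> real" and B :: "nat \<Rightarrow> 'a set"
  assumes "finite X" and disj: "\<And>i j. i \<noteq> j \<Longrightarrow> B i \<inter> B j = {}" and "X \<subseteq> (\<Union>i. B i)"
  shows "(\<lambda>i. \<Sum>x\<in>X \<inter> B i. g x) sums (\<Sum>x\<in>X. g x)"
  using assms(1,3)
proof (induction X rule: finite_induct)
  case empty
  show ?case by simp
next
  case (insert x X)
  obtain j where j: "x \<in> B j" using insert.prems by auto
  have "(\<Sum>y\<in>insert x X \<inter> B i. g y) = (if i = j then g x else 0) + (\<Sum>y\<in>X \<inter> B i. g y)" for i
  proof (cases "i = j")
    case True
    then have "insert x X \<inter> B i = insert x (X \<inter> B i)" using j by auto
    then show ?thesis using insert.hyps True by simp
  next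
    case False
    then have "insert x X \<inter> B i = X \<inter> B i" using j disj[OF False] by auto
    then show ?thesis using False by simp
  qed
  moreover have "(\<lambda>i. if i = j then g x else 0) sums g x" by (rule sums_single)
  moreover have "(\<lambda>i. \<Sum>y\<in>X \<inter> B i. g y) sums (\<Sum>y\<in>X. g y)"
    using insert by auto
  ultimately show ?case using insert.hyps by (simp add: sums_add)
qed

text \<open>A locally injective map is injective on each part of a countable measurable partition of its domain, by
Lindelof's theorem. The injective case then applies to the parts, and dominated convergence adds them up: \<open>\<psi>\<close> is
summed over each fiber with its sign, which is how the signs of resultants enter below.\<close>

theorem area_formula:
  fixes f :: "real^'n::{finite,wellorder} \<Rightarrow> real^'n::_" and \<psi> :: "real^'n::_ \<Rightarrow> real"
  assumes U: "open U"
    and der: "\<And>x. x \<in> U \<Longrightarrow> (f has_derivative f' x) (at x)"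
    and loc: "\<And>x. x \<in> U \<Longrightarrow> \<exists>V. open V \<and> x \<in> V \<and> inj_on f (V \<inter> U)"
    and fin: "\<And>y. finite {x. x \<in> U \<and> f x = y}"
    and int: "(\<lambda>x. \<bar>Determinants.det (matrix (f' x))\<bar> * \<psi> x) absolutely_integrable_on U"
  shows "(\<integral>y. (\<Sum>x | x \<in> U \<and> f x = y. \<psi> x) \<partial>lebesgue) =
      (LINT x:U|lebesgue. \<bar>Determinants.det (matrix (f' x))\<bar> * \<psi> x)"
proof -
  let ?J = "\<lambda>x. \<bar>Determinants.det (matrix (f' x))\<bar>"
  obtain V where V: "\<And>x. x \<in> U \<Longrightarrow> open (V x) \<and> x \<in> V x \<and> inj_on f (V x \<inter> U)"
    using loc by metis
  define F where "F = insert {} ((\<lambda>x. V x \<inter> U) ` U)"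
  have Fo: "open S" if "S \<in> F" for S using that V U by (auto simp: F_def)
  have Finj: "inj_on f S" "S \<subseteq> U" if "S \<in> F" for S using that V by (auto simp: F_def)
  have FU: "\<Union>F = U" using V by (auto simp: F_def)
  obtain G where G: "G \<subseteq> F" "countable G" "\<Union>G = \<Union>F"
    using Lindelof[of F] Fo by blast
  define W where "W = from_nat_into (insert {} G)"
  have cG: "countable (insert {} G)" "insert {} G \<noteq> {}" using G by auto
  have rW: "range W = insert {} G" unfolding W_def using range_from_nat_into[OF cG(2,1)] .
  have WF: "W i \<in> F" for i using rW G(1) by (auto simp: F_def)
  define B where "B = disjointed W"
  have BW: "B i \<subseteq> W i" for i unfolding B_def by (rule disjointed_subset)
  have BU: "(\<Union>i. B i) = U" unfolding B_def UN_disjointed_eq using rW G FU by auto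
  have Bdis: "disjoint_family B" unfolding B_def by (rule disjoint_family_disjointed)
  have Bset: "B i \<in> sets lebesgue" for i
  proof -
    have "range W \<subseteq> sets lebesgue" using WF Fo by (auto intro: borel_open)
    from sets.range_disjointed_sets[OF this] show ?thesis unfolding B_def by blast
  qed
  have Binj: "inj_on f (B i)" for i using Finj(1)[OF WF] BW inj_on_subset by blast
  have BsU: "B i \<subseteq> U" for i using BU by blast
  have Bder: "(f has_derivative f' x) (at x within B i)" if "x \<in> B i" for x i
    using der that BsU has_derivative_at_withinI by blast
  have Bint: "(\<lambda>x. ?J x * \<psi> x) absolutely_integrable_on B i" for i
    using set_integrable_subset[OF int Bset BsU] .
  have absint: "(\<lambda>x. ?J x * \<bar>\<psi> x\<bar>) absolutely_integrable_on U"
    using absolutely_integrable_abs[OF int] by (simp add: abs_mult)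
  have Baint: "(\<lambda>x. ?J x * \<bar>\<psi> x\<bar>) absolutely_integrable_on B i" for i
    using set_integrable_subset[OF absint Bset BsU] .
  note ch = change_of_variables_fiber_sum[OF Bset Bder Binj Bint]
  note cha = change_of_variables_fiber_sum[OF Bset Bder Binj Baint]
  have disj: "B i \<inter> B j = {}" if "i \<noteq> j" for i j using Bdis that by (auto simp: disjoint_family_on_def)
  let ?S = "\<lambda>i y. {x. x \<in> B i \<and> f x = y}"
  \<comment> \<open>A fiber meets a part in at most one point, so absolute values commute with the sum.\<close>
  have S1: "(\<Sum>x\<in>?S i y. \<bar>\<psi> x\<bar>) = \<bar>\<Sum>x\<in>?S i y. \<psi> x\<bar>" for i y
  proof -
    have "x = x'" if "x \<in> ?S i y" "x' \<in> ?S i y" for x x'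
      using that Binj[of i] by (auto dest: inj_onD)
    then have "?S i y = {x}" if "x \<in> ?S i y" for x using that by blast
    then consider "?S i y = {}" | x where "?S i y = {x}" by blast
    then show ?thesis
    proof cases
      case 1 show ?thesis unfolding 1 by simp
    next
      case (2 x) show ?thesis unfolding 2 by simp
    qed
  qed
  have fib: "(\<lambda>i. (\<Sum>x\<in>?S i y. g x)) sums (\<Sum>x | x \<in> U \<and> f x = y. g x)" for y and g :: "_ \<Rightarrow> real"
  proof -
    have e: "?S i y = {x. x \<in> U \<and> f x = y} \<inter> B i" for i using BsU[of i] by blast
    have "{x. x \<in> U \<and> f x = y} \<subseteq> (\<Union>i. B i)" using BU by blast
    then show ?thesis unfolding e by (intro sums_over_partition fin disj)
  qed
  have intU: "set_integrable lebesgue (\<Union>i. B i) (\<lambda>x. ?J x * \<psi> x)" "set_integrable lebesgue (\<Union>i. B i) (\<lambda>x. ?J x * \<bar>\<psi> x\<bar>)"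
    using int absint by (simp_all only: BU)
  have summ: "summable (\<lambda>i. LINT x:B i|lebesgue. ?J x * \<bar>\<psi> x\<bar>)"
  proof (rule summableI_nonneg_bounded)
    fix n
    show "0 \<le> (LINT x:B n|lebesgue. ?J x * \<bar>\<psi> x\<bar>)"
      unfolding set_lebesgue_integral_def by (intro integral_nonneg_AE) auto
    have "(\<Sum>i<n. LINT x:B i|lebesgue. ?J x * \<bar>\<psi> x\<bar>) = (LINT x:(\<Union>i\<in>{..<n}. B i)|lebesgue. ?J x * \<bar>\<psi> x\<bar>)"
      by (rule set_integral_finite_Union[symmetric]) (use Bdis Baint Bset in \<open>auto simp: disjoint_family_on_def\<close>)
    also have "\<dots> \<le> (LINT x:U|lebesgue. ?J x * \<bar>\<psi> x\<bar>)"
    proof -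
      have m: "(\<Union>i\<in>{..<n}. B i) \<in> sets lebesgue" "(\<Union>i\<in>{..<n}. B i) \<subseteq> U" using Bset BsU by auto
      show ?thesis
        unfolding set_lebesgue_integral_def
        by (rule integral_mono) (use set_integrable_subset[OF absint m] absint m(2) in \<open>auto simp: set_integrable_def split: split_indicator\<close>)
    qed
    finally show "(\<Sum>i<n. LINT x:B i|lebesgue. ?J x * \<bar>\<psi> x\<bar>) \<le> (LINT x:U|lebesgue. ?J x * \<bar>\<psi> x\<bar>)" .
  qed
  have "(\<integral>y. (\<Sum>x | x \<in> U \<and> f x = y. \<psi> x) \<partial>lebesgue) = (\<integral>y. (\<Sum>i. \<Sum>x\<in>?S i y. \<psi> x) \<partial>lebesgue)"
    using fib by (intro Bochner_Integration.integral_cong refl) (simp add: sums_iff)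
  also have "\<dots> = (\<Sum>i. \<integral>y. (\<Sum>x\<in>?S i y. \<psi> x) \<partial>lebesgue)"
  proof (rule integral_suminf)
    show "integrable lebesgue (\<lambda>y. \<Sum>x\<in>?S i y. \<psi> x)" for i by (rule ch(1))
    show "AE y in lebesgue. summable (\<lambda>i. norm (\<Sum>x\<in>?S i y. \<psi> x))"
      using fib[of "\<lambda>x. \<bar>\<psi> x\<bar>"] by (auto simp: S1 sums_iff)
    show "summable (\<lambda>i. \<integral>y. norm (\<Sum>x\<in>?S i y. \<psi> x) \<partial>lebesgue)"
      using summ by (simp add: S1[symmetric] cha(2))
  qed
  also have "\<dots> = (\<Sum>i. LINT x:B i|lebesgue. ?J x * \<psi> x)" by (simp only: ch(2))
  also have "\<dots> = (LINT x:(\<Union>i. B i)|lebesgue. ?J x * \<psi> x)"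
    by (rule lebesgue_integral_countable_add[OF Bset disj intU(1), symmetric])
  also have "\<dots> = (LINT x:U|lebesgue. ?J x * \<psi> x)" by (simp only: BU)
  finally show ?thesis .
qed

section \<open>Division by a quadratic polynomial\<close>

definition monic_poly :: "nat \<Rightarrow> (nat \<Rightarrow> real) \<Rightarrow> real poly" where
  "monic_poly d a = monom 1 d + (\<Sum>i = 1..d. monom (a i) (d - i))"

lemma monic_poly_eq_sum: "monic_poly d a = (\<Sum>i\<le>d. monom (if i = 0 then 1 else a i) (d - i))"
proof -
  have "{..d} = insert 0 {1..d}" by auto
  then show ?thesis by (simp add: monic_poly_def)
qed

lemma coeff_monic_poly: "coeff (monic_poly d a) k = (if k < d then a (d - k) else if k = d then 1 else 0)"
proof (cases "k \<le> d")
  case True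
  have "coeff (monic_poly d a) k = (\<Sum>i\<le>d. if i = d - k then (if i = 0 then 1 else a i) else 0)"
    unfolding monic_poly_eq_sum coeff_sum coeff_monom
    by (intro sum.cong refl) (use True in auto)
  also have "\<dots> = (if d - k = 0 then 1 else a (d - k))" by (subst sum.delta) auto
  finally show ?thesis using True by auto
next
  case False
  then show ?thesis unfolding monic_poly_eq_sum coeff_sum coeff_monom by (auto intro: sum.neutral)
qed

lemma degree_monic_poly [simp]: "degree (monic_poly d a) = d"
  by (rule antisym[OF degree_le le_degree]) (auto simp: coeff_monic_poly)

lemma monic_poly_nonzero [simp]: "monic_poly d a \<noteq> 0"
  by (metis coeff_0 coeff_monic_poly less_irrefl zero_neq_one)

lemma monic_poly_cong: "(\<And>i. i \<in> {1..d} \<Longrightarrow> a i = b i) \<Longrightarrow> monic_poly d a = monic_poly d b"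
  by (simp add: monic_poly_def)

lemma monic_poly_coeffs:
  assumes "degree p = d" "lead_coeff p = 1"
  shows "monic_poly d (\<lambda>i. coeff p (d - i)) = p"
  using assms by (auto simp: poly_eq_iff coeff_monic_poly coeff_eq_0)

lemma monic_poly_split:
  "monic_poly (e + 2) a = [:0, 0, 1:] * monic_poly e a + [:a (e + 2), a (e + 1):]"
proof (rule poly_eqI)
  fix k
  show "coeff (monic_poly (e + 2) a) k = coeff ([:0, 0, 1:] * monic_poly e a + [:a (e + 2), a (e + 1):]) k"
    by (auto simp: coeff_monic_poly coeff_pCons split: nat.split)
qed

definition quad :: "real \<Rightarrow> real \<Rightarrow> real poly" where "quad u w = [:w, u, 1:]"

lemma degree_quad [simp]: "degree (quad u w) = 2" and quad_nonzero [simp]: "quad u w \<noteq> 0"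
  by (simp_all add: quad_def)

text \<open>The Lucas sequence of \<open>quad u w\<close>: the remainder of \<open>X^k\<close> modulo \<open>X\<^sup>2 + u X + w\<close> is
\<open>lucas_const u w k + lucas u w k * X\<close>, and \<open>power_quot u w k\<close> is the quotient.\<close>

fun lucas :: "real \<Rightarrow> real \<Rightarrow> nat \<Rightarrow> real" where
  "lucas u w 0 = 0"
| "lucas u w (Suc 0) = 1"
| "lucas u w (Suc (Suc k)) = - u * lucas u w (Suc k) - w * lucas u w k"

definition lucas_const :: "real \<Rightarrow> real \<Rightarrow> nat \<Rightarrow> real" where
  "lucas_const u w k = (if k = 0 then 1 else - w * lucas u w (k - 1))"

definition power_quot :: "real \<Rightarrow> real \<Rightarrow> nat \<Rightarrow> real poly" where
  "power_quot u w k = (\<Sum>i<k. monom (lucas u w (k - 1 - i)) i)"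

lemma power_quot_Suc: "power_quot u w (Suc k) = pCons (lucas u w k) (power_quot u w k)"
proof -
  have "power_quot u w (Suc k) = monom (lucas u w k) 0 + (\<Sum>i<k. monom (lucas u w (k - 1 - i)) (Suc i))"
    unfolding power_quot_def by (subst sum.lessThan_Suc_shift) simp
  also have "\<dots> = pCons (lucas u w k) (power_quot u w k)"
    by (rule poly_eqI) (auto simp: power_quot_def coeff_sum coeff_pCons split: nat.split)
  finally show ?thesis .
qed

lemma monom_eq_quad_mult:
  "monom 1 k = quad u w * power_quot u w k + [:lucas_const u w k, lucas u w k:]"
proof (induction k)
  case 0
  show ?case by (simp add: power_quot_def lucas_const_def monom_0)
next
  case (Suc k)
  have "monom 1 (Suc k) = [:0, 1:] * (monom 1 k :: real poly)" by (simp add: monom_Suc)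
  also have "\<dots> = quad u w * ([:0, 1:] * power_quot u w k) + [:0, 1:] * [:lucas_const u w k, lucas u w k:]"
    unfolding Suc.IH by (simp only: algebra_simps)
  also have "[:0, 1:] * [:lucas_const u w k, lucas u w k:]
      = quad u w * [:lucas u w k:] + [:lucas_const u w (Suc k), lucas u w (Suc k):]"
    by (cases k) (simp_all add: quad_def lucas_const_def)
  also have "quad u w * ([:0, 1:] * power_quot u w k) + (quad u w * [:lucas u w k:] + [:lucas_const u w (Suc k), lucas u w (Suc k):])
    = quad u w * power_quot u w (Suc k) + [:lucas_const u w (Suc k), lucas u w (Suc k):]"
    unfolding power_quot_Suc by (simp add: algebra_simps)
  finally show ?case .
qed

lemma smult_sum_right: "smult c (\<Sum>i\<in>I. f i) = (\<Sum>i\<in>I. smult c (f i))"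
  by (induction I rule: infinite_finite_induct) (auto simp: smult_add_right)

text \<open>The coefficients of the quotient of \<open>monic_poly (e + 2) a\<close> by \<open>quad u w\<close>. They involve only \<open>a 1\<close>, ..., \<open>a e\<close>, through
a unitriangular matrix for fixed \<open>u\<close> and \<open>w\<close>.\<close>

definition quot_vec :: "nat \<Rightarrow> real \<Rightarrow> real \<Rightarrow> (nat \<Rightarrow> real) \<Rightarrow> nat \<Rightarrow> real" where
  "quot_vec e u w a = (\<lambda>m\<in>{1..e}. \<Sum>i\<le>m. (if i = 0 then 1 else a i) * lucas u w (m + 1 - i))"

lemma monic_poly_quot_vec:
  "monic_poly e (quot_vec e u w a) = (\<Sum>i\<le>e. smult (if i = 0 then 1 else a i) (power_quot u w (e - i + 2)))"
proof -
  let ?a = "\<lambda>i. if i = 0 then 1 else a i"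
  have "monic_poly e (quot_vec e u w a) = (\<Sum>m\<le>e. monom (\<Sum>i\<le>m. ?a i * lucas u w (m + 1 - i)) (e - m))"
    unfolding monic_poly_eq_sum by (intro sum.cong refl) (auto simp: quot_vec_def)
  also have "\<dots> = (\<Sum>m\<le>e. \<Sum>i\<le>m. smult (?a i) (monom (lucas u w (m + 1 - i)) (e - m)))"
    by (simp add: monom_sum[symmetric] smult_monom)
  also have "\<dots> = (\<Sum>m\<le>e. \<Sum>i\<le>e. smult (?a i) (monom (lucas u w (m + 1 - i)) (e - m)))"
    by (rule sum.cong[OF refl], rule sum.mono_neutral_left) auto
  also have "\<dots> = (\<Sum>i\<le>e. smult (?a i) (\<Sum>m\<le>e. monom (lucas u w (m + 1 - i)) (e - m)))"
    by (subst sum.swap) (simp add: smult_sum_right)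
  also have "\<dots> = (\<Sum>i\<le>e. smult (?a i) (power_quot u w (e - i + 2)))"
  proof (intro sum.cong refl arg_cong2[where f=smult])
    fix i assume i: "i \<in> {..e}"
    have "(\<Sum>m\<le>e. monom (lucas u w (m + 1 - i)) (e - m)) = (\<Sum>l\<le>e. monom (lucas u w (e - l + 1 - i)) l)"
      by (rule sum.reindex_bij_witness[of _ "\<lambda>l. e - l" "\<lambda>l. e - l"]) auto
    also have "\<dots> = (\<Sum>l<e - i + 2. monom (lucas u w (e - i + 2 - 1 - l)) l)"
      using i by (intro sum.mono_neutral_cong) (auto simp: add.commute)
    finally show "(\<Sum>m\<le>e. monom (lucas u w (m + 1 - i)) (e - m)) = power_quot u w (e - i + 2)"
      unfolding power_quot_def .
  qed
  finally show ?thesis .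
qed

text \<open>The values that \<open>a (e + 1)\<close> and \<open>a (e + 2)\<close> must have for \<open>quad u w\<close> to divide \<open>monic_poly (e + 2) a\<close>. They
involve only \<open>a 1\<close>, ..., \<open>a e\<close>, so for fixed values of these the pair is a map of the plane of the \<open>(u, w)\<close>.\<close>

definition rem1 :: "nat \<Rightarrow> real \<Rightarrow> real \<Rightarrow> (nat \<Rightarrow> real) \<Rightarrow> real" where
  "rem1 e u w a = - (\<Sum>i\<le>e. (if i = 0 then 1 else a i) * lucas u w (e - i + 2))"
definition rem0 :: "nat \<Rightarrow> real \<Rightarrow> real \<Rightarrow> (nat \<Rightarrow> real) \<Rightarrow> real" where
  "rem0 e u w a = w * (\<Sum>i\<le>e. (if i = 0 then 1 else a i) * lucas u w (e - i + 1))"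

lemma sum_pCons2: "(\<Sum>i\<in>I. [:f i, g i:]) = [:\<Sum>i\<in>I. f i, \<Sum>i\<in>I. g i:]" for f g :: "_ \<Rightarrow> real"
  by (induction I rule: infinite_finite_induct) auto

lemma monic_poly_division:
  "monic_poly (e + 2) a = quad u w * monic_poly e (quot_vec e u w a) +
     [:a (e + 2) - rem0 e u w a, a (e + 1) - rem1 e u w a:]"
proof -
  let ?a = "\<lambda>i. if i = 0 then 1 else a i"
  have "[:0, 0, 1:] * monic_poly e a = (\<Sum>i\<le>e. smult (?a i) (monom 1 (e - i + 2)))"
    unfolding monic_poly_eq_sum sum_distrib_left
    by (intro sum.cong refl) (simp add: monom_Suc smult_monom)
  also have "\<dots> = (\<Sum>i\<le>e. quad u w * smult (?a i) (power_quot u w (e - i + 2)) +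
      [:?a i * lucas_const u w (e - i + 2), ?a i * lucas u w (e - i + 2):])"
    by (subst monom_eq_quad_mult[of _ u w]) (simp add: smult_add_right)
  also have "\<dots> = quad u w * monic_poly e (quot_vec e u w a) +
      [:\<Sum>i\<le>e. ?a i * lucas_const u w (e - i + 2), \<Sum>i\<le>e. ?a i * lucas u w (e - i + 2):]"
    unfolding sum.distrib monic_poly_quot_vec sum_distrib_left sum_pCons2 ..
  also have "(\<Sum>i\<le>e. ?a i * lucas_const u w (e - i + 2)) = - rem0 e u w a"
    unfolding rem0_def lucas_const_def sum_negf[symmetric] sum_distrib_left
    by (intro sum.cong refl) simp
  also have "(\<Sum>i\<le>e. ?a i * lucas u w (e - i + 2)) = - rem1 e u w a" by (simp add: rem1_def)
  finally show ?thesis unfolding monic_poly_split by (simp add: algebra_simps)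
qed

lemma quad_dvd_small:
  assumes "quad u w dvd p" "degree p < 2" shows "p = 0"
  using assms dvd_imp_degree_le[of "quad u w" p] by fastforce

lemma quad_dvd_monic_poly_iff:
  "quad u w dvd monic_poly (e + 2) a \<longleftrightarrow> a (e + 1) = rem1 e u w a \<and> a (e + 2) = rem0 e u w a"
proof -
  have "quad u w dvd monic_poly (e + 2) a \<longleftrightarrow>
      quad u w dvd [:a (e + 2) - rem0 e u w a, a (e + 1) - rem1 e u w a:]"
    unfolding monic_poly_division[of e a u w] by (rule dvd_add_right_iff) simp
  also have "\<dots> \<longleftrightarrow> [:a (e + 2) - rem0 e u w a, a (e + 1) - rem1 e u w a:] = 0"
    using quad_dvd_small[of u w "[:a (e + 2) - rem0 e u w a, a (e + 1) - rem1 e u w a:]"] by auto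
  finally show ?thesis by auto
qed

lemma monic_poly_quotient:
  assumes "quad u w dvd monic_poly (e + 2) a"
  shows "monic_poly (e + 2) a = quad u w * monic_poly e (quot_vec e u w a)"
  using assms monic_poly_division[of e a u w] unfolding quad_dvd_monic_poly_iff by simp

text \<open>The resultant of \<open>quad u w\<close> and \<open>h\<close>: if \<open>r0 + r1 X\<close> is the remainder of \<open>h\<close>, this is \<open>(r0 + r1 x) (r0 + r1 y)\<close> for
the roots \<open>x\<close> and \<open>y\<close> of \<open>quad u w\<close>.\<close>

definition res :: "real \<Rightarrow> real \<Rightarrow> real poly \<Rightarrow> real" where
  "res u w h = (let r = h mod quad u w in
     (coeff r 0)\<^sup>2 - u * coeff r 0 * coeff r 1 + w * (coeff r 1)\<^sup>2)"

lemma mod_quad_eq: "h mod quad u w = [:coeff (h mod quad u w) 0, coeff (h mod quad u w) 1:]"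
proof -
  have "degree (h mod quad u w) < 2"
    using degree_mod_less[of "quad u w" h] by auto
  then show ?thesis
    by (auto simp: poly_eq_iff coeff_pCons coeff_eq_0 split: nat.split)
qed

lemma res_eqI:
  assumes "h = quad u w * k + [:r0, r1:]"
  shows "res u w h = r0\<^sup>2 - u * r0 * r1 + w * r1\<^sup>2"
proof -
  have "h mod quad u w = [:r0, r1:]"
    unfolding assms by (simp add: mod_poly_less degree_pCons_eq_if)
  then show ?thesis by (simp add: res_def)
qed

abbreviation cpoly :: "real poly \<Rightarrow> complex poly" where "cpoly \<equiv> map_poly complex_of_real"

lemma cpoly_add: "cpoly (p + q) = cpoly p + cpoly q"
  by (rule poly_eqI) (simp add: coeff_map_poly)

lemma cpoly_mult: "cpoly (p * q) = cpoly p * cpoly q"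
  by (rule poly_eqI) (simp add: coeff_map_poly coeff_mult)

lemma res_eq_prod_roots:
  assumes "x + y = - of_real u" "x * y = of_real w"
  shows "of_real (res u w h) = poly (cpoly h) x * poly (cpoly h) y"
proof -
  define r0 r1 where "r0 = coeff (h mod quad u w) 0" and "r1 = coeff (h mod quad u w) 1"
  have h: "h = quad u w * (h div quad u w) + [:r0, r1:]"
    using mod_quad_eq[of h u w] by (metis mult_div_mod_eq r0_def r1_def)
  have cp: "cpoly h = cpoly (quad u w) * cpoly (h div quad u w) + cpoly [:r0, r1:]"
    by (subst h) (simp only: cpoly_add cpoly_mult)
  have u: "of_real u = - (x + y)" using assms by (metis minus_minus)
  have q: "cpoly (quad u w) = [:x * y, - (x + y), 1:]" using assms u by (simp add: quad_def map_poly_pCons)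
  have q0: "poly (cpoly (quad u w)) x = 0" "poly (cpoly (quad u w)) y = 0"
    unfolding q by (simp_all add: algebra_simps)
  have "poly (cpoly h) x = of_real r0 + of_real r1 * x" "poly (cpoly h) y = of_real r0 + of_real r1 * y"
    unfolding cp using q0 by (simp_all add: map_poly_pCons)
  then have "poly (cpoly h) x * poly (cpoly h) y = of_real r0 ^ 2 - of_real u * of_real r0 * of_real r1 + of_real w * of_real r1 ^ 2"
    unfolding u assms(2)[symmetric] by (simp add: algebra_simps power2_eq_square)
  then show ?thesis unfolding res_eqI[OF h] by simp
qed

text \<open>A nonzero resultant makes \<open>h\<close> invertible modulo \<open>quad u w\<close>. The two identities at the end invert multiplication
by \<open>h\<close> with the adjugate matrix.\<close>

lemma res_nonzero_small:
  assumes "res u w h \<noteq> 0" "degree l < 2" "quad u w dvd l * h"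
  shows "l = 0"
proof -
  define r0 r1 where "r0 = coeff (h mod quad u w) 0" and "r1 = coeff (h mod quad u w) 1"
  have h: "h = quad u w * (h div quad u w) + [:r0, r1:]"
    using mod_quad_eq[of h u w] by (metis mult_div_mod_eq r0_def r1_def)
  define l0 l1 where "l0 = coeff l 0" and "l1 = coeff l 1"
  have l: "l = [:l0, l1:]" using assms(2)
    by (auto simp: poly_eq_iff coeff_pCons coeff_eq_0 l0_def l1_def split: nat.split)
  have "l * h = quad u w * (l * (h div quad u w) + [:l1 * r1:]) + [:l0 * r0 - w * l1 * r1, l0 * r1 + l1 * r0 - u * l1 * r1:]"
  proof -
    have "l * h = quad u w * (l * (h div quad u w)) + [:l0, l1:] * [:r0, r1:]"
      by (subst h) (simp only: l algebra_simps)
    also have "[:l0, l1:] * [:r0, r1:] = quad u w * [:l1 * r1:] + [:l0 * r0 - w * l1 * r1, l0 * r1 + l1 * r0 - u * l1 * r1:]"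
      by (simp add: quad_def algebra_simps)
    finally show ?thesis by (simp only: distrib_left add.assoc)
  qed
  then have "quad u w dvd [:l0 * r0 - w * l1 * r1, l0 * r1 + l1 * r0 - u * l1 * r1:]"
    using assms(3) by (metis dvd_add_right_iff dvd_triv_left)
  then have "[:l0 * r0 - w * l1 * r1, l0 * r1 + l1 * r0 - u * l1 * r1:] = 0"
    by (rule quad_dvd_small) (simp add: degree_pCons_eq_if)
  then have e: "l0 * r0 - w * l1 * r1 = 0" "l0 * r1 + l1 * r0 - u * l1 * r1 = 0" by auto
  have n: "r0\<^sup>2 - u * r0 * r1 + w * r1\<^sup>2 \<noteq> 0" using assms(1) unfolding res_eqI[OF h] .
  have "l0 * (r0\<^sup>2 - u * r0 * r1 + w * r1\<^sup>2)
      = (r0 - u * r1) * (l0 * r0 - w * l1 * r1) + w * r1 * (l0 * r1 + l1 * r0 - u * l1 * r1)"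
    "l1 * (r0\<^sup>2 - u * r0 * r1 + w * r1\<^sup>2)
      = r0 * (l0 * r1 + l1 * r0 - u * l1 * r1) - r1 * (l0 * r0 - w * l1 * r1)"
    by (simp_all add: algebra_simps power2_eq_square)
  then show ?thesis using n l unfolding e by simp
qed

text \<open>Up to sign the derivative of the Lucas sequence: in \<open>u\<close> it is \<open>- dlucas u w k\<close> and in \<open>w\<close> it is \<open>- dlucas u w (k - 1)\<close>.
The same numbers describe the quotients \<open>power_quot\<close> modulo \<open>quad u w\<close>, which is why the Jacobian of the remainder map is a
resultant.\<close>

fun dlucas :: "real \<Rightarrow> real \<Rightarrow> nat \<Rightarrow> real" where
  "dlucas u w 0 = 0"
| "dlucas u w (Suc 0) = 0"
| "dlucas u w (Suc (Suc k)) = lucas u w (Suc k) - u * dlucas u w (Suc k) - w * dlucas u w k"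

lemma dlucas_Suc: "dlucas u w (Suc k) = lucas u w k - u * dlucas u w k - w * dlucas u w (k - 1)"
  by (cases k) auto

lemma power_quot_mod:
  "\<exists>s. power_quot u w (Suc k) = quad u w * s + [:dlucas u w (Suc k) + u * dlucas u w k, dlucas u w k:]"
proof (induction k)
  case 0
  show ?case by (rule exI[of _ 0]) (simp add: power_quot_def)
next
  case (Suc k)
  then obtain s where s: "power_quot u w (Suc k) = quad u w * s + [:dlucas u w (Suc k) + u * dlucas u w k, dlucas u w k:]" ..
  show ?case
    unfolding power_quot_Suc[of _ _ "Suc k"] s
    by (rule exI[of _ "pCons 0 s + [:dlucas u w k:]"]) (simp add: quad_def algebra_simps)
qed

text \<open>The remainder of the quotient polynomial modulo \<open>quad u w\<close> is \<open>(qr2 + u * qr1) + qr1 * X\<close>.\<close>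

definition qr1 :: "nat \<Rightarrow> real \<Rightarrow> real \<Rightarrow> (nat \<Rightarrow> real) \<Rightarrow> real" where
  "qr1 e u w a = (\<Sum>i\<le>e. (if i = 0 then 1 else a i) * dlucas u w (e - i + 1))"
definition qr2 :: "nat \<Rightarrow> real \<Rightarrow> real \<Rightarrow> (nat \<Rightarrow> real) \<Rightarrow> real" where
  "qr2 e u w a = (\<Sum>i\<le>e. (if i = 0 then 1 else a i) * dlucas u w (e - i + 2))"

lemma res_quot_vec:
  "res u w (monic_poly e (quot_vec e u w a)) =
     (qr2 e u w a + u * qr1 e u w a) * qr2 e u w a + w * (qr1 e u w a)\<^sup>2"
proof -
  let ?a = "\<lambda>i. if i = 0 then 1 else a i"
  obtain s where s: "\<And>k. power_quot u w (Suc k) = quad u w * s k + [:dlucas u w (Suc k) + u * dlucas u w k, dlucas u w k:]"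
    using power_quot_mod[of u w] by metis
  have "monic_poly e (quot_vec e u w a) = (\<Sum>i\<le>e. quad u w * smult (?a i) (s (e - i + 1)) +
      [:?a i * (dlucas u w (e - i + 2) + u * dlucas u w (e - i + 1)), ?a i * dlucas u w (e - i + 1):])"
    unfolding monic_poly_quot_vec
    by (intro sum.cong refl) (simp add: s smult_add_right)
  also have "\<dots> = quad u w * (\<Sum>i\<le>e. smult (?a i) (s (e - i + 1))) + [:qr2 e u w a + u * qr1 e u w a, qr1 e u w a:]"
    unfolding sum.distrib sum_pCons2 sum_distrib_left
    by (simp add: qr1_def qr2_def sum.distrib[symmetric] sum_distrib_left algebra_simps)
  finally have "res u w (monic_poly e (quot_vec e u w a)) = (qr2 e u w a + u * qr1 e u w a)\<^sup>2
      - u * (qr2 e u w a + u * qr1 e u w a) * qr1 e u w a + w * (qr1 e u w a)\<^sup>2"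
    by (rule res_eqI)
  then show ?thesis by (simp add: algebra_simps power2_eq_square)
qed

lemma has_derivative_lucas:
  "((\<lambda>x::real^2. lucas (x $ 1) (x $ 2) k) has_derivative
     (\<lambda>v. - dlucas (x $ 1) (x $ 2) k * v $ 1 - dlucas (x $ 1) (x $ 2) (k - 1) * v $ 2)) (at x)"
proof (induction k rule: lucas.induct[of "\<lambda>u w k. _ k"])
  case (1 u w)
  show ?case by simp
next
  case (2 u w)
  show ?case by simp
next
  case (3 u w k)
  have c: "((\<lambda>x::real^2. x $ i) has_derivative (\<lambda>v. v $ i)) (at x)" for i
    by (rule bounded_linear_imp_has_derivative[OF bounded_linear_vec_nth])
  show ?case
    unfolding lucas.simps
    by (rule has_derivative_eq_rhs, (rule derivative_intros c 3)+)
       (auto simp: fun_eq_iff algebra_simps dlucas_Suc[of _ _ k] simp del: One_nat_def)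
qed

section \<open>Quadratic factors and signs of resultants\<close>

text \<open>Removing the largest element reverses the sign of each of the other terms and itself contributes \<open>1\<close>.\<close>

lemma sum_sgn_differences:
  fixes X :: "real set"
  assumes "finite X"
  shows "(\<Sum>x\<in>X. \<Prod>z\<in>X - {x}. sgn (x - z)) = of_bool (odd (card X))"
  using assms
proof (induction X rule: finite_linorder_max_induct)
  case empty
  show ?case by simp
next
  case (insert b X)
  then have b: "b \<notin> X" by auto
  have "(\<Prod>z\<in>insert b X - {x}. sgn (x - z)) = - (\<Prod>z\<in>X - {x}. sgn (x - z))" if "x \<in> X" for x
  proof -
    have "insert b X - {x} = insert b (X - {x})" using that b by auto
    then show ?thesis using insert that b by simp
  qed
  moreover have "(\<Prod>z\<in>insert b X - {b}. sgn (b - z)) = 1"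
    by (rule prod.neutral) (use insert in auto)
  ultimately show ?case using insert b by (simp add: sum_negf)
qed

text \<open>This is the contribution of the real roots to the sum of signs of resultants. For pairs below the largest element \<open>b\<close>
the factor of \<open>b\<close> is positive, and the pairs \<open>(x, b)\<close> contribute as in \<open>sum_sgn_differences\<close>, so the sum grows by one at every
second step.\<close>

lemma sum_sgn_pairs:
  fixes X :: "real set"
  assumes "finite X"
  shows "(\<Sum>(x, y) | x \<in> X \<and> y \<in> X \<and> x < y. \<Prod>z\<in>X - {x, y}. sgn ((x - z) * (y - z))) = real (card X div 2)"
  using assms
proof (induction X rule: finite_linorder_max_induct)
  case empty
  show ?case by simp
next
  case (insert b X)
  then have b: "b \<notin> X" by auto
  let ?P = "{(x, y). x \<in> X \<and> y \<in> X \<and> x < y}"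
  let ?f = "\<lambda>X (x, y). \<Prod>z\<in>X - {x, y}. sgn ((x - z) * (y - z))"
  have fin: "finite ?P" by (rule finite_subset[of _ "X \<times> X"]) (use insert in auto)
  have e: "{(x, y). x \<in> insert b X \<and> y \<in> insert b X \<and> x < y} = ?P \<union> (\<lambda>x. (x, b)) ` X"
    using insert by (auto dest: less_asym)
  have "?f (insert b X) q = ?f X q" if "q \<in> ?P" for q
  proof -
    obtain x y where "q = (x, y)" by (cases q)
    then have q: "q = (x, y)" "x \<in> X" "y \<in> X" "x < y" using that by simp_all
    have "insert b X - {x, y} = insert b (X - {x, y})" using q b by auto
    moreover have "sgn ((x - b) * (y - b)) = 1" using insert q by (simp add: mult_neg_neg)
    ultimately show ?thesis using insert b q by simp
  qed
  then have 1: "(\<Sum>q\<in>?P. ?f (insert b X) q) = real (card X div 2)"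
    using insert.IH by simp
  have "?f (insert b X) (x, b) = (\<Prod>z\<in>X - {x}. sgn (x - z))" if "x \<in> X" for x
  proof -
    have "insert b X - {x, b} = X - {x}" using that b by auto
    then show ?thesis using insert by (auto intro!: prod.cong simp: sgn_mult)
  qed
  then have 2: "(\<Sum>q\<in>(\<lambda>x. (x, b)) ` X. ?f (insert b X) q) = of_bool (odd (card X))"
    using sum_sgn_differences[of X] insert by (subst sum.reindex) (auto simp: inj_on_def)
  have "(\<Sum>q | q \<in> ?P \<union> (\<lambda>x. (x, b)) ` X. ?f (insert b X) q) = real (card X div 2) + of_bool (odd (card X))"
    unfolding Collect_mem_eq using fin insert b
    by (subst sum.union_disjoint) (auto simp: 1 2)
  then show ?case unfolding e Collect_mem_eq using insert b by (auto elim!: evenE oddE)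
qed

definition upper_roots :: "real poly \<Rightarrow> complex set" where
  "upper_roots p = {z. Im z > 0 \<and> poly (cpoly p) z = 0}"

definition schur_stable :: "real poly \<Rightarrow> bool" where
  "schur_stable p \<longleftrightarrow> (\<forall>z. poly (cpoly p) z = 0 \<longrightarrow> cmod z < 1)"

text \<open>Restricting to simple roots costs only a null set and makes the weight multiplicative on coprime factors.\<close>

definition weight :: "real \<Rightarrow> real poly \<Rightarrow> real" where
  "weight t p = (if schur_stable p \<and> rsquarefree (cpoly p) then t ^ card (upper_roots p) else 0)"

lemma poly_cpoly_of_real [simp]: "poly (cpoly p) (of_real x) = of_real (poly p x)"
  by (induction p) (auto simp: map_poly_pCons)

lemma poly_cpoly_cnj: "poly (cpoly p) (cnj z) = cnj (poly (cpoly p) z)"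
  by (induction p) (auto simp: map_poly_pCons)

lemma cpoly_eq_0_iff [simp]: "cpoly p = 0 \<longleftrightarrow> p = 0"
  by (auto simp: poly_eq_iff coeff_map_poly)

lemma degree_cpoly [simp]: "degree (cpoly p) = degree p"
  by (rule degree_map_poly) auto

lemma quad_roots:
  obtains x y where "x + y = - of_real u" "x * y = of_real w" "poly (cpoly (quad u w)) x = 0" "poly (cpoly (quad u w)) y = 0"
proof -
  have "\<not> constant (poly (cpoly (quad u w)))"
    by (simp add: constant_degree)
  then obtain x where x: "poly (cpoly (quad u w)) x = 0" using fundamental_theorem_of_algebra by blast
  define y where "y = - of_real u - x"
  have e: "of_real w + x * (of_real u + x) = 0" using x by (simp add: quad_def map_poly_pCons)
  show ?thesis
  proof (rule that[of x y])
    show "x + y = - of_real u" by (simp add: y_def)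
    have "- (x * (of_real u + x)) = of_real w" by (rule minus_unique) (use e in \<open>simp add: add.commute\<close>)
    moreover have "x * y = - (x * (of_real u + x))" "y * (of_real u + y) = - (x * y)" by (simp_all add: y_def algebra_simps)
    ultimately show "x * y = of_real w" "poly (cpoly (quad u w)) y = 0" by (simp_all add: quad_def map_poly_pCons)
  qed (fact x)
qed

lemma poly_quad_roots:
  assumes "x + y = - of_real u" "x * y = of_real w"
  shows "poly (cpoly (quad u w)) z = (z - x) * (z - y)"
proof -
  have u: "of_real u = - (x + y)" using assms by (metis minus_minus)
  show ?thesis unfolding quad_def by (simp add: map_poly_pCons u assms(2)[symmetric] algebra_simps)
qed

lemma res_zero_iff_common_root:
  "res u w h = 0 \<longleftrightarrow> (\<exists>z. poly (cpoly (quad u w)) z = 0 \<and> poly (cpoly h) z = 0)"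
proof -
  obtain x y where xy: "x + y = - of_real u" "x * y = of_real w" "poly (cpoly (quad u w)) x = 0" "poly (cpoly (quad u w)) y = 0"
    using quad_roots .
  have "res u w h = 0 \<longleftrightarrow> poly (cpoly h) x * poly (cpoly h) y = 0"
    unfolding res_eq_prod_roots[OF xy(1,2), symmetric] by simp
  then show ?thesis using poly_quad_roots[OF xy(1,2)] by auto
qed

lemma finite_quad_divisors:
  assumes "p \<noteq> 0"
  shows "finite {(u, w). quad u w dvd p}"
proof -
  let ?Z = "{z. poly (cpoly p) z = 0}"
  have "finite ?Z" using assms by (simp add: poly_roots_finite)
  then have "finite ((\<lambda>(x, y). (- Re (x + y), Re (x * y))) ` (?Z \<times> ?Z))" by auto
  moreover have "{(u, w). quad u w dvd p} \<subseteq> (\<lambda>(x, y). (- Re (x + y), Re (x * y))) ` (?Z \<times> ?Z)"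
  proof clarify
    fix u w assume d: "quad u w dvd p"
    obtain x y where xy: "x + y = - of_real u" "x * y = of_real w" "poly (cpoly (quad u w)) x = 0" "poly (cpoly (quad u w)) y = 0"
      using quad_roots .
    have "x \<in> ?Z" "y \<in> ?Z" using d xy(3,4) by (auto simp: cpoly_mult elim!: dvdE)
    then have "(x, y) \<in> ?Z \<times> ?Z" by simp
    moreover have "(u, w) = (\<lambda>(x, y). (- Re (x + y), Re (x * y))) (x, y)"
      using arg_cong[OF xy(1), of Re] arg_cong[OF xy(2), of Re] by simp
    ultimately show "(u, w) \<in> (\<lambda>(x, y). (- Re (x + y), Re (x * y))) ` (?Z \<times> ?Z)" by blast
  qed
  ultimately show ?thesis by (rule finite_subset[rotated])
qed

lemma pderiv_cpoly: "pderiv (cpoly p) = cpoly (pderiv p)"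
  by (rule poly_eqI) (simp add: coeff_pderiv coeff_map_poly)

text \<open>A common zero of a product and its derivative is one of exactly one factor if the factors have no common zero.\<close>

lemma rsquarefree_cpoly_mult:
  assumes "\<And>z. poly (cpoly q) z = 0 \<Longrightarrow> poly (cpoly h) z \<noteq> 0"
  shows "rsquarefree (cpoly (q * h)) \<longleftrightarrow> rsquarefree (cpoly q) \<and> rsquarefree (cpoly h)"
  using assms unfolding rsquarefree_roots cpoly_mult by (auto simp: pderiv_mult)

lemma finite_upper_roots [simp]: "p \<noteq> 0 \<Longrightarrow> finite (upper_roots p)"
  unfolding upper_roots_def by (rule finite_subset[of _ "{z. poly (cpoly p) z = 0}"]) (auto simp: poly_roots_finite)

lemma weight_mult:
  assumes "res u w h \<noteq> 0" "h \<noteq> 0"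
  shows "weight t (quad u w * h) = weight t (quad u w) * weight t h"
proof -
  have n: "poly (cpoly h) z \<noteq> 0" if "poly (cpoly (quad u w)) z = 0" for z
    using that assms(1) unfolding res_zero_iff_common_root by blast
  have s: "schur_stable (quad u w * h) \<longleftrightarrow> schur_stable (quad u w) \<and> schur_stable h"
    by (auto simp: schur_stable_def cpoly_mult)
  have "upper_roots (quad u w * h) = upper_roots (quad u w) \<union> upper_roots h"
    by (auto simp: upper_roots_def cpoly_mult)
  moreover have "upper_roots (quad u w) \<inter> upper_roots h = {}" using n by (auto simp: upper_roots_def)
  ultimately have "card (upper_roots (quad u w * h)) = card (upper_roots (quad u w)) + card (upper_roots h)"
    using assms(2) by (simp add: card_Un_disjoint)
  then show ?thesis by (simp add: weight_def s rsquarefree_cpoly_mult[OF n] power_add)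
qed

lemma card_roots_cpoly:
  assumes "rsquarefree (cpoly p)"
  shows "card {x. poly p x = 0} + 2 * card (upper_roots p) = degree p"
proof -
  let ?Z = "{z. poly (cpoly p) z = 0}" and ?R = "{x. poly p x = 0}"
  have p0: "p \<noteq> 0" using assms by (auto simp: rsquarefree_def)
  have fR: "finite ?R" using p0 by (rule poly_roots_finite)
  have e: "?Z = of_real ` ?R \<union> (upper_roots p \<union> cnj ` upper_roots p)"
  proof (intro equalityI subsetI)
    fix z assume z: "z \<in> ?Z"
    consider "Im z > 0" | "Im z < 0" | "Im z = 0" by linarith
    then show "z \<in> of_real ` ?R \<union> (upper_roots p \<union> cnj ` upper_roots p)"
    proof cases
      case 1 then show ?thesis using z by (auto simp: upper_roots_def)
    next
      case 2
      then have "cnj z \<in> upper_roots p" using z by (auto simp: upper_roots_def poly_cpoly_cnj)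
      then have "cnj (cnj z) \<in> cnj ` upper_roots p" by blast
      then show ?thesis by simp
    next
      case 3
      then have zr: "z = of_real (Re z)" by (simp add: complex_eq_iff)
      have "poly (cpoly p) (of_real (Re z)) = 0" using z zr by simp
      then have "Re z \<in> ?R" by simp
      then show ?thesis using zr by blast
    qed
  qed (auto simp: upper_roots_def poly_cpoly_cnj)
  have fU: "finite (upper_roots p)" using p0 by simp
  have im: "0 < Im z" if "z \<in> upper_roots p" for z using that by (simp add: upper_roots_def)
  have re: "Im z = 0" if "z \<in> of_real ` ?R" for z using that by auto
  have nre: "Im z \<noteq> 0" if "z \<in> upper_roots p \<union> cnj ` upper_roots p" for z using that by (auto dest: im)
  have dis: "of_real ` ?R \<inter> (upper_roots p \<union> cnj ` upper_roots p) = {}" using re nre by blast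
  have "card ?Z = card (of_real ` ?R :: complex set) + card (upper_roots p \<union> cnj ` upper_roots p)"
    unfolding e by (rule card_Un_disjoint[OF _ _ dis]) (use fU fR in auto)
  also have "card (upper_roots p \<union> cnj ` upper_roots p) = card (upper_roots p) + card (cnj ` upper_roots p)"
    by (rule card_Un_disjoint) (use fU in \<open>auto dest!: im\<close>)
  also have "card (cnj ` upper_roots p) = card (upper_roots p)" by (rule card_image) (auto simp: inj_on_def)
  also have "card (of_real ` ?R :: complex set) = card ?R" by (rule card_image) (auto simp: inj_on_def)
  finally have "card ?Z = card ?R + 2 * card (upper_roots p)" by simp
  moreover have "card ?Z = degree (cpoly p)"
  proof -
    have "degree (cpoly p) = degree (smult (lead_coeff (cpoly p)) (\<Prod>z\<in>?Z. [:- z, 1:]))"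
      by (simp only: complex_poly_decompose_rsquarefree[OF assms])
    also have "\<dots> = degree (\<Prod>z\<in>?Z. [:- z, 1:])"
    proof -
      have "lead_coeff (cpoly p) \<noteq> 0" by (rule leading_coeff_neq_0) (use p0 in simp)
      then show ?thesis by (simp only: degree_smult_eq if_False)
    qed
    also have "\<dots> = (\<Sum>z\<in>?Z. degree [:- z, 1:])" by (rule degree_prod_sum_eq) simp
    finally show ?thesis by simp
  qed
  ultimately show ?thesis by simp
qed

lemma prod_roots_factor:
  fixes p :: "'a::idom poly"
  assumes "finite S" "\<And>x. x \<in> S \<Longrightarrow> poly p x = 0"
  shows "\<exists>k. p = (\<Prod>z\<in>S. [:- z, 1:]) * k"
  using assms
proof (induction S rule: finite_induct)
  case (insert x S)
  then obtain k where k: "p = (\<Prod>z\<in>S. [:- z, 1:]) * k" by auto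
  have "poly (\<Prod>z\<in>S. [:- z, 1:]) x * poly k x = 0" using insert.prems k by (metis insertI1 poly_mult)
  moreover have "poly (\<Prod>z\<in>S. [:- z, 1:]) x \<noteq> 0" using insert.hyps by (auto simp: poly_prod)
  ultimately have "poly k x = 0" by simp
  then obtain k' where "k = [:- x, 1:] * k'" by (auto simp: poly_eq_0_iff_dvd elim: dvdE)
  then have "p = (\<Prod>z\<in>insert x S. [:- z, 1:]) * k'" using k insert.hyps by (simp add: mult_ac del: mult_pCons_left mult_pCons_right)
  then show ?case ..
qed auto

lemma quad_dvd_if_roots:
  assumes "x + y = - of_real u" "x * y = of_real w" "x \<noteq> y" "poly (cpoly p) x = 0" "poly (cpoly p) y = 0"
  shows "quad u w dvd p"
proof -
  define r0 r1 where "r0 = coeff (p mod quad u w) 0" and "r1 = coeff (p mod quad u w) 1"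
  have h: "p = quad u w * (p div quad u w) + [:r0, r1:]"
    using mod_quad_eq[of p u w] by (metis mult_div_mod_eq r0_def r1_def)
  have cp: "cpoly p = cpoly (quad u w) * cpoly (p div quad u w) + cpoly [:r0, r1:]"
    by (subst h) (simp only: cpoly_add cpoly_mult)
  have "of_real r0 + of_real r1 * x = 0" "of_real r0 + of_real r1 * y = 0"
    using assms(4,5) unfolding cp
    by (simp_all add: poly_quad_roots[OF assms(1,2)] map_poly_pCons mult.commute)
  note e = this
  have "of_real r1 * (x - y) = (of_real r0 + of_real r1 * x) - (of_real r0 + of_real r1 * y)" by (simp add: algebra_simps)
  then have "of_real r1 * (x - y) = 0" "of_real r0 + of_real r1 * x = 0" by (simp_all only: e diff_self)
  then have "r1 = 0" "r0 = 0" using assms(3) by auto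
  then show ?thesis using h by (metis add.right_neutral dvd_triv_left pCons_0_0)
qed

lemma sgn_prod_real: "sgn (\<Prod>z\<in>A. f z) = (\<Prod>z\<in>A. sgn (f z :: real))"
  by (induction A rule: infinite_finite_induct) (simp_all add: sgn_mult)

text \<open>A quadratic divisor of \<open>p\<close> has either two real roots or a conjugate pair of roots. For a conjugate pair the resultant is
\<open>p / q\<close> times its conjugate at a root, hence positive. For two real roots \<open>x\<close> and \<open>y\<close> the conjugate pairs of other roots
contribute positive factors and the other real roots \<open>z\<close> the signs of \<open>(x - z) (y - z)\<close>, so \<open>sum_sgn_pairs\<close> applies.
The total is the number of conjugate pairs plus half the number of real roots, rounded down.\<close>

lemma sum_sgn_res:
  assumes "rsquarefree (cpoly p)"
  shows "(\<Sum>(u, w) | quad u w dvd p. sgn (res u w (p div quad u w))) = real (degree p div 2)"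
    and "quad u w dvd p \<Longrightarrow> res u w (p div quad u w) \<noteq> 0"
proof -
  let ?R = "{x. poly p x = 0}"
  let ?P = "{(x, y). x \<in> ?R \<and> y \<in> ?R \<and> x < y}"
  let ?f = "\<lambda>(x, y). (- (x + y), x * y) :: real \<times> real"
  let ?g = "\<lambda>z. (- 2 * Re z, (Re z)\<^sup>2 + (Im z)\<^sup>2)"
  let ?s = "\<lambda>(u, w). sgn (res u w (p div quad u w))"
  have p0: "p \<noteq> 0" using assms by (auto simp: rsquarefree_def)
  have fR: "finite ?R" using p0 by (rule poly_roots_finite)
  have simple: "\<not> (poly (cpoly p) z = 0 \<and> poly (cpoly (pderiv p)) z = 0)" for z
    using assms by (simp add: rsquarefree_roots pderiv_cpoly)
  show nz: "res u w (p div quad u w) \<noteq> 0" if "quad u w dvd p" for u w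
  proof
    assume "res u w (p div quad u w) = 0"
    then obtain z where z: "poly (cpoly (quad u w)) z = 0" "poly (cpoly (p div quad u w)) z = 0"
      unfolding res_zero_iff_common_root by auto
    have pe: "p = quad u w * (p div quad u w)" using that by simp
    have "poly (cpoly (quad u w * (p div quad u w))) z = 0" "poly (cpoly (pderiv (quad u w * (p div quad u w)))) z = 0"
      using z by (simp_all add: pderiv_mult cpoly_add cpoly_mult)
    then show False using simple pe by metis
  qed
  have g: "- 2 * Re z = u \<and> (Re z)\<^sup>2 + (Im z)\<^sup>2 = w \<longleftrightarrow> z + cnj z = - of_real u \<and> z * cnj z = of_real w" for z u w
    by (auto simp: complex_eq_iff power2_eq_square)
  have Q: "{(u, w). quad u w dvd p} = ?f ` ?P \<union> ?g ` upper_roots p"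
  proof (intro equalityI subsetI)
    fix q assume "q \<in> ?f ` ?P \<union> ?g ` upper_roots p"
    then consider x y where "q = ?f (x, y)" "poly p x = 0" "poly p y = 0" "x < y"
      | z where "q = ?g z" "poly (cpoly p) z = 0" "Im z > 0" by (auto simp: upper_roots_def)
    then show "q \<in> {(u, w). quad u w dvd p}"
    proof cases
      case (1 x y)
      have "quad (- (x + y)) (x * y) dvd p"
        by (rule quad_dvd_if_roots[of "of_real x" "of_real y"]) (use 1 in simp_all)
      then show ?thesis using 1(1) by simp
    next
      case (2 z)
      have "z \<noteq> cnj z" using 2(3) by (auto simp: complex_eq_iff)
      moreover have "z + cnj z = - of_real (fst q) \<and> z * cnj z = of_real (snd q)"
        using g[of z "fst q" "snd q"] 2(1) by simp
      ultimately have "quad (fst q) (snd q) dvd p"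
        by (intro quad_dvd_if_roots[of z "cnj z"]) (use 2 in \<open>simp_all add: poly_cpoly_cnj\<close>)
      then show ?thesis by (simp add: case_prod_beta)
    qed
  next
    fix q assume "q \<in> {(u, w). quad u w dvd p}"
    then obtain u w where q: "q = (u, w)" and d: "quad u w dvd p" by auto
    obtain x y where xy: "x + y = - of_real u" "x * y = of_real w"
      "poly (cpoly (quad u w)) x = 0" "poly (cpoly (quad u w)) y = 0"
      using quad_roots .
    have px: "poly (cpoly p) x = 0" "poly (cpoly p) y = 0" using d xy(3,4) by (auto simp: cpoly_mult elim!: dvdE)
    have "x \<noteq> y"
    proof
      assume "x = y"
      then have "complex_of_real u = - (x + x)" using xy(1) by simp
      then have q': "poly (cpoly (pderiv (quad u w))) x = 0" by (simp add: quad_def pderiv_pCons map_poly_pCons)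
      obtain k where "p = quad u w * k" using d unfolding dvd_def by blast
      then have "poly (cpoly (pderiv p)) x = 0" using xy(3) q' by (simp add: pderiv_mult cpoly_add cpoly_mult)
      then show False using simple px by blast
    qed
    have im: "Im x = - Im y" "Re x * Im y + Im x * Re y = 0" using xy(1,2) by (auto simp: complex_eq_iff)
    then have "Im y * (Re x - Re y) = 0" by (simp add: algebra_simps)
    then consider "Im y = 0" | "Re x = Re y" by auto
    then show "q \<in> ?f ` ?P \<union> ?g ` upper_roots p"
    proof cases
      case 1
      define a b where "a = Re x" and "b = Re y"
      have r: "x = of_real a" "y = of_real b" using 1 im(1) by (auto simp: complex_eq_iff a_def b_def)
      have ab: "poly p a = 0" "poly p b = 0" "a \<noteq> b" using px \<open>x \<noteq> y\<close> r by auto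
      have "u = - (a + b)" "w = a * b"
        using arg_cong[OF xy(1), of Re] arg_cong[OF xy(2), of Re] unfolding r by simp_all
      then have "q = ?f (a, b)" "q = ?f (b, a)" using q by auto
      moreover have "(a, b) \<in> ?P \<or> (b, a) \<in> ?P" using ab by (simp add: linorder_neq_iff)
      ultimately show ?thesis by blast
    next
      case 2
      have c: "y = cnj x" using 2 im(1) by (auto simp: complex_eq_iff)
      then have "Im x \<noteq> 0" using \<open>x \<noteq> y\<close> by (auto simp: complex_eq_iff)
      define z where "z = (if Im x > 0 then x else y)"
      have "z \<in> upper_roots p" using \<open>Im x \<noteq> 0\<close> px im(1) by (auto simp: z_def upper_roots_def)
      moreover have "z + cnj z = - of_real u \<and> z * cnj z = of_real w" using xy(1,2) c by (auto simp: z_def add.commute mult.commute)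
      then have "q = ?g z" unfolding q using g[of z u w] by auto
      ultimately show ?thesis by blast
    qed
  qed
  have injf: "inj_on ?f ?P"
  proof (rule inj_onI)
    fix r s assume rs: "r \<in> ?P" "s \<in> ?P" "?f r = ?f s"
    obtain x y a b where e: "r = (x, y)" "s = (a, b)" by (cases r, cases s) auto
    have l: "x < y" "a < b" "x + y = a + b" "x * y = a * b" using rs e by auto
    have "(x - a) * (x - b) = x * x - x * (a + b) + a * b" by (simp add: algebra_simps)
    also have "\<dots> = 0" unfolding l(3,4)[symmetric] by (simp add: algebra_simps)
    finally have "x = a \<or> x = b" by simp
    then show "r = s" using l e by auto
  qed
  have injg: "inj_on ?g (upper_roots p)"
    by (rule inj_onI) (auto simp: upper_roots_def complex_eq_iff power2_eq_iff)
  have disj: "?f ` ?P \<inter> ?g ` upper_roots p = {}"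
  proof -
    have False if "x < y" "Im z > 0" "x + y = 2 * Re z" "x * y = (Re z)\<^sup>2 + (Im z)\<^sup>2" for x y z
    proof -
      have "(y - x)\<^sup>2 = (x + y)\<^sup>2 - 4 * (x * y)" by (simp add: power2_eq_square algebra_simps)
      also have "\<dots> = - 4 * (Im z)\<^sup>2" unfolding that(3,4) by (simp add: power2_eq_square algebra_simps)
      finally show False using that(1,2) by (smt (verit) zero_less_power2)
    qed
    then show ?thesis by (fastforce simp: upper_roots_def)
  qed
  define P where "P = (\<Prod>z\<in>?R. [:- z, 1:])"
  obtain k where k: "p = P * k" using prod_roots_factor[OF fR] unfolding P_def by auto
  have P0: "poly P x = 0" if "x \<in> ?R" for x
    unfolding P_def poly_prod using fR that by (auto simp: prod_zero_iff)
  have k0: "poly k x \<noteq> 0" for x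
  proof
    assume x: "poly k x = 0"
    then have p: "poly p x = 0" unfolding k by simp
    then have "poly P x = 0" by (intro P0) simp
    then have "poly (pderiv p) x = 0" unfolding k pderiv_mult using x by simp
    then show False using simple[of "of_real x"] p by simp
  qed
  have kk: "poly k x * poly k y > 0" for x y
  proof (rule ccontr)
    assume "\<not> poly k x * poly k y > 0"
    then have n: "poly k x * poly k y < 0" using k0[of x] k0[of y] by (simp add: not_less less_le)
    then have "x \<noteq> y" by (auto simp: not_less)
    then show False using n poly_IVT[of x y k] poly_IVT[of y x k] k0 by (force simp: linorder_neq_iff mult.commute)
  qed
  have sP: "?s (?f (x, y)) = (\<Prod>z\<in>?R - {x, y}. sgn ((x - z) * (y - z)))" if xy: "(x, y) \<in> ?P" for x y
  proof -
    have "P = [:- x, 1:] * ([:- y, 1:] * (\<Prod>z\<in>?R - {x, y}. [:- z, 1:]))"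
    proof -
      have "?R = insert x (insert y (?R - {x, y}))" using xy by auto
      then have "P = (\<Prod>z\<in>insert x (insert y (?R - {x, y})). [:- z, 1:])" unfolding P_def by (rule prod.cong) simp
      also have "\<dots> = [:- x, 1:] * ([:- y, 1:] * (\<Prod>z\<in>?R - {x, y}. [:- z, 1:]))"
        using xy fR by (simp del: mult_pCons_left mult_pCons_right)
      finally show ?thesis .
    qed
    note PT = this
    define T where "T = (\<Prod>z\<in>?R - {x, y}. [:- z, 1:])"
    define q where "q = quad (- (x + y)) (x * y)"
    have P: "P = [:- x, 1:] * ([:- y, 1:] * T)" unfolding T_def by (rule PT)
    have "q = [:- x, 1:] * [:- y, 1:]" by (simp add: q_def quad_def)
    then have pe: "p = q * (T * k)" unfolding k P by (simp only: mult.assoc)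
    have "q \<noteq> 0" by (simp add: q_def)
    then have h: "p div q = T * k" by (subst pe) simp
    have "complex_of_real (res (- (x + y)) (x * y) (T * k)) = of_real (poly (T * k) x * poly (T * k) y)"
      by (subst res_eq_prod_roots[of "of_real x" "of_real y"]) (simp_all only: poly_cpoly_of_real of_real_mult of_real_add of_real_minus minus_minus)
    then have "res (- (x + y)) (x * y) (T * k) = poly (T * k) x * poly (T * k) y"
      by (simp only: of_real_eq_iff)
    also have "\<dots> = (\<Prod>z\<in>?R - {x, y}. (x - z) * (y - z)) * (poly k x * poly k y)"
      by (simp add: T_def poly_prod prod.distrib)
    finally have e: "res (- (x + y)) (x * y) (T * k) = (\<Prod>z\<in>?R - {x, y}. (x - z) * (y - z)) * (poly k x * poly k y)" .
    have "?s (?f (x, y)) = sgn (res (- (x + y)) (x * y) (p div q))" unfolding q_def by simp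
    also have "\<dots> = sgn (\<Prod>z\<in>?R - {x, y}. (x - z) * (y - z)) * sgn (poly k x * poly k y)"
      unfolding h e by (rule sgn_mult)
    also have "sgn (poly k x * poly k y) = 1" using kk[of x y] by simp
    also have "sgn (\<Prod>z\<in>?R - {x, y}. (x - z) * (y - z)) = (\<Prod>z\<in>?R - {x, y}. sgn ((x - z) * (y - z)))"
      by (rule sgn_prod_real)
    finally show ?thesis by (simp only: mult_1_right)
  qed
  have sg: "?s (?g z) = 1" if z: "z \<in> upper_roots p" for z
  proof -
    define u w where "u = fst (?g z)" and "w = snd (?g z)"
    have uw: "?g z = (u, w)" by (simp add: u_def w_def)
    have r: "z + cnj z = - of_real u" "z * cnj z = of_real w" using g[of z u w] by (simp_all add: u_def w_def)
    have "(u, w) \<in> {(u, w). quad u w dvd p}" unfolding Q uw[symmetric] using z by blast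
    then have n: "res u w (p div quad u w) \<noteq> 0" using nz by auto
    have "complex_of_real (res u w (p div quad u w)) = of_real ((cmod (poly (cpoly (p div quad u w)) z))\<^sup>2)"
      unfolding res_eq_prod_roots[OF r] poly_cpoly_cnj by (rule complex_norm_square[symmetric])
    then have "res u w (p div quad u w) = (cmod (poly (cpoly (p div quad u w)) z))\<^sup>2" by (simp only: of_real_eq_iff)
    then have "res u w (p div quad u w) > 0" using n by (metis zero_le_power2 less_le)
    then show ?thesis unfolding uw by simp
  qed
  have fP: "finite ?P" by (rule finite_subset[of _ "?R \<times> ?R"]) (use fR in auto)
  have "(\<Sum>q\<in>?f ` ?P \<union> ?g ` upper_roots p. ?s q) = (\<Sum>q\<in>?f ` ?P. ?s q) + (\<Sum>q\<in>?g ` upper_roots p. ?s q)"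
    by (rule sum.union_disjoint) (use fP p0 disj in auto)
  also have "(\<Sum>q\<in>?f ` ?P. ?s q) = (\<Sum>q\<in>?P. ?s (?f q))" by (subst sum.reindex[OF injf]) simp
  also have "\<dots> = (\<Sum>(x, y)\<in>?P. \<Prod>z\<in>?R - {x, y}. sgn ((x - z) * (y - z)))"
  proof (intro sum.cong refl)
    fix q assume "q \<in> ?P"
    then show "?s (?f q) = (case q of (x, y) \<Rightarrow> \<Prod>z\<in>?R - {x, y}. sgn ((x - z) * (y - z)))"
      using sP by (cases q) (simp only: prod.case)
  qed
  also have "\<dots> = real (card ?R div 2)" by (rule sum_sgn_pairs[OF fR])
  also have "(\<Sum>q\<in>?g ` upper_roots p. ?s q) = (\<Sum>z\<in>upper_roots p. ?s (?g z))" by (subst sum.reindex[OF injg]) simp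
  also have "\<dots> = real (card (upper_roots p))" by (rule trans[OF sum.cong[OF refl sg]]) simp_all
  also have "real (card ?R div 2) + real (card (upper_roots p)) = real (degree p div 2)"
    unfolding card_roots_cpoly[OF assms, symmetric] by simp
  finally have "(\<Sum>q\<in>{(u, w). quad u w dvd p}. ?s q) = real (degree p div 2)"
    unfolding Q .
  then show "(\<Sum>(u, w) | quad u w dvd p. sgn (res u w (p div quad u w))) = real (degree p div 2)" .
qed

text \<open>The weight is multiplicative and hence constant along the sum, so that only the signs are left to be summed.\<close>

lemma sum_weights_quadratic_factors:
  "(\<Sum>(u, w) | quad u w dvd monic_poly (e + 2) a \<and> res u w (monic_poly e (quot_vec e u w a)) \<noteq> 0.
      sgn (res u w (monic_poly e (quot_vec e u w a))) *
        (weight t (quad u w) * weight t (monic_poly e (quot_vec e u w a)))) =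
    real ((e + 2) div 2) * weight t (monic_poly (e + 2) a)"
proof -
  let ?p = "monic_poly (e + 2) a" and ?h = "\<lambda>u w. monic_poly e (quot_vec e u w a)"
  have div: "?p div quad u w = ?h u w" if "quad u w dvd ?p" for u w
    unfolding monic_poly_quotient[OF that] by simp
  have w: "weight t (quad u w) * weight t (?h u w) = weight t ?p"
    if "quad u w dvd ?p" "res u w (?h u w) \<noteq> 0" for u w
    unfolding monic_poly_quotient[OF that(1)] by (rule weight_mult[symmetric]) (use that in auto)
  have "(\<Sum>(u, w) | quad u w dvd ?p \<and> res u w (?h u w) \<noteq> 0.
      sgn (res u w (?h u w)) * (weight t (quad u w) * weight t (?h u w))) =
    (\<Sum>(u, w) | quad u w dvd ?p \<and> res u w (?h u w) \<noteq> 0. sgn (res u w (?h u w))) * weight t ?p"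
    unfolding sum_distrib_right by (intro sum.cong refl) (auto simp: w)
  also have "\<dots> = real ((e + 2) div 2) * weight t ?p"
  proof (cases "rsquarefree (cpoly ?p)")
    case False
    then show ?thesis by (simp add: weight_def)
  next
    case True
    have "{(u, w). quad u w dvd ?p \<and> res u w (?h u w) \<noteq> 0} = {(u, w). quad u w dvd ?p}"
      using sum_sgn_res(2)[OF True] div by (auto simp del: add_2_eq_Suc add_2_eq_Suc')
    moreover have "(\<Sum>(u, w) | quad u w dvd ?p. sgn (res u w (?h u w))) = (\<Sum>(u, w) | quad u w dvd ?p. sgn (res u w (?p div quad u w)))"
      by (intro sum.cong refl) (auto simp: div simp del: add_2_eq_Suc add_2_eq_Suc')
    ultimately show ?thesis using sum_sgn_res(1)[OF True] by simp
  qed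
  finally show ?thesis .
qed

section \<open>Measurability on the coefficient space\<close>

text \<open>Indices such as \<open>e + 1\<close> and the coordinate \<open>v $ 1\<close> should not be rewritten with the successor.\<close>

declare One_nat_def [simp del]

abbreviation lborel_dim :: "nat \<Rightarrow> (nat \<Rightarrow> real) measure" where
  "lborel_dim d \<equiv> Pi\<^sub>M {1..d} (\<lambda>_. lborel)"

lemma measurable_coordinate:
  "i \<in> I \<Longrightarrow> (\<lambda>a. a i) \<in> borel_measurable (Pi\<^sub>M I (\<lambda>_. lborel))"
  using measurable_component_singleton[of i I "\<lambda>_. lborel :: real measure"] by simp

interpretation lborel_product: product_sigma_finite "\<lambda>_. lborel :: real measure" ..

lemma atLeastAtMost_Suc_insert: "{1..Suc e} = insert (Suc e) {1..e}" by auto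

lemma measurable_lucas [measurable (raw)]:
  assumes f: "f \<in> borel_measurable M" and g: "g \<in> borel_measurable M"
  shows "(\<lambda>x. lucas (f x) (g x) k) \<in> borel_measurable M"
proof (induction k rule: induct_nat_012)
  case (ge2 k)
  show ?case unfolding lucas.simps
    by (intro borel_measurable_diff borel_measurable_times borel_measurable_uminus f g ge2)
qed simp_all

lemma measurable_quot_vec:
  assumes f: "f \<in> borel_measurable M" and g: "g \<in> borel_measurable M" and h: "h \<in> measurable M (lborel_dim e)"
  shows "(\<lambda>x. quot_vec e (f x) (g x) (h x)) \<in> measurable M (lborel_dim e)"
  unfolding quot_vec_def
proof (rule measurable_restrict)
  fix m assume m: "m \<in> {1..e}"
  have hi: "(\<lambda>x. h x i) \<in> borel_measurable M" if "i \<in> {1..e}" for i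
    using measurable_compose[OF h measurable_coordinate[OF that]] .
  have "(\<lambda>x. (if i = 0 then 1 else h x i) * lucas (f x) (g x) (m + 1 - i)) \<in> borel_measurable M" if "i \<le> m" for i
  proof (rule borel_measurable_times[OF _ measurable_lucas[OF f g]])
    show "(\<lambda>x. if i = 0 then 1 else h x i) \<in> borel_measurable M"
      using m that by (cases "i = 0") (simp_all add: hi)
  qed
  then have "(\<lambda>x. \<Sum>i\<le>m. (if i = 0 then 1 else h x i) * lucas (f x) (g x) (m + 1 - i)) \<in> borel_measurable M"
    by (intro borel_measurable_sum) simp
  then show "(\<lambda>x. \<Sum>i\<le>m. (if i = 0 then 1 else h x i) * lucas (f x) (g x) (m + 1 - i)) \<in> measurable M lborel"
    by simp
qed

lemma nn_integral_lborel_shift: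
  fixes f :: "real \<Rightarrow> ennreal"
  assumes "f \<in> borel_measurable lborel"
  shows "(\<integral>\<^sup>+y. f (y + c) \<partial>lborel) = (\<integral>\<^sup>+y. f y \<partial>lborel)"
  using nn_integral_real_affine[of f 1 c] assms by (simp add: add.commute)

text \<open>For fixed \<open>u\<close> and \<open>w\<close> the map to the quotient is a composition of shears: the last coordinate is translated by an amount
that depends on the earlier ones.\<close>

lemma nn_integral_quot_vec:
  assumes "f \<in> borel_measurable (lborel_dim e)"
  shows "(\<integral>\<^sup>+a. f (quot_vec e u w a) \<partial>lborel_dim e) = (\<integral>\<^sup>+a. f a \<partial>lborel_dim e)"
  using assms
proof (induction e arbitrary: f)
  case 0
  show ?case by (intro nn_integral_cong) (auto simp: space_PiM quot_vec_def)
next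
  case (Suc e)
  note fm = Suc.prems[unfolded atLeastAtMost_Suc_insert]
  let ?c = "\<lambda>x. \<Sum>i\<le>e. (if i = 0 then 1 else x i) * lucas u w (e + 2 - i)"
  let ?F = "\<lambda>z. \<integral>\<^sup>+y. f (z(Suc e := y)) \<partial>lborel"
  have "quot_vec (Suc e) u w \<in> measurable (lborel_dim (Suc e)) (lborel_dim (Suc e))"
    by (rule measurable_quot_vec) auto
  note qm = measurable_compose[OF this Suc.prems, unfolded atLeastAtMost_Suc_insert]
  have upd: "(\<lambda>(z, y). z(Suc e := y)) \<in> measurable (lborel_dim e \<Otimes>\<^sub>M lborel) (Pi\<^sub>M (insert (Suc e) {1..e}) (\<lambda>_. lborel))"
    by (rule measurable_add_dim)
  have Fm: "?F \<in> borel_measurable (lborel_dim e)"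
  proof (rule lborel.borel_measurable_nn_integral)
    have "(\<lambda>p. f (case p of (z, y) \<Rightarrow> z(Suc e := y))) = (\<lambda>(z, y). f (z(Suc e := y)))" by auto
    then show "(\<lambda>(z, y). f (z(Suc e := y))) \<in> borel_measurable (lborel_dim e \<Otimes>\<^sub>M lborel)"
      using measurable_compose[OF upd fm] by (simp only:)
  qed
  have "(\<integral>\<^sup>+a. f (quot_vec (Suc e) u w a) \<partial>lborel_dim (Suc e)) =
      (\<integral>\<^sup>+x. \<integral>\<^sup>+y. f (quot_vec (Suc e) u w (x(Suc e := y))) \<partial>lborel \<partial>lborel_dim e)"
    unfolding atLeastAtMost_Suc_insert
    by (rule lborel_product.product_nn_integral_insert[OF _ _ qm]) simp_all
  also have "\<dots> = (\<integral>\<^sup>+x. ?F (quot_vec e u w x) \<partial>lborel_dim e)"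
  proof (rule nn_integral_cong)
    fix x :: "nat \<Rightarrow> real" assume x: "x \<in> space (lborel_dim e)"
    have e: "quot_vec (Suc e) u w (x(Suc e := y)) = (quot_vec e u w x)(Suc e := y + ?c x)" for y
    proof
      fix m
      consider "m = Suc e" | "m \<in> {1..e}" | "m \<notin> {1..Suc e}" by fastforce
      then show "quot_vec (Suc e) u w (x(Suc e := y)) m = ((quot_vec e u w x)(Suc e := y + ?c x)) m"
      proof cases
        case 1
        have "(\<Sum>i\<le>e. (if i = 0 then 1 else (x(Suc e := y)) i) * lucas u w (Suc e + 1 - i)) = ?c x"
          by (intro sum.cong refl) (auto simp: One_nat_def)
        then show ?thesis using 1 by (simp add: quot_vec_def One_nat_def)
      next
        case 2
        then show ?thesis by (auto simp: quot_vec_def intro!: sum.cong)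
      next
        case 3
        then show ?thesis by (auto simp: quot_vec_def)
      qed
    qed
    have q: "quot_vec e u w x \<in> space (lborel_dim e)" by (auto simp: quot_vec_def space_PiM)
    have "(\<lambda>y. f ((quot_vec e u w x)(Suc e := y))) \<in> borel_measurable lborel"
      using measurable_compose[OF measurable_Pair1'[OF q, of "lborel"] measurable_compose[OF upd fm]] by (simp only: prod.case)
    from nn_integral_lborel_shift[OF this, of "?c x"]
    show "(\<integral>\<^sup>+y. f (quot_vec (Suc e) u w (x(Suc e := y))) \<partial>lborel) = ?F (quot_vec e u w x)"
      unfolding e .
  qed
  also have "\<dots> = (\<integral>\<^sup>+z. ?F z \<partial>lborel_dim e)" by (rule Suc.IH[OF Fm])
  also have "\<dots> = (\<integral>\<^sup>+a. f a \<partial>lborel_dim (Suc e))"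
    unfolding atLeastAtMost_Suc_insert
    by (rule lborel_product.product_nn_integral_insert[OF _ _ fm, symmetric]) simp_all
  finally show ?case .
qed

lemma distr_eqI_nn_integral:
  assumes T: "T \<in> measurable M N"
    and eq: "\<And>f. f \<in> borel_measurable N \<Longrightarrow> (\<integral>\<^sup>+x. f (T x) \<partial>M) = (\<integral>\<^sup>+y. f y \<partial>N)"
  shows "distr M N T = N"
proof (rule measure_eqI)
  fix A assume "A \<in> sets (distr M N T)"
  then have A: "A \<in> sets N" by simp
  then have i: "indicator A \<in> borel_measurable N" by (rule borel_measurable_indicator)
  have "emeasure (distr M N T) A = (\<integral>\<^sup>+y. indicator A y \<partial>distr M N T)" using A by simp
  also have "\<dots> = (\<integral>\<^sup>+x. indicator A (T x) \<partial>M)" by (rule nn_integral_distr[OF T]) (simp add: i)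
  also have "\<dots> = (\<integral>\<^sup>+y. indicator A y \<partial>N)" by (rule eq[OF i])
  also have "\<dots> = emeasure N A" using A by simp
  finally show "emeasure (distr M N T) A = emeasure N A" .
qed simp

lemma distr_quot_vec: "distr (lborel_dim e) (lborel_dim e) (quot_vec e u w) = lborel_dim e"
  by (rule distr_eqI_nn_integral[OF measurable_quot_vec nn_integral_quot_vec])
    (rule measurable_const measurable_ident_sets UNIV_I refl | simp)+

lemma integral_quot_vec:
  fixes f :: "(nat \<Rightarrow> real) \<Rightarrow> real"
  assumes "f \<in> borel_measurable (lborel_dim e)"
  shows "(\<integral>a. f (quot_vec e u w a) \<partial>lborel_dim e) = (\<integral>a. f a \<partial>lborel_dim e)"
proof -
  have q: "quot_vec e u w \<in> measurable (lborel_dim e) (lborel_dim e)"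
    by (rule measurable_quot_vec) auto
  have "(\<integral>a. f a \<partial>lborel_dim e) = (\<integral>a. f a \<partial>distr (lborel_dim e) (lborel_dim e) (quot_vec e u w))"
    by (simp only: distr_quot_vec)
  also have "\<dots> = (\<integral>a. f (quot_vec e u w a) \<partial>lborel_dim e)" by (rule integral_distr[OF q assms])
  finally show ?thesis by (rule sym)
qed

text \<open>By compactness a zero exists iff the values come arbitrarily close to \<open>0\<close>, and by continuity this can be tested on a
countable dense subset.\<close>

lemma sets_ex_zero:
  fixes F :: "'a \<Rightarrow> 'b::euclidean_space \<Rightarrow> real"
  assumes K: "compact K" and meas: "\<And>z. (\<lambda>a. F a z) \<in> borel_measurable M"
    and cont: "\<And>a. continuous_on K (F a)" and nonneg: "\<And>a z. F a z \<ge> 0"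
  shows "{a \<in> space M. \<exists>z\<in>K. F a z = 0} \<in> sets M"
proof -
  obtain T where T: "countable T" "T \<subseteq> K" "K \<subseteq> closure T" using separable[of K] by blast
  have "(\<exists>z\<in>K. F a z = 0) \<longleftrightarrow> (\<forall>n. \<exists>z\<in>T. F a z < 1 / real (Suc n))" for a
  proof
    assume "\<exists>z\<in>K. F a z = 0"
    then obtain z where z: "z \<in> K" "F a z = 0" by auto
    show "\<forall>n. \<exists>z\<in>T. F a z < 1 / real (Suc n)"
    proof
      fix n
      obtain d where d: "d > 0" "\<And>y. y \<in> K \<Longrightarrow> dist y z < d \<Longrightarrow> dist (F a y) (F a z) < 1 / real (Suc n)"
        using cont[of a] z(1) unfolding continuous_on_iff by (metis of_nat_0_less_iff zero_less_Suc zero_less_divide_1_iff)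
      obtain y where "y \<in> T" "dist y z < d" using z(1) T(3) d(1) closure_approachable[of z T] by blast
      then show "\<exists>z\<in>T. F a z < 1 / real (Suc n)" using d(2)[of y] T(2) z(2) by (intro bexI[of _ y]) (auto simp: dist_real_def)
    qed
  next
    assume *: "\<forall>n. \<exists>z\<in>T. F a z < 1 / real (Suc n)"
    then have "K \<noteq> {}" using T(2) by blast
    then obtain z where z: "z \<in> K" "\<And>y. y \<in> K \<Longrightarrow> F a z \<le> F a y"
      using continuous_attains_inf[OF K _ cont[of a]] by blast
    have "F a z = 0"
    proof (rule ccontr)
      assume "F a z \<noteq> 0"
      then have "F a z > 0" using nonneg[of a z] by simp
      then obtain n where n: "1 / real (Suc n) < F a z" using nat_approx_posE by metis
      obtain y where "y \<in> T" "F a y < 1 / real (Suc n)" using * by blast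
      then show False using z(2)[of y] T(2) n by auto
    qed
    then show "\<exists>z\<in>K. F a z = 0" using z(1) by blast
  qed
  then have "{a \<in> space M. \<exists>z\<in>K. F a z = 0} = (\<Inter>n. \<Union>z\<in>T. {a \<in> space M. F a z < 1 / real (Suc n)})"
    by auto
  also have "\<dots> \<in> sets M"
  proof -
    have "{a \<in> space M. F a z < c} \<in> sets M" for z c using meas[of z] by measurable
    then have "(\<Union>z\<in>T. {a \<in> space M. F a z < 1 / real (Suc n)}) \<in> sets M" for n
      by (intro sets.countable_UN'' T(1))
    then show ?thesis by (intro sets.countable_INT image_subsetI) auto
  qed
  finally show ?thesis .
qed

lemma measurable_coeff_monic_poly [measurable]:
  "(\<lambda>a. coeff (monic_poly d a) k) \<in> borel_measurable (lborel_dim d)"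
  unfolding coeff_monic_poly by (cases "k < d") (auto intro!: measurable_coordinate)

lemma measurable_poly_monic_poly [measurable]:
  "(\<lambda>a. poly (cpoly (monic_poly d a)) z) \<in> borel_measurable (lborel_dim d)"
  "(\<lambda>a. poly (cpoly (pderiv (monic_poly d a))) z) \<in> borel_measurable (lborel_dim d)"
  "(\<lambda>a. poly (monic_poly d a) x) \<in> borel_measurable (lborel_dim d)"
  by (simp_all add: poly_altdef coeff_map_poly degree_pderiv coeff_pderiv)

text \<open>Having a root outside the open unit disc is the existence of a zero on one of countably many compact annuli.\<close>

lemma sets_stable: "{a \<in> space (lborel_dim d). schur_stable (monic_poly d a)} \<in> sets (lborel_dim d)"
proof -
  let ?K = "\<lambda>n. cball 0 (real n) - ball (0::complex) 1"
  have "schur_stable p \<longleftrightarrow> \<not> (\<exists>n. \<exists>z\<in>?K n. cmod (poly (cpoly p) z) = 0)" for p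
  proof
    assume "\<not> (\<exists>n. \<exists>z\<in>?K n. cmod (poly (cpoly p) z) = 0)"
    moreover have "z \<in> ?K (nat \<lceil>cmod z\<rceil>)" if "cmod z \<ge> 1" for z using that by (auto simp: of_nat_ceiling)
    ultimately show "schur_stable p" unfolding schur_stable_def by (metis norm_zero not_less)
  qed (auto simp: schur_stable_def not_less)
  then have "{a \<in> space (lborel_dim d). schur_stable (monic_poly d a)} = space (lborel_dim d) -
      (\<Union>n. {a \<in> space (lborel_dim d). \<exists>z\<in>?K n. cmod (poly (cpoly (monic_poly d a)) z) = 0})" by auto
  also have "\<dots> \<in> sets (lborel_dim d)"
  proof (intro sets.Diff sets.top sets.countable_UN)
    show "range (\<lambda>n. {a \<in> space (lborel_dim d). \<exists>z\<in>?K n. cmod (poly (cpoly (monic_poly d a)) z) = 0}) \<subseteq> sets (lborel_dim d)"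
    proof (intro image_subsetI sets_ex_zero)
      show "compact (?K n)" for n by (intro compact_diff compact_cball open_ball)
    qed (auto intro!: continuous_intros)
  qed
  finally show ?thesis .
qed

lemma sets_rsquarefree: "{a \<in> space (lborel_dim d). rsquarefree (cpoly (monic_poly d a))} \<in> sets (lborel_dim d)"
proof -
  let ?F = "\<lambda>a z. cmod (poly (cpoly (monic_poly d a)) z) + cmod (poly (cpoly (pderiv (monic_poly d a))) z)"
  have "rsquarefree (cpoly (monic_poly d a)) \<longleftrightarrow> \<not> (\<exists>n. \<exists>z\<in>cball 0 (real n). ?F a z = 0)" for a
  proof -
    have "(\<exists>n. \<exists>z\<in>cball 0 (real n). P z) \<longleftrightarrow> (\<exists>z. P z)" for P :: "complex \<Rightarrow> bool"
      by (metis mem_cball_0 real_arch_simple)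
    note this[of "\<lambda>z. ?F a z = 0"]
    then show ?thesis unfolding rsquarefree_roots pderiv_cpoly
      by (auto simp: add_nonneg_eq_0_iff)
  qed
  then have "{a \<in> space (lborel_dim d). rsquarefree (cpoly (monic_poly d a))} = space (lborel_dim d) -
      (\<Union>n. {a \<in> space (lborel_dim d). \<exists>z\<in>cball 0 (real n). ?F a z = 0})" by auto
  also have "\<dots> \<in> sets (lborel_dim d)"
  proof (intro sets.Diff sets.top sets.countable_UN)
    show "range (\<lambda>n. {a \<in> space (lborel_dim d). \<exists>z\<in>cball 0 (real n). ?F a z = 0}) \<subseteq> sets (lborel_dim d)"
      by (intro image_subsetI sets_ex_zero) (auto intro!: continuous_intros)
  qed
  finally show ?thesis .
qed

text \<open>On a fine enough grid distinct points lie in distinct cells. This turns the number of roots into countably many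
conditions about the existence of a root in an interval.\<close>

lemma card_ge_iff_separated:
  fixes R :: "real set"
  assumes "finite R"
  shows "k \<le> card R \<longleftrightarrow>
    (\<exists>n::nat. \<exists>T\<in>{T::int set. finite T \<and> card T = k}. \<forall>j\<in>T. \<exists>x\<in>R. \<lfloor>x * real n\<rfloor> = j)"
proof
  assume "k \<le> card R"
  then obtain S where S: "S \<subseteq> R" "card S = k" "finite S" using assms by (meson obtain_subset_with_card_n finite_subset)
  have "eventually (\<lambda>n. \<lfloor>x * real n\<rfloor> \<noteq> \<lfloor>y * real n\<rfloor>) sequentially" if "x \<noteq> y" for x y :: real
  proof -
    have "0 < \<bar>x - y\<bar>" using that by simp
    then obtain N where N: "1 < real N * \<bar>x - y\<bar>" using reals_Archimedean3 by blast
    have "\<lfloor>x * real n\<rfloor> \<noteq> \<lfloor>y * real n\<rfloor>" if "n \<ge> N" for n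
    proof
      assume "\<lfloor>x * real n\<rfloor> = \<lfloor>y * real n\<rfloor>"
      then have "\<bar>x * real n - y * real n\<bar> < 1" by linarith
      then have "real n * \<bar>x - y\<bar> < 1" by (simp add: abs_mult left_diff_distrib[symmetric] mult.commute)
      moreover have "real N * \<bar>x - y\<bar> \<le> real n * \<bar>x - y\<bar>" using that by (intro mult_right_mono) auto
      ultimately show False using N by linarith
    qed
    then show ?thesis by (auto simp: eventually_sequentially)
  qed
  then have "eventually (\<lambda>n. \<forall>x\<in>S. \<forall>y\<in>S. x \<noteq> y \<longrightarrow> \<lfloor>x * real n\<rfloor> \<noteq> \<lfloor>y * real n\<rfloor>) sequentially"
    using S(3) by (intro eventually_ball_finite ballI) auto
  then obtain n where n: "\<forall>x\<in>S. \<forall>y\<in>S. x \<noteq> y \<longrightarrow> \<lfloor>x * real n\<rfloor> \<noteq> \<lfloor>y * real n\<rfloor>"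
    by (auto simp: eventually_sequentially)
  then have "card ((\<lambda>x. \<lfloor>x * real n\<rfloor>) ` S) = k" using S(2) by (subst card_image) (auto simp: inj_on_def)
  then show "\<exists>n::nat. \<exists>T\<in>{T::int set. finite T \<and> card T = k}. \<forall>j\<in>T. \<exists>x\<in>R. \<lfloor>x * real n\<rfloor> = j"
    using S by (intro exI[of _ n] bexI[of _ "(\<lambda>x. \<lfloor>x * real n\<rfloor>) ` S"]) auto
next
  assume "\<exists>n::nat. \<exists>T\<in>{T::int set. finite T \<and> card T = k}. \<forall>j\<in>T. \<exists>x\<in>R. \<lfloor>x * real n\<rfloor> = j"
  then obtain n T where T: "finite T" "card T = k" "\<forall>j\<in>T. \<exists>x\<in>R. \<lfloor>x * real n\<rfloor> = j" by auto
  then have "T \<subseteq> (\<lambda>x. \<lfloor>x * real n\<rfloor>) ` R" by auto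
  then show "k \<le> card R" using surj_card_le[OF assms] T(2) by auto
qed

lemma sets_card_real_roots_ge:
  "{a \<in> space (lborel_dim d). k \<le> card {x. poly (monic_poly d a) x = 0}} \<in> sets (lborel_dim d)"
proof -
  \<comment> \<open>The half-open cells of the grid are exhausted by compact intervals \<open>?I n m j\<close>.\<close>
  let ?I = "\<lambda>n m j. {x \<in> cball 0 (real m). real_of_int j \<le> x * real n \<and> x * real n \<le> real_of_int j + 1 - 1 / real (Suc m)}"
  have fl: "(\<exists>x\<in>R. \<lfloor>x * real n\<rfloor> = j) \<longleftrightarrow> (\<exists>m. \<exists>x\<in>?I n m j. x \<in> R)" for R :: "real set" and n j
  proof
    assume "\<exists>x\<in>R. \<lfloor>x * real n\<rfloor> = j"
    then obtain x where x: "x \<in> R" "real_of_int j \<le> x * real n" "x * real n < real_of_int j + 1"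
      by (auto simp: floor_eq_iff)
    then obtain m0 where m0: "1 / real (Suc m0) < real_of_int j + 1 - x * real n"
      using nat_approx_posE[of "real_of_int j + 1 - x * real n"] by auto
    define m where "m = max m0 (nat \<lceil>\<bar>x\<bar>\<rceil>)"
    have "1 / real (Suc m) \<le> 1 / real (Suc m0)" by (intro divide_left_mono) (auto simp: m_def)
    moreover have "\<bar>x\<bar> \<le> real m" unfolding m_def by linarith
    ultimately have "x \<in> ?I n m j" using x(2) m0 by simp
    then show "\<exists>m. \<exists>x\<in>?I n m j. x \<in> R" using x(1) by blast
  next
    assume "\<exists>m. \<exists>x\<in>?I n m j. x \<in> R"
    then obtain m x where x: "x \<in> R" "real_of_int j \<le> x * real n" "x * real n \<le> real_of_int j + 1 - 1 / real (Suc m)" by auto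
    moreover have "1 / real (Suc m) > 0" by simp
    ultimately have "\<lfloor>x * real n\<rfloor> = j" unfolding floor_eq_iff by linarith
    then show "\<exists>x\<in>R. \<lfloor>x * real n\<rfloor> = j" using x(1) by blast
  qed
  have "{a \<in> space (lborel_dim d). k \<le> card {x. poly (monic_poly d a) x = 0}} =
    (\<Union>n::nat. \<Union>T\<in>{T::int set. finite T \<and> card T = k}. {a \<in> space (lborel_dim d). \<forall>j\<in>T. \<exists>m. \<exists>x\<in>?I n m j. \<bar>poly (monic_poly d a) x\<bar> = 0})"
    by (subst card_ge_iff_separated) (auto simp: poly_roots_finite fl)
  also have "\<dots> \<in> sets (lborel_dim d)"
  proof (intro sets.countable_UN'' countable_subset[OF _ countable_Collect_finite])
    fix n :: nat and T :: "int set" assume "T \<in> {T. finite T \<and> card T = k}"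
    then have fT: "finite T" by simp
    have s: "{a \<in> space (lborel_dim d). \<exists>m. \<exists>x\<in>?I n m j. \<bar>poly (monic_poly d a) x\<bar> = 0} \<in> sets (lborel_dim d)" for j
    proof -
      have "{a \<in> space (lborel_dim d). \<exists>x\<in>?I n m j. \<bar>poly (monic_poly d a) x\<bar> = 0} \<in> sets (lborel_dim d)" for m
      proof (rule sets_ex_zero)
        have "?I n m j = cball 0 (real m) \<inter> ({x. real_of_int j \<le> x * real n} \<inter> {x. x * real n \<le> real_of_int j + 1 - 1 / real (Suc m)})" by auto
        moreover have "closed ({x. real_of_int j \<le> x * real n} \<inter> {x. x * real n \<le> real_of_int j + 1 - 1 / real (Suc m)})"
          by (intro closed_Int closed_Collect_le continuous_intros)
        ultimately show "compact (?I n m j)" by (metis compact_Int_closed compact_cball)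
      qed (auto intro!: continuous_intros)
      then have "(\<Union>m. {a \<in> space (lborel_dim d). \<exists>x\<in>?I n m j. \<bar>poly (monic_poly d a) x\<bar> = 0}) \<in> sets (lborel_dim d)"
        by (intro sets.countable_UN) auto
      moreover have "{a \<in> space (lborel_dim d). \<exists>m. \<exists>x\<in>?I n m j. \<bar>poly (monic_poly d a) x\<bar> = 0} =
        (\<Union>m. {a \<in> space (lborel_dim d). \<exists>x\<in>?I n m j. \<bar>poly (monic_poly d a) x\<bar> = 0})" by auto
      ultimately show ?thesis by simp
    qed
    show "{a \<in> space (lborel_dim d). \<forall>j\<in>T. \<exists>m. \<exists>x\<in>?I n m j. \<bar>poly (monic_poly d a) x\<bar> = 0} \<in> sets (lborel_dim d)"
      by (rule sets.sets_Collect_finite_All[OF s fT])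
  qed auto
  finally show ?thesis .
qed

text \<open>For simple roots the number of conjugate pairs is determined by the number of real roots, which is measurable.\<close>

lemma measurable_weight [measurable]:
  "(\<lambda>a. weight t (monic_poly d a)) \<in> borel_measurable (lborel_dim d)"
proof -
  let ?c = "\<lambda>a. card {x. poly (monic_poly d a) x = 0}"
  have [measurable]: "Measurable.pred (lborel_dim d) (\<lambda>a. k \<le> ?c a)"
      "Measurable.pred (lborel_dim d) (\<lambda>a. schur_stable (monic_poly d a))"
      "Measurable.pred (lborel_dim d) (\<lambda>a. rsquarefree (cpoly (monic_poly d a)))" for k
    unfolding pred_def by (rule sets_card_real_roots_ge sets_stable sets_rsquarefree)+
  have [measurable]: "?c \<in> measurable (lborel_dim d) (count_space UNIV)"
  proof (rule measurable_count_space_eq2_countable[THEN iffD2], intro conjI ballI)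
    fix k :: nat
    have "?c -` {k} \<inter> space (lborel_dim d) = {a \<in> space (lborel_dim d). k \<le> ?c a \<and> \<not> Suc k \<le> ?c a}" by auto
    also have "\<dots> \<in> sets (lborel_dim d)" by measurable
    finally show "?c -` {k} \<inter> space (lborel_dim d) \<in> sets (lborel_dim d)" .
  qed auto
  have "weight t (monic_poly d a) = (if schur_stable (monic_poly d a) \<and> rsquarefree (cpoly (monic_poly d a))
      then t ^ ((d - ?c a) div 2) else 0)" for a
  proof (cases "rsquarefree (cpoly (monic_poly d a))")
    case True
    have "d - ?c a = 2 * card (upper_roots (monic_poly d a))"
      using card_roots_cpoly[OF True] by simp
    then show ?thesis by (simp add: weight_def)
  qed (simp add: weight_def)
  then show ?thesis by simp
qed

text \<open>Up to sign the coefficients are elementary symmetric functions of roots in the unit disc; multiplying by one linear factor at most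
doubles them.\<close>

lemma coeff_stable_bound:
  assumes "schur_stable p" "lead_coeff p = 1"
  shows "\<bar>coeff p k\<bar> \<le> 2 ^ degree p"
proof -
  have b: "cmod (coeff (\<Prod>i<n. [:- r i, 1:]) k) \<le> 2 ^ n" if "\<And>i. i < n \<Longrightarrow> cmod (r i) \<le> 1" for r n k
    using that
  proof (induction n arbitrary: k)
    case 0
    show ?case by simp
  next
    case (Suc n)
    define P where "P = (\<Prod>i<n. [:- r i, 1:])"
    have IH: "cmod (coeff P k) \<le> 2 ^ n" for k unfolding P_def using Suc by simp
    have "(\<Prod>i<Suc n. [:- r i, 1:]) = P * [:- r n, 1:]" unfolding P_def by (rule prod.lessThan_Suc)
    also have "\<dots> = pCons 0 P - smult (r n) P" by simp
    finally have "cmod (coeff (\<Prod>i<Suc n. [:- r i, 1:]) k) = cmod ((case k of 0 \<Rightarrow> 0 | Suc j \<Rightarrow> coeff P j) - r n * coeff P k)"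
      by (simp only: coeff_diff coeff_pCons coeff_smult)
    also have "\<dots> \<le> cmod (case k of 0 \<Rightarrow> 0 | Suc j \<Rightarrow> coeff P j) + cmod (r n * coeff P k)"
      by (rule norm_triangle_ineq4)
    also have "\<dots> \<le> 2 ^ n + 1 * 2 ^ n"
    proof (rule add_mono)
      show "cmod (case k of 0 \<Rightarrow> 0 | Suc j \<Rightarrow> coeff P j) \<le> 2 ^ n" using IH by (cases k) simp_all
      show "cmod (r n * coeff P k) \<le> 1 * 2 ^ n"
        unfolding norm_mult by (rule mult_mono) (use IH Suc.prems[of n] in simp_all)
    qed
    finally show ?case by simp
  qed
  obtain r where r: "smult (lead_coeff (cpoly p)) (\<Prod>i<degree (cpoly p). [:- r i, 1:]) = cpoly p"
    using complex_poly_decompose' .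
  moreover have "lead_coeff (cpoly p) = 1" using assms(2) by (simp add: coeff_map_poly)
  ultimately have r: "cpoly p = (\<Prod>i<degree p. [:- r i, 1:])" by simp
  have "cmod (r i) \<le> 1" if "i < degree p" for i
  proof -
    have "poly (cpoly p) (r i) = 0" unfolding r poly_prod using that by (intro prod_zero) auto
    then show ?thesis using assms(1) unfolding schur_stable_def by (meson less_imp_le)
  qed
  then have "cmod (coeff (cpoly p) k) \<le> 2 ^ degree p" unfolding r by (rule b)
  then show ?thesis by (simp add: coeff_map_poly)
qed

section \<open>Weighted integrals\<close>

lemma weight_abs_le_1: "0 \<le> t \<Longrightarrow> t \<le> 1 \<Longrightarrow> \<bar>weight t p\<bar> \<le> 1"
  by (simp add: weight_def power_le_one)

lemma weight_nonzero_stable: "weight t p \<noteq> 0 \<Longrightarrow> schur_stable p"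
  unfolding weight_def by (metis (full_types))

lemma integrable_on_box:
  fixes f :: "(nat \<Rightarrow> real) \<Rightarrow> real"
  assumes "f \<in> borel_measurable (lborel_dim d)" "\<And>a. \<bar>f a\<bar> \<le> C"
    "\<And>a i. f a \<noteq> 0 \<Longrightarrow> i \<in> {1..d} \<Longrightarrow> \<bar>a i\<bar> \<le> B"
  shows "integrable (lborel_dim d) f"
proof -
  let ?box = "PiE {1..d} (\<lambda>_. {-B..B})"
  have box: "?box \<in> sets (lborel_dim d)" by (rule sets_PiM_I_finite) auto
  have "emeasure (lborel_dim d) ?box = (\<Prod>i\<in>{1..d}. emeasure lborel {-B..B})"
    by (rule lborel_product.emeasure_PiM) auto
  also have "\<dots> < \<infinity>"
    by (auto simp: power_less_top_ennreal emeasure_lborel_Icc_eq)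
  finally have "integrable (lborel_dim d) (indicator ?box :: _ \<Rightarrow> real)"
    using box by (intro integrable_real_indicator)
  then have "integrable (lborel_dim d) (\<lambda>a. C * indicator ?box a)" by (rule integrable_mult_right)
  then show ?thesis
  proof (rule Bochner_Integration.integrable_bound[OF _ assms(1)], intro AE_I2)
    fix a assume a: "a \<in> space (lborel_dim d)"
    show "norm (f a) \<le> norm (C * indicator ?box a)"
    proof (cases "f a = 0")
      case False
      have aP: "a \<in> PiE {1..d} (\<lambda>_. UNIV)" using a by (simp only: space_PiM space_lborel space_borel)
      have "a \<in> ?box"
      proof (rule PiE_I)
        fix i assume "i \<in> {1..d}" then have "\<bar>a i\<bar> \<le> B" by (intro assms(3)[OF False])
        then show "a i \<in> {-B..B}" by (simp add: abs_le_iff)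
      next
        fix i assume "i \<notin> {1..d}" then show "a i = undefined" by (rule PiE_arb[OF aP])
      qed
      moreover have "\<bar>f a\<bar> \<le> \<bar>C\<bar>" using assms(2)[of a] by linarith
      ultimately show ?thesis by simp
    qed simp
  qed
qed

text \<open>The functions of polynomials for which weighted integrals converge: bounded on the stable polynomials, whose coefficients
form a bounded set.\<close>

definition test_fun :: "nat \<Rightarrow> (real poly \<Rightarrow> real) \<Rightarrow> bool" where
  "test_fun d g \<longleftrightarrow> (\<lambda>a. g (monic_poly d a)) \<in> borel_measurable (lborel_dim d) \<and>
     (\<exists>C. \<forall>p. degree p = d \<and> lead_coeff p = 1 \<and> schur_stable p \<longrightarrow> \<bar>g p\<bar> \<le> C)"

definition weighted_integral :: "real \<Rightarrow> nat \<Rightarrow> (real poly \<Rightarrow> real) \<Rightarrow> real" where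
  "weighted_integral t d g = (\<integral>a. weight t (monic_poly d a) * g (monic_poly d a) \<partial>lborel_dim d)"

lemma lead_coeff_monic_poly [simp]: "coeff (monic_poly d a) d = 1"
  by (simp add: coeff_monic_poly)

lemma stable_monic_poly_bound:
  assumes "schur_stable (monic_poly d a)" "i \<in> {1..d}"
  shows "\<bar>a i\<bar> \<le> 2 ^ d"
proof -
  have "a i = coeff (monic_poly d a) (d - i)" using assms(2) by (auto simp: coeff_monic_poly)
  then show ?thesis using coeff_stable_bound[OF assms(1), of "d - i"] by simp
qed

lemma integrable_weight_test_fun:
  assumes "test_fun d g" "0 \<le> t" "t \<le> 1"
  shows "integrable (lborel_dim d) (\<lambda>a. weight t (monic_poly d a) * g (monic_poly d a))"
proof -
  obtain C where C: "\<And>p. degree p = d \<Longrightarrow> lead_coeff p = 1 \<Longrightarrow> schur_stable p \<Longrightarrow> \<bar>g p\<bar> \<le> C"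
    using assms(1) unfolding test_fun_def by blast
  show ?thesis
  proof (rule integrable_on_box[where C = "\<bar>C\<bar>" and B = "2 ^ d"])
    show "(\<lambda>a. weight t (monic_poly d a) * g (monic_poly d a)) \<in> borel_measurable (lborel_dim d)"
      using assms(1) unfolding test_fun_def by (intro borel_measurable_times measurable_weight) blast
    fix a :: "nat \<Rightarrow> real"
    show "\<bar>weight t (monic_poly d a) * g (monic_poly d a)\<bar> \<le> \<bar>C\<bar>"
    proof (cases "weight t (monic_poly d a) = 0")
      case False
      then have "\<bar>g (monic_poly d a)\<bar> \<le> C" by (intro C weight_nonzero_stable) simp_all
      then have "\<bar>weight t (monic_poly d a)\<bar> * \<bar>g (monic_poly d a)\<bar> \<le> 1 * \<bar>C\<bar>"
        by (intro mult_mono weight_abs_le_1 assms) auto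
      then show ?thesis by (simp add: abs_mult)
    qed simp
    show "\<bar>a i\<bar> \<le> 2 ^ d" if "weight t (monic_poly d a) * g (monic_poly d a) \<noteq> 0" "i \<in> {1..d}" for i
      using that by (intro stable_monic_poly_bound[OF weight_nonzero_stable]) auto
  qed
qed

definition vec2 :: "real \<times> real \<Rightarrow> real^2" where "vec2 p = (\<chi> i. if i = 1 then fst p else snd p)"

lemma vec2_nth [simp]: "vec2 p $ 1 = fst p" "vec2 p $ 2 = snd p" by (simp_all add: vec2_def)

lemma measurable_vec_nth: "(\<lambda>v::real^'n. v $ i) \<in> borel_measurable lborel"
  by (simp add: borel_measurable_continuous_onI continuous_on_component)

lemma measurable_vec2: "vec2 \<in> borel_measurable borel"
proof -
  have "vec2 = (\<lambda>p. fst p *\<^sub>R axis 1 1 + snd p *\<^sub>R axis 2 1)"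
    by (auto simp: fun_eq_iff Finite_Cartesian_Product.vec_eq_iff vec2_def axis_def forall_2)
  moreover have "continuous_on UNIV (\<lambda>p::real \<times> real. fst p *\<^sub>R (axis 1 1 :: real^2) + snd p *\<^sub>R axis 2 1)"
    by (intro continuous_intros)
  ultimately show ?thesis using borel_measurable_continuous_onI by metis
qed

text \<open>The plane is needed as \<open>real^2\<close> for the area formula and as a pair of coordinates for Fubini's theorem.\<close>

lemma distr_vec2: "distr lborel borel vec2 = lborel"
proof (rule lborel_eqI[symmetric])
  fix l u :: "real^2" assume le: "\<And>b. b \<in> Basis \<Longrightarrow> l \<bullet> b \<le> u \<bullet> b"
  have B: "(Basis :: (real^2) set) = {axis 1 1, axis 2 1}"
    by (auto simp: Basis_vec_def UNIV_2)
  have le': "l $ 1 \<le> u $ 1" "l $ 2 \<le> u $ 2"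
    using le[of "axis 1 1"] le[of "axis 2 1"] by (simp_all add: B inner_axis)
  have "vec2 -` box l u = {l $ 1<..<u $ 1} \<times> {l $ 2<..<u $ 2}"
    by (auto simp: box_def B inner_axis)
  then have "emeasure (distr lborel borel vec2) (box l u) = emeasure (lborel \<Otimes>\<^sub>M lborel) ({l $ 1<..<u $ 1} \<times> {l $ 2<..<u $ 2})"
    by (subst emeasure_distr) (auto simp: measurable_vec2 lborel_prod)
  also have "\<dots> = ennreal (u $ 1 - l $ 1) * ennreal (u $ 2 - l $ 2)"
    using le' by (subst lborel.emeasure_pair_measure_Times) auto
  also have "\<dots> = ennreal (\<Prod>b\<in>Basis. (u - l) \<bullet> b)"
    using le' by (simp add: B inner_axis axis_eq_axis ennreal_mult)
  finally show "emeasure (distr lborel borel vec2) (box l u) = ennreal (\<Prod>b\<in>Basis. (u - l) \<bullet> b)" .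
qed simp

lemma nn_integral_vec2:
  assumes "f \<in> borel_measurable (lborel :: (real^2) measure)"
  shows "(\<integral>\<^sup>+v. f v \<partial>lborel) = (\<integral>\<^sup>+y. \<integral>\<^sup>+z. f (vec2 (y, z)) \<partial>lborel \<partial>lborel)"
proof -
  have m: "(\<lambda>p. f (vec2 p)) \<in> borel_measurable (lborel \<Otimes>\<^sub>M lborel)"
    using measurable_compose[OF measurable_vec2, of f] assms by (simp add: lborel_prod)
  have "(\<integral>\<^sup>+v. f v \<partial>lborel) = (\<integral>\<^sup>+v. f v \<partial>distr lborel borel vec2)" by (simp only: distr_vec2)
  also have "\<dots> = (\<integral>\<^sup>+p. f (vec2 p) \<partial>lborel)"
    by (rule nn_integral_distr) (use assms measurable_vec2 in auto)
  also have "\<dots> = (\<integral>\<^sup>+p. f (vec2 p) \<partial>(lborel \<Otimes>\<^sub>M lborel))" by (simp only: lborel_prod)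
  also have "\<dots> = (\<integral>\<^sup>+y. \<integral>\<^sup>+z. f (vec2 (y, z)) \<partial>lborel \<partial>lborel)"
    by (rule lborel.nn_integral_fst[symmetric, OF m])
  finally show ?thesis .
qed

definition extend_vec :: "nat \<Rightarrow> (nat \<Rightarrow> real) \<Rightarrow> real^2 \<Rightarrow> nat \<Rightarrow> real" where
  "extend_vec e x v = x(e + 1 := v $ 1, e + 2 := v $ 2)"

lemma measurable_lborel_dimI:
  assumes "\<And>i. i \<in> {1..d} \<Longrightarrow> (\<lambda>x. f x i) \<in> borel_measurable M"
    "\<And>x. x \<in> space M \<Longrightarrow> f x \<in> PiE {1..d} (\<lambda>_. UNIV)"
  shows "f \<in> measurable M (lborel_dim d)"
  by (rule measurable_PiM_single') (use assms in auto)

lemma measurable_extend: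
  "(\<lambda>p. extend_vec e (fst p) (snd p)) \<in> measurable (lborel_dim e \<Otimes>\<^sub>M lborel) (lborel_dim (e + 2))"
proof (rule measurable_lborel_dimI)
  fix i assume i: "i \<in> {1..e + 2}"
  consider "i = e + 1" | "i = e + 2" | "i \<in> {1..e}" using i by fastforce
  then show "(\<lambda>p. extend_vec e (fst p) (snd p) i) \<in> borel_measurable (lborel_dim e \<Otimes>\<^sub>M lborel)"
  proof cases
    case 1
    then show ?thesis using measurable_compose[OF measurable_snd measurable_vec_nth, of 1] by (simp add: extend_vec_def)
  next
    case 2
    then show ?thesis using measurable_compose[OF measurable_snd measurable_vec_nth, of 2] by (simp add: extend_vec_def)
  next
    case 3
    then show ?thesis using measurable_compose[OF measurable_fst measurable_coordinate[OF 3]] by (simp add: extend_vec_def)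
  qed
next
  fix p :: "(nat \<Rightarrow> real) \<times> (real^2)" assume "p \<in> space (lborel_dim e \<Otimes>\<^sub>M lborel)"
  then have "fst p \<in> PiE {1..e} (\<lambda>_. UNIV)" by (auto simp: space_pair_measure space_PiM)
  then show "extend_vec e (fst p) (snd p) \<in> {1..e + 2} \<rightarrow>\<^sub>E UNIV"
    by (auto simp: extend_vec_def PiE_def extensional_def)
qed

lemma atLeastAtMost_add2_insert: "{1..e + (2::nat)} = insert (e + 2) (insert (e + 1) {1..e})" by auto

lemma distr_extend: "distr (lborel_dim e \<Otimes>\<^sub>M lborel) (lborel_dim (e + 2)) (\<lambda>p. extend_vec e (fst p) (snd p)) = lborel_dim (e + 2)"
proof (rule distr_eqI_nn_integral[OF measurable_extend])
  fix f :: "(nat \<Rightarrow> real) \<Rightarrow> ennreal" assume f: "f \<in> borel_measurable (lborel_dim (e + 2))"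
  let ?I = "insert (e + 1) {1..e}"
  have f': "f \<in> borel_measurable (Pi\<^sub>M (insert (e + 2) ?I) (\<lambda>_. lborel))"
    using f unfolding atLeastAtMost_add2_insert .
  have upd: "(\<lambda>(z, y). z(e + 2 := y)) \<in> measurable (Pi\<^sub>M ?I (\<lambda>_. lborel) \<Otimes>\<^sub>M lborel) (Pi\<^sub>M (insert (e + 2) ?I) (\<lambda>_. lborel))"
    by (rule measurable_add_dim)
  have g: "(\<lambda>z. \<integral>\<^sup>+y. f (z(e + 2 := y)) \<partial>lborel) \<in> borel_measurable (Pi\<^sub>M ?I (\<lambda>_. lborel))"
  proof (rule lborel.borel_measurable_nn_integral)
    have "(\<lambda>p. f (case p of (z, y) \<Rightarrow> z(e + 2 := y))) = (\<lambda>(z, y). f (z(e + 2 := y)))" by auto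
    then show "(\<lambda>(z, y). f (z(e + 2 := y))) \<in> borel_measurable (Pi\<^sub>M ?I (\<lambda>_. lborel) \<Otimes>\<^sub>M lborel)"
      using measurable_compose[OF upd f'] by (simp only:)
  qed
  note fe = measurable_compose[OF measurable_extend f]
  have "(\<integral>\<^sup>+p. f (extend_vec e (fst p) (snd p)) \<partial>(lborel_dim e \<Otimes>\<^sub>M lborel)) =
      (\<integral>\<^sup>+x. \<integral>\<^sup>+v. f (extend_vec e (fst (x, v)) (snd (x, v))) \<partial>lborel \<partial>lborel_dim e)"
    by (rule lborel.nn_integral_fst[symmetric, OF fe])
  also have "\<dots> = (\<integral>\<^sup>+x. \<integral>\<^sup>+y. \<integral>\<^sup>+z. f ((x(e + 1 := y))(e + 2 := z)) \<partial>lborel \<partial>lborel \<partial>lborel_dim e)"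
  proof (rule nn_integral_cong)
    fix x assume x: "x \<in> space (lborel_dim e)"
    have "(\<lambda>v. f (extend_vec e (fst (x, v)) (snd (x, v)))) \<in> borel_measurable lborel"
      by (rule measurable_compose[OF measurable_Pair1'[OF x] fe])
    from nn_integral_vec2[OF this]
    show "(\<integral>\<^sup>+v. f (extend_vec e (fst (x, v)) (snd (x, v))) \<partial>lborel) = (\<integral>\<^sup>+y. \<integral>\<^sup>+z. f ((x(e + 1 := y))(e + 2 := z)) \<partial>lborel \<partial>lborel)"
      unfolding extend_vec_def fst_conv snd_conv vec2_nth .
  qed
  also have "\<dots> = (\<integral>\<^sup>+z. \<integral>\<^sup>+y. f (z(e + 2 := y)) \<partial>lborel \<partial>Pi\<^sub>M ?I (\<lambda>_. lborel))"
    by (rule lborel_product.product_nn_integral_insert[OF _ _ g, symmetric]) simp_all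
  also have "\<dots> = (\<integral>\<^sup>+a. f a \<partial>lborel_dim (e + 2))"
    unfolding atLeastAtMost_add2_insert
    by (rule lborel_product.product_nn_integral_insert[OF _ _ f', symmetric]) simp_all
  finally show "(\<integral>\<^sup>+p. f (extend_vec e (fst p) (snd p)) \<partial>(lborel_dim e \<Otimes>\<^sub>M lborel)) = (\<integral>\<^sup>+a. f a \<partial>lborel_dim (e + 2))" .
qed

lemma quad_eq_monic_poly: "quad u w = monic_poly 2 (\<lambda>i\<in>{1..2}. if i = 1 then u else w)"
  by (rule poly_eqI) (auto simp: quad_def coeff_monic_poly coeff_pCons numeral_2_eq_2 One_nat_def split: nat.split)

lemma measurable_weight_quad:
  assumes "f \<in> borel_measurable M" "g \<in> borel_measurable M"
  shows "(\<lambda>x. weight t (quad (f x) (g x))) \<in> borel_measurable M"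
proof -
  have "(\<lambda>x. \<lambda>i\<in>{1..2}. if i = 1 then f x else g x) \<in> measurable M (lborel_dim 2)"
  proof (rule measurable_restrict)
    fix i :: nat
    show "(\<lambda>x. if i = 1 then f x else g x) \<in> measurable M lborel" using assms by (cases "i = 1") auto
  qed
  from measurable_compose[OF this measurable_weight] show ?thesis unfolding quad_eq_monic_poly .
qed

lemma coeff_quad_mult:
  "coeff (quad u w * h) k = w * coeff h k + u * (if k = 0 then 0 else coeff h (k - 1)) + (if k < 2 then 0 else coeff h (k - 2))"
proof -
  have "quad u w * h = smult w h + pCons 0 (smult u h + pCons 0 h)" by (simp add: quad_def)
  then show ?thesis by (auto simp: coeff_pCons numeral_2_eq_2 One_nat_def split: nat.split)
qed

definition mult_vec :: "nat \<Rightarrow> real \<Rightarrow> real \<Rightarrow> (nat \<Rightarrow> real) \<Rightarrow> nat \<Rightarrow> real" where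
  "mult_vec e u w h = (\<lambda>i\<in>{1..e + 2}. coeff (quad u w * monic_poly e h) (e + 2 - i))"

lemma quad_mult_monic_poly: "quad u w * monic_poly e h = monic_poly (e + 2) (mult_vec e u w h)"
proof -
  have d: "degree (quad u w * monic_poly e h) = e + 2" by (simp add: degree_mult_eq)
  moreover have "lead_coeff (quad u w * monic_poly e h) = 1" by (simp add: lead_coeff_mult) (simp add: quad_def numeral_2_eq_2)
  ultimately have "quad u w * monic_poly e h = monic_poly (e + 2) (\<lambda>i. coeff (quad u w * monic_poly e h) (e + 2 - i))"
    by (rule monic_poly_coeffs[symmetric])
  also have "\<dots> = monic_poly (e + 2) (mult_vec e u w h)" by (rule monic_poly_cong) (auto simp: mult_vec_def)
  finally show ?thesis .
qed

lemma measurable_coeff_compose: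
  assumes "h \<in> measurable M (lborel_dim e)"
  shows "(\<lambda>x. coeff (monic_poly e (h x)) k) \<in> borel_measurable M"
  by (rule measurable_compose[OF assms measurable_coeff_monic_poly])

lemma measurable_mult_vec:
  assumes f: "f \<in> borel_measurable M" and g: "g \<in> borel_measurable M" and h: "h \<in> measurable M (lborel_dim e)"
  shows "(\<lambda>x. mult_vec e (f x) (g x) (h x)) \<in> measurable M (lborel_dim (e + 2))"
  unfolding mult_vec_def
proof (rule measurable_restrict)
  fix i
  note c = measurable_coeff_compose[OF h]
  have "(\<lambda>x. coeff (quad (f x) (g x) * monic_poly e (h x)) k) \<in> borel_measurable M" for k
    unfolding coeff_quad_mult
    by (cases "k = 0"; cases "k < 2") (auto intro!: borel_measurable_add borel_measurable_times f g c)
  then show "(\<lambda>x. coeff (quad (f x) (g x) * monic_poly e (h x)) (e + 2 - i)) \<in> measurable M lborel" by simp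
qed

lemma res_monic_poly:
  "res u w (monic_poly e h) =
    (let r0 = (\<Sum>k\<le>e. coeff (monic_poly e h) k * lucas_const u w k); r1 = (\<Sum>k\<le>e. coeff (monic_poly e h) k * lucas u w k)
     in r0\<^sup>2 - u * r0 * r1 + w * r1\<^sup>2)"
proof -
  have "monic_poly e h = (\<Sum>k\<le>e. smult (coeff (monic_poly e h) k) (monom 1 k))"
    using poly_as_sum_of_monoms[of "monic_poly e h"] by (simp add: smult_monom)
  also have "\<dots> = (\<Sum>k\<le>e. quad u w * smult (coeff (monic_poly e h) k) (power_quot u w k) +
      [:coeff (monic_poly e h) k * lucas_const u w k, coeff (monic_poly e h) k * lucas u w k:])"
    by (subst monom_eq_quad_mult[of _ u w]) (simp add: smult_add_right)
  also have "\<dots> = quad u w * (\<Sum>k\<le>e. smult (coeff (monic_poly e h) k) (power_quot u w k)) +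
      [:\<Sum>k\<le>e. coeff (monic_poly e h) k * lucas_const u w k, \<Sum>k\<le>e. coeff (monic_poly e h) k * lucas u w k:]"
    unfolding sum.distrib sum_distrib_left sum_pCons2 ..
  finally show ?thesis unfolding Let_def by (rule res_eqI)
qed

lemma measurable_res:
  assumes f: "f \<in> borel_measurable M" and g: "g \<in> borel_measurable M" and h: "h \<in> measurable M (lborel_dim e)"
  shows "(\<lambda>x. res (f x) (g x) (monic_poly e (h x))) \<in> borel_measurable M"
proof -
  note c = measurable_coeff_compose[OF h]
  have l: "(\<lambda>x. lucas_const (f x) (g x) k) \<in> borel_measurable M" for k
    unfolding lucas_const_def using measurable_lucas[OF f g] g by (cases "k = 0") auto
  have "(\<lambda>x. \<Sum>k\<le>e. coeff (monic_poly e (h x)) k * lucas_const (f x) (g x) k) \<in> borel_measurable M"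
    "(\<lambda>x. \<Sum>k\<le>e. coeff (monic_poly e (h x)) k * lucas (f x) (g x) k) \<in> borel_measurable M"
    by (intro borel_measurable_sum borel_measurable_times c l measurable_lucas f g)+
  then show ?thesis unfolding res_monic_poly Let_def
    by (intro borel_measurable_add borel_measurable_diff borel_measurable_times borel_measurable_power f g)
qed

lemma res_stable_bound:
  assumes "schur_stable (quad u w)" "schur_stable (monic_poly e h)"
  shows "\<bar>res u w (monic_poly e h)\<bar> \<le> ((real e + 1) * 2 ^ e)\<^sup>2"
proof -
  obtain x y where xy: "x + y = - of_real u" "x * y = of_real w" "poly (cpoly (quad u w)) x = 0" "poly (cpoly (quad u w)) y = 0"
    using quad_roots .
  have b: "cmod (poly (cpoly (monic_poly e h)) z) \<le> (real e + 1) * 2 ^ e" if "cmod z < 1" for z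
  proof -
    have "cmod (poly (cpoly (monic_poly e h)) z) \<le> (\<Sum>k\<le>e. cmod (of_real (coeff (monic_poly e h) k) * z ^ k))"
      unfolding poly_altdef degree_cpoly degree_monic_poly coeff_map_poly[of complex_of_real, OF of_real_0]
      by (rule norm_sum)
    also have "\<dots> \<le> (\<Sum>k\<le>e. 2 ^ e)"
    proof (rule sum_mono)
      fix k
      have "\<bar>coeff (monic_poly e h) k\<bar> * cmod z ^ k \<le> 2 ^ e * 1"
        using coeff_stable_bound[OF assms(2), of k] that by (intro mult_mono power_le_one) auto
      then show "cmod (of_real (coeff (monic_poly e h) k) * z ^ k) \<le> 2 ^ e"
        by (simp add: norm_mult norm_power)
    qed
    finally show ?thesis by (simp add: algebra_simps)
  qed
  have "cmod x < 1" "cmod y < 1" using assms(1) xy(3,4) by (auto simp: schur_stable_def)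
  then have "cmod (poly (cpoly (monic_poly e h)) x) * cmod (poly (cpoly (monic_poly e h)) y) \<le> ((real e + 1) * 2 ^ e) * ((real e + 1) * 2 ^ e)"
    by (intro mult_mono b) auto
  then have "cmod (of_real (res u w (monic_poly e h))) \<le> ((real e + 1) * 2 ^ e) * ((real e + 1) * 2 ^ e)"
    unfolding res_eq_prod_roots[OF xy(1,2)] by (simp add: norm_mult)
  then show ?thesis by (simp add: power2_eq_square)
qed

lemma stable_quad_bound:
  assumes "schur_stable (quad u w)" shows "\<bar>u\<bar> \<le> 4" "\<bar>w\<bar> \<le> 4"
  using coeff_stable_bound[OF assms, of 1] coeff_stable_bound[OF assms, of 0] by (simp_all add: quad_def One_nat_def)

section \<open>Removing a pair of roots\<close>

lemma extend_simps: "extend_vec e x v (e + 1) = v $ 1" "extend_vec e x v (e + 2) = v $ 2" "i \<le> e \<Longrightarrow> extend_vec e x v i = x i"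
  by (simp_all add: extend_vec_def)

lemma quot_vec_extend: "quot_vec e u w (extend_vec e x v) = quot_vec e u w x"
  unfolding quot_vec_def by (intro restrict_ext sum.cong refl) (auto simp: extend_simps)

lemma rem_extend: "rem1 e u w (extend_vec e x v) = rem1 e u w x" "rem0 e u w (extend_vec e x v) = rem0 e u w x"
  unfolding rem1_def rem0_def
  by (intro arg_cong[where f=uminus] arg_cong[where f="\<lambda>s. w * s"] sum.cong refl; auto simp: extend_simps)+

text \<open>For fixed first coefficients \<open>x\<close>, the map that sends \<open>(u, w)\<close> to the two last coefficients for which \<open>quad u w\<close> is a divisor.
Its fibers are the quadratic divisors of a polynomial.\<close>

definition rem_map :: "nat \<Rightarrow> (nat \<Rightarrow> real) \<Rightarrow> real^2 \<Rightarrow> real^2" where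
  "rem_map e x v = vec2 (rem1 e (v $ 1) (v $ 2) x, rem0 e (v $ 1) (v $ 2) x)"

lemma vec2_eq_iff: "vec2 (a, b) = y \<longleftrightarrow> a = y $ 1 \<and> b = y $ 2"
  by (auto simp: Finite_Cartesian_Product.vec_eq_iff forall_2)

lemma rem_map_eq_iff: "rem_map e x v = y \<longleftrightarrow> quad (v $ 1) (v $ 2) dvd monic_poly (e + 2) (extend_vec e x y)"
  unfolding quad_dvd_monic_poly_iff rem_extend extend_simps rem_map_def vec2_eq_iff by auto

lemma continuous_on_lucas:
  assumes "continuous_on S f" "continuous_on S g"
  shows "continuous_on S (\<lambda>x. lucas (f x) (g x) k)"
proof (induction k rule: induct_nat_012)
  case (ge2 k)
  show ?case unfolding lucas.simps by (intro continuous_intros assms ge2)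
qed simp_all

lemma continuous_on_nth: "continuous_on S f \<Longrightarrow> continuous_on S (\<lambda>x. (f x :: real^'n) $ i)"
  by (rule continuous_on_component)

lemma continuous_on_res_quot:
  "continuous_on UNIV (\<lambda>p::(real^2) \<times> (real^2). res (snd p $ 1) (snd p $ 2) (monic_poly e (quot_vec e (fst p $ 1) (fst p $ 2) x)))"
proof -
  have n: "continuous_on UNIV (\<lambda>p::(real^2) \<times> (real^2). fst p $ i)" "continuous_on UNIV (\<lambda>p::(real^2) \<times> (real^2). snd p $ i)" for i
    by (intro continuous_on_nth continuous_intros)+
  have c: "continuous_on UNIV (\<lambda>p::(real^2) \<times> (real^2). coeff (monic_poly e (quot_vec e (fst p $ 1) (fst p $ 2) x)) k)" for k
  proof (cases "k < e")
    case True
    then have m: "e - k \<in> {1..e}" by auto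
    show ?thesis unfolding coeff_monic_poly quot_vec_def using True m
      by (simp only: if_True restrict_apply') (intro continuous_intros continuous_on_lucas n)
  qed (simp add: coeff_monic_poly)
  have l: "continuous_on UNIV (\<lambda>p::(real^2) \<times> (real^2). lucas_const (snd p $ 1) (snd p $ 2) k)" for k
    unfolding lucas_const_def by (cases "k = 0") (simp, simp only: if_False, intro continuous_intros continuous_on_lucas n)
  show ?thesis unfolding res_monic_poly Let_def
    by (intro continuous_intros c l continuous_on_lucas n)
qed

lemma has_derivative_nth: "((\<lambda>x::real^2. x $ i) has_derivative (\<lambda>v. v $ i)) F"
  by (rule bounded_linear_imp_has_derivative[OF bounded_linear_vec_nth])

lemma has_derivative_rem1:
  "((\<lambda>v::real^2. rem1 e (v $ 1) (v $ 2) x) has_derivative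
    (\<lambda>d. qr2 e (v $ 1) (v $ 2) x * d $ 1 + qr1 e (v $ 1) (v $ 2) x * d $ 2)) (at v)"
proof -
  let ?a = "\<lambda>i. if i = 0 then 1 else x i"
  have "((\<lambda>v::real^2. - (\<Sum>i\<le>e. ?a i * lucas (v $ 1) (v $ 2) (e - i + 2))) has_derivative
    (\<lambda>d. - (\<Sum>i\<le>e. ?a i * (- dlucas (v $ 1) (v $ 2) (e - i + 2) * d $ 1 - dlucas (v $ 1) (v $ 2) (e - i + 2 - 1) * d $ 2)))) (at v)"
    by (intro has_derivative_minus has_derivative_sum has_derivative_mult_right has_derivative_lucas)
  moreover have "- (\<Sum>i\<le>e. ?a i * (- dlucas (v $ 1) (v $ 2) (e - i + 2) * d $ 1 - dlucas (v $ 1) (v $ 2) (e - i + 2 - 1) * d $ 2))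
      = qr2 e (v $ 1) (v $ 2) x * d $ 1 + qr1 e (v $ 1) (v $ 2) x * d $ 2" for d :: "real^2"
  proof -
    have "e - i + 2 - 1 = e - i + 1" for i by simp
    then show ?thesis unfolding qr1_def qr2_def sum_distrib_right sum_negf[symmetric] sum.distrib[symmetric]
      by (intro sum.cong refl) (simp only: algebra_simps)
  qed
  ultimately show ?thesis unfolding rem1_def by simp
qed

lemma has_derivative_rem0:
  "((\<lambda>v::real^2. rem0 e (v $ 1) (v $ 2) x) has_derivative
    (\<lambda>d. - (v $ 2) * qr1 e (v $ 1) (v $ 2) x * d $ 1 + (qr2 e (v $ 1) (v $ 2) x + v $ 1 * qr1 e (v $ 1) (v $ 2) x) * d $ 2)) (at v)"
proof -
  let ?a = "\<lambda>i. if i = 0 then 1 else x i"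
  have "((\<lambda>v::real^2. v $ 2 * (\<Sum>i\<le>e. ?a i * lucas (v $ 1) (v $ 2) (e - i + 1))) has_derivative
    (\<lambda>d. v $ 2 * (\<Sum>i\<le>e. ?a i * (- dlucas (v $ 1) (v $ 2) (e - i + 1) * d $ 1 - dlucas (v $ 1) (v $ 2) (e - i + 1 - 1) * d $ 2)) +
      d $ 2 * (\<Sum>i\<le>e. ?a i * lucas (v $ 1) (v $ 2) (e - i + 1)))) (at v)"
    by (intro has_derivative_mult has_derivative_sum has_derivative_mult_right has_derivative_lucas has_derivative_nth)
  moreover have "v $ 2 * (\<Sum>i\<le>e. ?a i * (- dlucas (v $ 1) (v $ 2) (e - i + 1) * d $ 1 - dlucas (v $ 1) (v $ 2) (e - i + 1 - 1) * d $ 2)) +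
      d $ 2 * (\<Sum>i\<le>e. ?a i * lucas (v $ 1) (v $ 2) (e - i + 1))
    = - (v $ 2) * qr1 e (v $ 1) (v $ 2) x * d $ 1 + (qr2 e (v $ 1) (v $ 2) x + v $ 1 * qr1 e (v $ 1) (v $ 2) x) * d $ 2" for d :: "real^2"
  proof -
    have e: "e - i + 1 - 1 = e - i" "e - i + 1 = Suc (e - i)" "e - i + 2 = Suc (Suc (e - i))" for i by simp_all
    show ?thesis unfolding qr1_def qr2_def sum_distrib_right sum_distrib_left sum_negf[symmetric] sum.distrib[symmetric] e
      by (intro sum.cong refl) (simp only: dlucas.simps, simp add: algebra_simps)
  qed
  ultimately show ?thesis unfolding rem0_def by simp
qed

definition rem_deriv :: "nat \<Rightarrow> (nat \<Rightarrow> real) \<Rightarrow> real^2 \<Rightarrow> real^2 \<Rightarrow> real^2" where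
  "rem_deriv e x v d = vec2 (qr2 e (v $ 1) (v $ 2) x * d $ 1 + qr1 e (v $ 1) (v $ 2) x * d $ 2,
    - (v $ 2) * qr1 e (v $ 1) (v $ 2) x * d $ 1 + (qr2 e (v $ 1) (v $ 2) x + v $ 1 * qr1 e (v $ 1) (v $ 2) x) * d $ 2)"

lemma vec2_axis: "vec2 (a, b) = a *\<^sub>R axis 1 1 + b *\<^sub>R axis 2 1"
  by (auto simp: Finite_Cartesian_Product.vec_eq_iff vec2_def axis_def forall_2)

lemma has_derivative_rem_map: "(rem_map e x has_derivative rem_deriv e x v) (at v)"
proof -
  have "((\<lambda>v::real^2. rem1 e (v $ 1) (v $ 2) x *\<^sub>R axis 1 1 + rem0 e (v $ 1) (v $ 2) x *\<^sub>R axis 2 1) has_derivative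
     (\<lambda>d. (qr2 e (v $ 1) (v $ 2) x * d $ 1 + qr1 e (v $ 1) (v $ 2) x * d $ 2) *\<^sub>R axis 1 1 +
      (- (v $ 2) * qr1 e (v $ 1) (v $ 2) x * d $ 1 + (qr2 e (v $ 1) (v $ 2) x + v $ 1 * qr1 e (v $ 1) (v $ 2) x) * d $ 2) *\<^sub>R (axis 2 1 :: real^2))) (at v)"
    by (intro has_derivative_add has_derivative_scaleR_left has_derivative_rem1 has_derivative_rem0)
  then show ?thesis unfolding rem_map_def[abs_def] rem_deriv_def[abs_def] vec2_axis .
qed

text \<open>This is the Jacobian that underlies Bairstow's method.\<close>

lemma det_rem_deriv: "Determinants.det (matrix (rem_deriv e x v)) = res (v $ 1) (v $ 2) (monic_poly e (quot_vec e (v $ 1) (v $ 2) x))"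
proof -
  have m: "matrix (rem_deriv e x v) $ i $ j = rem_deriv e x v (axis j 1) $ i" for i j
    by (simp add: matrix_def)
  have ax: "axis 1 1 $ (1::2) = (1::real)" "axis 1 1 $ (2::2) = (0::real)" "axis 2 1 $ (1::2) = (0::real)" "axis 2 1 $ (2::2) = (1::real)"
    by (simp_all add: axis_def)
  show ?thesis unfolding det_2 m rem_deriv_def vec2_nth ax res_quot_vec fst_conv snd_conv
    by (simp add: power2_eq_square algebra_simps)
qed

text \<open>If \<open>q h = q' h'\<close>, then \<open>q'\<close> divides \<open>(q - q') h\<close>. If \<open>q'\<close> and \<open>h\<close> are coprime, this forces \<open>q = q'\<close>, since the difference
of two monic quadratic polynomials has degree less than \<open>2\<close>. Coprimality persists in a neighbourhood because the
resultant is continuous.\<close>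

lemma rem_map_locally_inj:
  assumes "res (v0 $ 1) (v0 $ 2) (monic_poly e (quot_vec e (v0 $ 1) (v0 $ 2) x)) \<noteq> 0"
  shows "\<exists>V. open V \<and> v0 \<in> V \<and> inj_on (rem_map e x) V"
proof -
  let ?R = "\<lambda>p::(real^2) \<times> (real^2). res (snd p $ 1) (snd p $ 2) (monic_poly e (quot_vec e (fst p $ 1) (fst p $ 2) x))"
  have "open (?R -` (- {0}))"
    by (rule open_vimage[OF _ continuous_on_res_quot]) auto
  moreover have "(v0, v0) \<in> ?R -` (- {0})" using assms by simp
  ultimately obtain A B where AB: "open A" "open B" "(v0, v0) \<in> A \<times> B" "A \<times> B \<subseteq> ?R -` (- {0})"
    by (rule open_prod_elim)
  show ?thesis
  proof (intro exI[of _ "A \<inter> B"] conjI inj_onI)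
    fix v v' assume v: "v \<in> A \<inter> B" "v' \<in> A \<inter> B" and eq: "rem_map e x v = rem_map e x v'"
    let ?q = "quad (v $ 1) (v $ 2)" and ?q' = "quad (v' $ 1) (v' $ 2)"
    let ?h = "monic_poly e (quot_vec e (v $ 1) (v $ 2) x)" and ?h' = "monic_poly e (quot_vec e (v' $ 1) (v' $ 2) x)"
    define p where "p = monic_poly (e + 2) (extend_vec e x (rem_map e x v'))"
    have "?q dvd p" "?q' dvd p" unfolding p_def using eq rem_map_eq_iff[of e x v] rem_map_eq_iff[of e x v'] by auto
    then have "p = ?q * ?h" "p = ?q' * ?h'"
      unfolding p_def by (auto dest!: monic_poly_quotient simp only: quot_vec_extend)
    then have "(?q - ?q') * ?h = ?q' * (?h' - ?h)" by (simp only: left_diff_distrib right_diff_distrib)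
    then have d: "?q' dvd (?q - ?q') * ?h" by simp
    have "(v, v') \<in> A \<times> B" using v by auto
    then have "res (v' $ 1) (v' $ 2) ?h \<noteq> 0" using AB(4) by auto
    moreover have qq: "?q - ?q' = [:v $ 2 - v' $ 2, v $ 1 - v' $ 1:]" by (simp add: quad_def)
    then have "degree (?q - ?q') < 2" by (simp add: degree_pCons_eq_if)
    ultimately have "?q - ?q' = 0" using d by (rule res_nonzero_small)
    then show "v = v'" unfolding qq by (auto simp: Finite_Cartesian_Product.vec_eq_iff forall_2)
  qed (use AB in auto)
qed

text \<open>The area formula for \<open>rem_map\<close>, with the sign of the resultant in the integrand. On one side the sign turns the absolute
value of the Jacobian into the resultant itself; on the other side the sum of signs over the fiber
is \<open>(e + 2) div 2\<close>.\<close>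

lemma integral_quadratic_factors:
  assumes int: "integrable (lborel :: (real^2) measure) (\<lambda>v::real^2. res (v $ 1) (v $ 2) (monic_poly e (quot_vec e (v $ 1) (v $ 2) x)) *
      (weight t (quad (v $ 1) (v $ 2)) * weight t (monic_poly e (quot_vec e (v $ 1) (v $ 2) x)) *
       g (quad (v $ 1) (v $ 2) * monic_poly e (quot_vec e (v $ 1) (v $ 2) x))))" (is "integrable _ ?I")
    and meas: "(\<lambda>v::real^2. weight t (monic_poly (e + 2) (extend_vec e x v)) * g (monic_poly (e + 2) (extend_vec e x v))) \<in> borel_measurable lborel"
  shows "(\<integral>v. real ((e + 2) div 2) * (weight t (monic_poly (e + 2) (extend_vec e x v)) * g (monic_poly (e + 2) (extend_vec e x v))) \<partial>(lborel :: (real^2) measure))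
    = (\<integral>v. ?I v \<partial>(lborel :: (real^2) measure))"
proof -
  let ?h = "\<lambda>v::real^2. monic_poly e (quot_vec e (v $ 1) (v $ 2) x)"
  let ?q = "\<lambda>v::real^2. quad (v $ 1) (v $ 2)"
  let ?r = "\<lambda>v::real^2. res (v $ 1) (v $ 2) (?h v)"
  let ?p = "\<lambda>y. monic_poly (e + 2) (extend_vec e x y)"
  define U where "U = {v. ?r v \<noteq> 0}"
  define \<psi> where "\<psi> v = sgn (?r v) * (weight t (?q v) * weight t (?h v) * g (?q v * ?h v))" for v
  have "U = (\<lambda>v. (v, v)) -` ((\<lambda>p. res (snd p $ 1) (snd p $ 2) (monic_poly e (quot_vec e (fst p $ 1) (fst p $ 2) x))) -` (- {0}))"
    by (auto simp: U_def)
  moreover have "open \<dots>"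
    by (intro open_vimage continuous_on_res_quot continuous_intros)
  ultimately have U: "open U" by simp
  have I: "\<bar>Determinants.det (matrix (rem_deriv e x v))\<bar> * \<psi> v = ?I v" for v
    unfolding det_rem_deriv \<psi>_def by (simp add: abs_sgn mult.assoc[symmetric] mult_sgn_abs mult.commute[of "\<bar>_\<bar>" "sgn _"])
  have IU: "indicator U v *\<^sub>R ?I v = ?I v" for v by (cases "?r v = 0") (simp_all add: U_def)
  have "integrable lebesgue ?I" using int by (simp add: integrable_completion borel_measurable_integrable)
  then have absint: "(\<lambda>v. \<bar>Determinants.det (matrix (rem_deriv e x v))\<bar> * \<psi> v) absolutely_integrable_on U"
    unfolding set_integrable_def I IU .
  have fib: "{v. v \<in> U \<and> rem_map e x v = y} = (\<lambda>(u, w). vec2 (u, w)) `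
      {(u, w). quad u w dvd ?p y \<and> res u w (monic_poly e (quot_vec e u w (extend_vec e x y))) \<noteq> 0}" (is "_ = _ ` ?Q y") for y
  proof (intro equalityI subsetI)
    fix v assume "v \<in> {v. v \<in> U \<and> rem_map e x v = y}"
    then have "(v $ 1, v $ 2) \<in> ?Q y" by (auto simp: U_def rem_map_eq_iff quot_vec_extend)
    moreover have "v = (\<lambda>(u, w). vec2 (u, w)) (v $ 1, v $ 2)" by (simp add: Finite_Cartesian_Product.vec_eq_iff forall_2)
    ultimately show "v \<in> (\<lambda>(u, w). vec2 (u, w)) ` ?Q y" by (rule rev_image_eqI)
  qed (auto simp: U_def rem_map_eq_iff quot_vec_extend)
  have fQ: "finite (?Q y)" for y
    by (rule finite_subset[OF _ finite_quad_divisors[of "?p y"]]) auto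
  have S: "(\<Sum>v | v \<in> U \<and> rem_map e x v = y. \<psi> v) = real ((e + 2) div 2) * (weight t (?p y) * g (?p y))" for y
  proof -
    have inj: "inj_on (\<lambda>(u, w). vec2 (u, w)) (?Q y)" by (auto simp: inj_on_def vec2_eq_iff)
    have "(\<Sum>v | v \<in> U \<and> rem_map e x v = y. \<psi> v) = (\<Sum>(u, w)\<in>?Q y. \<psi> (vec2 (u, w)))"
      unfolding fib by (subst sum.reindex[OF inj]) (simp add: case_prod_beta)
    also have "\<dots> = (\<Sum>(u, w)\<in>?Q y. sgn (res u w (monic_poly e (quot_vec e u w (extend_vec e x y)))) *
        (weight t (quad u w) * weight t (monic_poly e (quot_vec e u w (extend_vec e x y)))) * g (?p y))"
    proof (intro sum.cong refl)
      fix q assume "q \<in> ?Q y"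
      then obtain u w where q: "q = (u, w)" "quad u w dvd ?p y" by auto
      have "?p y = quad u w * monic_poly e (quot_vec e u w (extend_vec e x y))" by (rule monic_poly_quotient[OF q(2)])
      then show "(case q of (u, w) \<Rightarrow> \<psi> (vec2 (u, w))) = (case q of (u, w) \<Rightarrow> sgn (res u w (monic_poly e (quot_vec e u w (extend_vec e x y)))) *
        (weight t (quad u w) * weight t (monic_poly e (quot_vec e u w (extend_vec e x y)))) * g (?p y))"
        unfolding q(1) prod.case \<psi>_def vec2_nth fst_conv snd_conv quot_vec_extend by simp
    qed
    also have "\<dots> = (\<Sum>(u, w)\<in>?Q y. sgn (res u w (monic_poly e (quot_vec e u w (extend_vec e x y)))) *
        (weight t (quad u w) * weight t (monic_poly e (quot_vec e u w (extend_vec e x y))))) * g (?p y)"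
      unfolding sum_distrib_right by (intro sum.cong refl) (simp add: case_prod_beta)
    also have "\<dots> = real ((e + 2) div 2) * weight t (?p y) * g (?p y)"
      by (simp only: sum_weights_quadratic_factors)
    finally show ?thesis by (simp only: mult.assoc)
  qed
  have "(\<integral>y. (\<Sum>v | v \<in> U \<and> rem_map e x v = y. \<psi> v) \<partial>lebesgue) =
      (LINT v:U|lebesgue. \<bar>Determinants.det (matrix (rem_deriv e x v))\<bar> * \<psi> v)"
  proof (rule area_formula[OF U has_derivative_rem_map])
    fix v assume "v \<in> U"
    then obtain V where "open V" "v \<in> V" "inj_on (rem_map e x) V" using rem_map_locally_inj[of v e x] unfolding U_def by auto
    then show "\<exists>V. open V \<and> v \<in> V \<and> inj_on (rem_map e x) (V \<inter> U)"
      by (intro exI[of _ V]) (auto intro: inj_on_subset)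
  next
    show "finite {v. v \<in> U \<and> rem_map e x v = y}" for y unfolding fib using fQ by blast
  qed (fact absint)
  also have "\<dots> = (\<integral>v. ?I v \<partial>lebesgue)" unfolding set_lebesgue_integral_def I IU ..
  also have "\<dots> = (\<integral>v. ?I v \<partial>lborel)" using int by (intro integral_completion) (simp add: borel_measurable_integrable)
  finally have "(\<integral>y. real ((e + 2) div 2) * (weight t (?p y) * g (?p y)) \<partial>lebesgue) = (\<integral>v. ?I v \<partial>lborel)"
    unfolding S .
  moreover have "(\<integral>y. real ((e + 2) div 2) * (weight t (?p y) * g (?p y)) \<partial>lebesgue) = (\<integral>y. real ((e + 2) div 2) * (weight t (?p y) * g (?p y)) \<partial>lborel)"
    using meas by (intro integral_completion borel_measurable_times[OF borel_measurable_const])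
  ultimately show ?thesis by simp
qed

text \<open>Fubini's theorem in the splitting of the coefficients into the first \<open>e\<close> and the last two gives the plane integral of
\<open>integral_quadratic_factors\<close>; exchanging the order of integration, the first coefficients can be replaced by those of the
quotient, since \<open>quot_vec\<close> preserves the measure for each \<open>u\<close> and \<open>w\<close>.\<close>

theorem pair_removal:
  assumes g: "test_fun (e + 2) g" and t: "0 \<le> t" "t \<le> 1"
  shows "real ((e + 2) div 2) * weighted_integral t (e + 2) g =
    (\<integral>v. weight t (quad (v $ 1) (v $ 2)) *
       (\<integral>h. weight t (monic_poly e h) * (res (v $ 1) (v $ 2) (monic_poly e h) * g (quad (v $ 1) (v $ 2) * monic_poly e h)) \<partial>lborel_dim e)
     \<partial>(lborel :: (real^2) measure))"
proof -
  let ?L = "lborel :: (real^2) measure"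
  define \<Xi> where "\<Xi> v h = res (v $ 1) (v $ 2) (monic_poly e h) * (weight t (quad (v $ 1) (v $ 2)) * weight t (monic_poly e h) *
      g (quad (v $ 1) (v $ 2) * monic_poly e h))" for v :: "real^2" and h
  interpret L: sigma_finite_measure "lborel_dim e" by (rule lborel_product.sigma_finite) simp
  interpret P: pair_sigma_finite "lborel_dim e" ?L ..
  interpret Q: pair_sigma_finite ?L "lborel_dim e" ..
  have gm: "(\<lambda>a. g (monic_poly (e + 2) a)) \<in> borel_measurable (lborel_dim (e + 2))" using g by (simp add: test_fun_def)
  have \<Xi>m: "(\<lambda>x. \<Xi> (f x) (h x)) \<in> borel_measurable M"
    if f: "f \<in> measurable M ?L" and h: "h \<in> measurable M (lborel_dim e)" for M :: "'b measure" and f h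
  proof -
    have n: "(\<lambda>x. f x $ i) \<in> borel_measurable M" for i by (rule measurable_compose[OF f measurable_vec_nth])
    show ?thesis unfolding \<Xi>_def quad_mult_monic_poly
      by (intro borel_measurable_times measurable_res measurable_weight_quad n h
          measurable_compose[OF h measurable_weight] measurable_compose[OF measurable_mult_vec[OF n n h] gm])
  qed
  obtain C where C: "\<And>p. degree p = e + 2 \<Longrightarrow> lead_coeff p = 1 \<Longrightarrow> schur_stable p \<Longrightarrow> \<bar>g p\<bar> \<le> C"
    using g unfolding test_fun_def by blast
  define K where "K = ((real e + 1) * 2 ^ e)\<^sup>2 * \<bar>C\<bar>"
  \<comment> \<open>All integrands are bounded and vanish off a box, which gives the integrability that Fubini's theorem requires.\<close>
  define box where "box = cbox (vec2 (- 4, - 4)) (vec2 (4, 4)) \<times> PiE {1..e} (\<lambda>_. {- (2 ^ e) .. 2 ^ e :: real})"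
  have \<Xi>b: "\<bar>\<Xi> v h\<bar> \<le> K" and \<Xi>s: "\<Xi> v h \<noteq> 0 \<Longrightarrow> h \<in> PiE {1..e} (\<lambda>_. UNIV) \<Longrightarrow> (v, h) \<in> box" for v h
  proof -
    have *: "\<bar>\<Xi> v h\<bar> \<le> K \<and> (h \<in> PiE {1..e} (\<lambda>_. UNIV) \<longrightarrow> (v, h) \<in> box)" if nz: "\<Xi> v h \<noteq> 0"
    proof -
      have s: "schur_stable (quad (v $ 1) (v $ 2))" "schur_stable (monic_poly e h)"
        using nz by (auto simp: \<Xi>_def intro: weight_nonzero_stable)
      then have s2: "schur_stable (quad (v $ 1) (v $ 2) * monic_poly e h)" by (auto simp: schur_stable_def cpoly_mult)
      have gb: "\<bar>g (quad (v $ 1) (v $ 2) * monic_poly e h)\<bar> \<le> \<bar>C\<bar>"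
        using C[of "quad (v $ 1) (v $ 2) * monic_poly e h"] s2 unfolding quad_mult_monic_poly by simp
      have wb: "\<bar>weight t p\<bar> \<le> 1" for p by (rule weight_abs_le_1[OF t])
      have "\<bar>\<Xi> v h\<bar> \<le> ((real e + 1) * 2 ^ e)\<^sup>2 * (1 * 1 * \<bar>C\<bar>)"
        unfolding \<Xi>_def abs_mult by (intro mult_mono res_stable_bound s wb gb) auto
      moreover have "(v, h) \<in> box" if "h \<in> PiE {1..e} (\<lambda>_. UNIV)"
      proof -
        have "h i \<in> {- (2 ^ e) .. 2 ^ e}" if "i \<in> {1..e}" for i
          using stable_monic_poly_bound[OF s(2) that] by (simp add: abs_le_iff)
        then have "h \<in> PiE {1..e} (\<lambda>_. {- (2 ^ e) .. 2 ^ e :: real})" using that by (auto simp: PiE_def)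
        moreover have "v \<in> cbox (vec2 (- 4, - 4)) (vec2 (4, 4))"
          using stable_quad_bound[OF s(1)] by (auto simp: mem_box_cart forall_2 abs_le_iff)
        ultimately show ?thesis by (simp add: box_def)
      qed
      ultimately show ?thesis by (simp add: K_def)
    qed
    show "\<bar>\<Xi> v h\<bar> \<le> K" using * by (cases "\<Xi> v h = 0") (auto simp: K_def)
    show "\<Xi> v h \<noteq> 0 \<Longrightarrow> h \<in> PiE {1..e} (\<lambda>_. UNIV) \<Longrightarrow> (v, h) \<in> box" using * by blast
  qed
  have b2: "PiE {1..e} (\<lambda>_. {- (2 ^ e) .. 2 ^ e :: real}) \<in> sets (lborel_dim e)" by (rule sets_PiM_I_finite) auto
  have boxm: "box \<in> sets (?L \<Otimes>\<^sub>M lborel_dim e)" unfolding box_def using b2 by (intro pair_measureI) auto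
  have "emeasure (?L \<Otimes>\<^sub>M lborel_dim e) box = emeasure ?L (cbox (vec2 (- 4, - 4)) (vec2 (4, 4))) *
      emeasure (lborel_dim e) (PiE {1..e} (\<lambda>_. {- (2 ^ e) .. 2 ^ e :: real}))"
    unfolding box_def using b2 by (intro L.emeasure_pair_measure_Times) auto
  also have "emeasure (lborel_dim e) (PiE {1..e} (\<lambda>_. {- (2 ^ e) .. 2 ^ e :: real})) = (\<Prod>i\<in>{1..e}. emeasure lborel {- (2 ^ e) .. 2 ^ e :: real})"
    by (rule lborel_product.emeasure_PiM) auto
  also have "emeasure ?L (cbox (vec2 (- 4, - 4)) (vec2 (4, 4))) * \<dots> < \<infinity>"
  proof -
    have "emeasure ?L (cbox (vec2 (- 4, - 4)) (vec2 (4, 4))) < \<infinity>" by (rule emeasure_lborel_cbox_finite)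
    moreover have "(\<Prod>i\<in>{1..e}. emeasure lborel {- (2 ^ e) .. 2 ^ e :: real}) < \<infinity>"
      by (auto simp: power_less_top_ennreal emeasure_lborel_Icc_eq)
    ultimately show ?thesis by (simp add: ennreal_mult_less_top)
  qed
  finally have "integrable (?L \<Otimes>\<^sub>M lborel_dim e) (indicator box :: _ \<Rightarrow> real)"
    using boxm by (intro integrable_real_indicator)
  then have "integrable (?L \<Otimes>\<^sub>M lborel_dim e) (\<lambda>p. K * indicator box p)" by (rule integrable_mult_right)
  then have \<Xi>i: "integrable (?L \<Otimes>\<^sub>M lborel_dim e) (\<lambda>p. \<Xi> (fst p) (snd p))"
  proof (rule Bochner_Integration.integrable_bound, intro \<Xi>m measurable_fst measurable_snd, intro AE_I2)
    fix p assume "p \<in> space (?L \<Otimes>\<^sub>M lborel_dim e)"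
    then have "snd p \<in> PiE {1..e} (\<lambda>_. UNIV)" by (auto simp: space_pair_measure space_PiM)
    then show "norm (\<Xi> (fst p) (snd p)) \<le> norm (K * indicator box p)"
      using \<Xi>b[of "fst p" "snd p"] \<Xi>s[of "fst p" "snd p"] by (cases "\<Xi> (fst p) (snd p) = 0") auto
  qed
  define \<Theta> where "\<Theta> p = \<Xi> (snd p) (quot_vec e (snd p $ 1) (snd p $ 2) (fst p))" for p
  have \<Theta>m: "\<Theta> \<in> borel_measurable (lborel_dim e \<Otimes>\<^sub>M ?L)"
    unfolding \<Theta>_def[abs_def]
    by (intro \<Xi>m measurable_snd measurable_quot_vec measurable_fst measurable_compose[OF measurable_snd measurable_vec_nth])
  have \<Xi>mh: "\<Xi> v \<in> borel_measurable (lborel_dim e)" for v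
    using \<Xi>m[of "\<lambda>_. v" "lborel_dim e" "\<lambda>h. h"] by simp
  have \<Theta>i: "integrable (lborel_dim e \<Otimes>\<^sub>M ?L) \<Theta>"
  proof (rule integrableI_bounded[OF \<Theta>m])
    have "(\<integral>\<^sup>+p. ennreal (norm (\<Theta> p)) \<partial>(lborel_dim e \<Otimes>\<^sub>M ?L)) = (\<integral>\<^sup>+v. \<integral>\<^sup>+x. ennreal (norm (\<Theta> (x, v))) \<partial>lborel_dim e \<partial>?L)"
      by (rule P.nn_integral_snd[symmetric]) (use \<Theta>m in simp)
    also have "\<dots> = (\<integral>\<^sup>+v. \<integral>\<^sup>+h. ennreal (norm (\<Xi> v h)) \<partial>lborel_dim e \<partial>?L)"
    proof (rule nn_integral_cong)
      fix v :: "real^2"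
      have "(\<lambda>h. ennreal (norm (\<Xi> v h))) \<in> borel_measurable (lborel_dim e)" using \<Xi>mh[of v] by simp
      from nn_integral_quot_vec[OF this]
      show "(\<integral>\<^sup>+x. ennreal (norm (\<Theta> (x, v))) \<partial>lborel_dim e) = (\<integral>\<^sup>+h. ennreal (norm (\<Xi> v h)) \<partial>lborel_dim e)"
        unfolding \<Theta>_def fst_conv snd_conv .
    qed
    also have "\<dots> = (\<integral>\<^sup>+v. \<integral>\<^sup>+h. ennreal (norm (\<Xi> (fst (v, h)) (snd (v, h)))) \<partial>lborel_dim e \<partial>?L)" by simp
    also have "\<dots> = (\<integral>\<^sup>+p. ennreal (norm (\<Xi> (fst p) (snd p))) \<partial>(?L \<Otimes>\<^sub>M lborel_dim e))"
      by (rule L.nn_integral_fst) (use borel_measurable_integrable[OF \<Xi>i] in simp)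
    also have "\<dots> < \<infinity>" using \<Xi>i by (simp add: integrable_iff_bounded)
    finally show "(\<integral>\<^sup>+p. ennreal (norm (\<Theta> p)) \<partial>(lborel_dim e \<Otimes>\<^sub>M ?L)) < \<infinity>" .
  qed
  define \<Phi> where "\<Phi> a = weight t (monic_poly (e + 2) a) * g (monic_poly (e + 2) a)" for a
  have \<Phi>i: "integrable (lborel_dim (e + 2)) \<Phi>" unfolding \<Phi>_def by (rule integrable_weight_test_fun[OF g t])
  have \<Phi>m: "\<Phi> \<in> borel_measurable (lborel_dim (e + 2))" using \<Phi>i by (rule borel_measurable_integrable)
  let ?n = "real ((e + 2) div 2)"
  have ei: "integrable (lborel_dim e \<Otimes>\<^sub>M ?L) (\<lambda>p. ?n * \<Phi> (extend_vec e (fst p) (snd p)))"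
    using integrable_distr_eq[OF measurable_extend[of e] \<Phi>m] \<Phi>i unfolding distr_extend by simp
  have "?n * weighted_integral t (e + 2) g = (\<integral>a. ?n * \<Phi> a \<partial>lborel_dim (e + 2))"
    unfolding weighted_integral_def \<Phi>_def by simp
  also have "\<dots> = (\<integral>a. ?n * \<Phi> a \<partial>distr (lborel_dim e \<Otimes>\<^sub>M ?L) (lborel_dim (e + 2)) (\<lambda>p. extend_vec e (fst p) (snd p)))"
    by (simp only: distr_extend)
  also have "\<dots> = (\<integral>p. ?n * \<Phi> (extend_vec e (fst p) (snd p)) \<partial>(lborel_dim e \<Otimes>\<^sub>M ?L))"
    by (rule integral_distr[OF measurable_extend]) (intro borel_measurable_times \<Phi>m borel_measurable_const)
  also have "\<dots> = (\<integral>x. \<integral>v. ?n * \<Phi> (extend_vec e (fst (x, v)) (snd (x, v))) \<partial>?L \<partial>lborel_dim e)"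
    by (rule P.integral_fst'[OF ei, symmetric])
  also have "\<dots> = (\<integral>x. \<integral>v. \<Theta> (x, v) \<partial>?L \<partial>lborel_dim e)"
  proof (rule integral_cong_AE)
    show "(\<lambda>x. \<integral>v. ?n * \<Phi> (extend_vec e (fst (x, v)) (snd (x, v))) \<partial>?L) \<in> borel_measurable (lborel_dim e)"
      by (rule lborel.borel_measurable_lebesgue_integral) (use borel_measurable_integrable[OF ei] in \<open>simp add: case_prod_beta'\<close>)
    show "(\<lambda>x. \<integral>v. \<Theta> (x, v) \<partial>?L) \<in> borel_measurable (lborel_dim e)"
      by (rule lborel.borel_measurable_lebesgue_integral) (use \<Theta>m in \<open>simp add: case_prod_beta'\<close>)
    have "AE x in lborel_dim e. integrable ?L (\<lambda>v. \<Theta> (x, v))" by (rule P.AE_integrable_fst'[OF \<Theta>i])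
    then show "AE x in lborel_dim e. (\<integral>v. ?n * \<Phi> (extend_vec e (fst (x, v)) (snd (x, v))) \<partial>?L) = (\<integral>v. \<Theta> (x, v) \<partial>?L)"
    proof (rule AE_mp, intro AE_I2 impI)
      fix x assume x: "x \<in> space (lborel_dim e)" and i: "integrable ?L (\<lambda>v. \<Theta> (x, v))"
      have "(\<lambda>v. \<Phi> (extend_vec e (fst (x, v)) (snd (x, v)))) \<in> borel_measurable ?L"
        by (rule measurable_compose[OF measurable_Pair1'[OF x] measurable_compose[OF measurable_extend \<Phi>m]])
      then show "(\<integral>v. ?n * \<Phi> (extend_vec e (fst (x, v)) (snd (x, v))) \<partial>?L) = (\<integral>v. \<Theta> (x, v) \<partial>?L)"
        using i integral_quadratic_factors[of e x t g] unfolding \<Theta>_def \<Phi>_def \<Xi>_def fst_conv snd_conv by blast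
    qed
  qed
  also have "\<dots> = (\<integral>v. \<integral>x. \<Theta> (x, v) \<partial>lborel_dim e \<partial>?L)"
    by (rule P.Fubini_integral[symmetric]) (use \<Theta>i in \<open>simp add: case_prod_beta'\<close>)
  also have "\<dots> = (\<integral>v. \<integral>h. \<Xi> v h \<partial>lborel_dim e \<partial>?L)"
    unfolding \<Theta>_def fst_conv snd_conv by (simp only: integral_quot_vec[OF \<Xi>mh])
  also have "\<dots> = (\<integral>v. weight t (quad (v $ 1) (v $ 2)) *
       (\<integral>h. weight t (monic_poly e h) * (res (v $ 1) (v $ 2) (monic_poly e h) * g (quad (v $ 1) (v $ 2) * monic_poly e h)) \<partial>lborel_dim e) \<partial>?L)"
    unfolding \<Xi>_def integral_mult_right_zero[symmetric] by (intro Bochner_Integration.integral_cong refl) (simp only: mult_ac)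
  finally show ?thesis .
qed

section \<open>Volumes as coefficients of a weighted integral\<close>

text \<open>If only the constant coefficient varies, a multiple root is a zero of the fixed derivative, so that only finitely many values
of the constant coefficient are exceptional.\<close>

lemma null_not_rsquarefree:
  assumes "d \<ge> 1"
  shows "{a \<in> space (lborel_dim d). \<not> rsquarefree (cpoly (monic_poly d a))} \<in> null_sets (lborel_dim d)"
proof -
  obtain k where d: "d = Suc k" using assms by (cases d) auto
  let ?N = "{a \<in> space (lborel_dim d). \<not> rsquarefree (cpoly (monic_poly d a))}"
  have "?N = space (lborel_dim d) - {a \<in> space (lborel_dim d). rsquarefree (cpoly (monic_poly d a))}" by auto
  then have N: "?N \<in> sets (lborel_dim d)" using sets.compl_sets[OF sets_rsquarefree[of d]] by (simp only:)
  have im: "(indicator ?N :: _ \<Rightarrow> ennreal) \<in> borel_measurable (Pi\<^sub>M (insert (Suc k) {1..k}) (\<lambda>_. lborel))"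
    using borel_measurable_indicator[OF N] unfolding d atLeastAtMost_Suc_insert .
  have "emeasure (lborel_dim d) ?N = (\<integral>\<^sup>+a. indicator ?N a \<partial>Pi\<^sub>M (insert (Suc k) {1..k}) (\<lambda>_. lborel))"
    using nn_integral_indicator[OF N] unfolding d atLeastAtMost_Suc_insert by simp
  also have "\<dots> = (\<integral>\<^sup>+x. \<integral>\<^sup>+y. indicator ?N (x(Suc k := y)) \<partial>lborel \<partial>lborel_dim k)"
    by (rule lborel_product.product_nn_integral_insert[OF _ _ im]) simp_all
  also have "\<dots> = (\<integral>\<^sup>+x. 0 \<partial>lborel_dim k)"
  proof (rule nn_integral_cong)
    fix x :: "nat \<Rightarrow> real"
    define P where "P = monic_poly d (x(Suc k := 0))"
    define A where "A = (\<lambda>z. - Re (poly (cpoly P) z)) ` {z. poly (cpoly (pderiv P)) z = 0}"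
    have P: "monic_poly d (x(Suc k := y)) = P + [:y:]" for y
      by (rule poly_eqI) (auto simp: P_def d coeff_monic_poly coeff_pCons split: nat.split)
    have "degree P = Suc k" by (simp add: P_def d)
    then have "pderiv P \<noteq> 0" by (simp add: pderiv_eq_0_iff)
    then have "finite {z. poly (cpoly (pderiv P)) z = 0}" by (intro poly_roots_finite) simp
    then have "finite A" by (simp add: A_def)
    then have A: "A \<in> null_sets lborel" by (rule finite_imp_null_set_lborel)
    have "y \<in> A" if "\<not> rsquarefree (cpoly (monic_poly d (x(Suc k := y))))" for y
    proof -
      note ns = that
      have pd: "pderiv (P + [:y:]) = pderiv P" by (simp add: pderiv_add pderiv_pCons)
      obtain z where z: "poly (cpoly (P + [:y:])) z = 0" "poly (cpoly (pderiv P)) z = 0"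
        using ns unfolding P rsquarefree_roots pderiv_cpoly pd by blast
      have "poly (cpoly P) z + of_real y = 0" using z(1) by (simp add: cpoly_add map_poly_pCons)
      then have "Re (poly (cpoly P) z + of_real y) = 0" by simp
      then have "y = - Re (poly (cpoly P) z)" by simp
      then show "y \<in> A" using z(2) by (auto simp: A_def)
    qed
    then have "(\<integral>\<^sup>+y. indicator ?N (x(Suc k := y)) \<partial>lborel) \<le> (\<integral>\<^sup>+y. indicator A y \<partial>lborel)"
      by (intro nn_integral_mono) (auto split: split_indicator)
    also have "\<dots> = emeasure lborel A" by (rule nn_integral_indicator[OF null_setsD2[OF A]])
    also have "\<dots> = 0" by (rule null_setsD1[OF A])
    finally show "(\<integral>\<^sup>+y. indicator ?N (x(Suc k := y)) \<partial>lborel) = 0" by simp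
  qed
  finally show ?thesis using N by (auto simp: null_sets_def)
qed

lemma coeff_poly_eq: "coeff_poly d a = cpoly (monic_poly d a)"
  by (rule poly_eqI) (simp add: coeff_poly_def monic_poly_def coeff_sum coeff_map_poly if_distrib[of complex_of_real] cong: if_cong)

lemma size_nonreal_roots:
  assumes "rsquarefree (cpoly p)"
  shows "size (filter_mset (\<lambda>z. z \<notin> \<real>) (proots (cpoly p))) = 2 * card (upper_roots p)"
proof -
  have p0: "p \<noteq> 0" using assms by (auto simp: rsquarefree_def)
  let ?Z = "{z. z \<notin> \<real> \<and> poly (cpoly p) z = 0}"
  have fin: "finite ?Z" by (rule finite_subset[OF _ poly_roots_finite[of "cpoly p"]]) (use p0 in auto)
  have "filter_mset (\<lambda>z. z \<notin> \<real>) (proots (cpoly p)) = mset_set ?Z"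
  proof (rule multiset_eqI)
    fix z
    have "order z (cpoly p) = (if poly (cpoly p) z = 0 then 1 else 0)"
    proof -
      have "order z (cpoly p) = 0 \<or> order z (cpoly p) = 1" using assms unfolding rsquarefree_def by blast
      then show ?thesis using p0 order_root[of "cpoly p" z] by (cases "poly (cpoly p) z = 0") auto
    qed
    then show "count (filter_mset (\<lambda>z. z \<notin> \<real>) (proots (cpoly p))) z = count (mset_set ?Z) z"
      using p0 fin by (auto simp: count_mset_set')
  qed
  then have "size (filter_mset (\<lambda>z. z \<notin> \<real>) (proots (cpoly p))) = card ?Z" by simp
  also have "?Z = upper_roots p \<union> cnj ` upper_roots p"
  proof (intro equalityI subsetI)
    fix z assume z: "z \<in> ?Z"
    then have "Im z \<noteq> 0" by (auto simp: complex_is_Real_iff)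
    then consider "Im z > 0" | "Im (cnj z) > 0" by (auto simp: neq_iff)
    then show "z \<in> upper_roots p \<union> cnj ` upper_roots p"
    proof cases
      case 1 then show ?thesis using z by (auto simp: upper_roots_def)
    next
      case 2
      then have "cnj z \<in> upper_roots p" using z by (auto simp: upper_roots_def poly_cpoly_cnj)
      then have "cnj (cnj z) \<in> cnj ` upper_roots p" by blast
      then show ?thesis by simp
    qed
  qed (auto simp: upper_roots_def poly_cpoly_cnj complex_is_Real_iff)
  also have "card (upper_roots p \<union> cnj ` upper_roots p) = card (upper_roots p) + card (cnj ` upper_roots p)"
  proof (rule card_Un_disjoint)
    show "finite (upper_roots p)" using p0 by simp
    then show "finite (cnj ` upper_roots p)" by simp
    have im: "0 < Im z" if "z \<in> upper_roots p" for z using that by (simp add: upper_roots_def)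
    show "upper_roots p \<inter> cnj ` upper_roots p = {}" by (auto dest!: im)
  qed
  also have "card (cnj ` upper_roots p) = card (upper_roots p)" by (rule card_image) (auto simp: inj_on_def)
  finally show ?thesis by simp
qed

text \<open>Up to a null set these are the points of \<open>E_set d s\<close>.\<close>

definition good_set :: "nat \<Rightarrow> nat \<Rightarrow> (nat \<Rightarrow> real) set" where
  "good_set d s = {a \<in> space (lborel_dim d). schur_stable (monic_poly d a) \<and>
     rsquarefree (cpoly (monic_poly d a)) \<and> card (upper_roots (monic_poly d a)) = s}"

lemma sets_good_set [measurable]: "good_set d s \<in> sets (lborel_dim d)"
proof -
  let ?S = "{a \<in> space (lborel_dim d). schur_stable (monic_poly d a)}"
  let ?R = "{a \<in> space (lborel_dim d). rsquarefree (cpoly (monic_poly d a))}"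
  let ?C = "\<lambda>k. {a \<in> space (lborel_dim d). k \<le> card {x. poly (monic_poly d a) x = 0}}"
  have iff: "card (upper_roots (monic_poly d a)) = s \<longleftrightarrow>
      2 * s \<le> d \<and> d - 2 * s \<le> card {x. poly (monic_poly d a) x = 0} \<and> \<not> Suc (d - 2 * s) \<le> card {x. poly (monic_poly d a) x = 0}"
    if "rsquarefree (cpoly (monic_poly d a))" for a s
    using card_roots_cpoly[OF that] by auto
  have "good_set d s = (if 2 * s \<le> d then ?S \<inter> ?R \<inter> (?C (d - 2 * s) - ?C (Suc (d - 2 * s))) else {})"
  proof (rule Set.set_eqI)
    fix a
    show "a \<in> good_set d s \<longleftrightarrow> a \<in> (if 2 * s \<le> d then ?S \<inter> ?R \<inter> (?C (d - 2 * s) - ?C (Suc (d - 2 * s))) else {})"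
      unfolding good_set_def using iff[of a s] by (cases "2 * s \<le> d") (simp_all del: not_less_eq_eq, blast+)
  qed
  also have "\<dots> \<in> sets (lborel_dim d)"
    by (cases "2 * s \<le> d")
      (simp_all only: if_True if_False sets.empty_sets, intro sets.Int sets.Diff sets_stable sets_rsquarefree sets_card_real_roots_ge)
  finally show ?thesis .
qed

lemma vol_eq_measure:
  assumes "d \<ge> 1"
  shows "vol d s = measure (lborel_dim d) (good_set d s)"
proof -
  let ?N = "{a \<in> space (lborel_dim d). \<not> rsquarefree (cpoly (monic_poly d a))}"
  have sp: "space (lborel_dim d) = {1..d} \<rightarrow>\<^sub>E UNIV" by (simp add: space_PiM)
  have E: "a \<in> E_set d s \<longleftrightarrow> a \<in> space (lborel_dim d) \<and> schur_stable (monic_poly d a) \<and>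
      size (filter_mset (\<lambda>z. z \<notin> \<real>) (proots (cpoly (monic_poly d a)))) = 2 * s" for a s
    unfolding E_set_def coeff_poly_eq schur_stable_def sp by auto
  have split: "E_set d s = good_set d s \<union> (E_set d s \<inter> ?N)"
    by (auto simp: E good_set_def size_nonreal_roots)
  have N: "E_set d s \<inter> ?N \<in> null_sets (completion (lborel_dim d))"
    by (rule null_sets_completionI[OF null_not_rsquarefree[OF assms], THEN completion.complete2[rotated]]) auto
  have G: "good_set d s \<in> sets (completion (lborel_dim d))" by (rule sets_completionI_sets[OF sets_good_set])
  have "vol d s = measure (completion (lborel_dim d)) (good_set d s \<union> (E_set d s \<inter> ?N))"
    unfolding vol_def lebesgue_dim_def using split by simp
  also have "\<dots> = measure (completion (lborel_dim d)) (good_set d s)"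
    by (rule measure_Un_null_set[OF G N])
  also have "\<dots> = measure (lborel_dim d) (good_set d s)" by (rule measure_completion[OF sets_good_set])
  finally show ?thesis .
qed

lemma integrable_good_set: "integrable (lborel_dim d) (indicator (good_set d s) :: _ \<Rightarrow> real)"
proof (rule integrable_on_box[where C = 1 and B = "2 ^ d"])
  show "(indicator (good_set d s) :: _ \<Rightarrow> real) \<in> borel_measurable (lborel_dim d)"
    by (rule borel_measurable_indicator[OF sets_good_set])
  show "\<bar>indicator (good_set d s) a :: real\<bar> \<le> 1" for a by (simp split: split_indicator)
  show "\<bar>a i\<bar> \<le> 2 ^ d" if "(indicator (good_set d s) a :: real) \<noteq> 0" "i \<in> {1..d}" for a i
    by (rule stable_monic_poly_bound) (use that in \<open>auto simp: good_set_def split: split_indicator_asm\<close>)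
qed

theorem weighted_integral_one:
  assumes "d \<ge> 1"
  shows "weighted_integral t d (\<lambda>_. 1) = (\<Sum>s\<le>d div 2. vol d s * t ^ s)"
proof -
  have w: "weight t (monic_poly d a) * 1 = (\<Sum>s\<le>d div 2. t ^ s * indicator (good_set d s) a)"
    if a: "a \<in> space (lborel_dim d)" for a
  proof (cases "schur_stable (monic_poly d a) \<and> rsquarefree (cpoly (monic_poly d a))")
    case True
    have le: "card (upper_roots (monic_poly d a)) \<le> d div 2"
      using card_roots_cpoly[of "monic_poly d a"] True by simp
    have "indicator (good_set d s) a = (if s = card (upper_roots (monic_poly d a)) then 1 else 0 :: real)" for s
      using True a by (auto simp: good_set_def split: split_indicator)
    then have "(\<Sum>s\<le>d div 2. t ^ s * indicator (good_set d s) a) = (\<Sum>s\<le>d div 2. if s = card (upper_roots (monic_poly d a)) then t ^ s else 0)"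
      by (intro sum.cong refl) simp
    also have "\<dots> = t ^ card (upper_roots (monic_poly d a))" using le by (subst sum.delta) auto
    finally show ?thesis using True by (simp add: weight_def)
  next
    case False
    then have "a \<notin> good_set d s" for s by (auto simp: good_set_def)
    moreover have "weight t (monic_poly d a) = 0" using False unfolding weight_def by (simp only: if_False)
    ultimately show ?thesis by simp
  qed
  have "weighted_integral t d (\<lambda>_. 1) = (\<integral>a. (\<Sum>s\<le>d div 2. t ^ s * indicator (good_set d s) a) \<partial>lborel_dim d)"
    unfolding weighted_integral_def by (rule Bochner_Integration.integral_cong[OF refl w])
  also have "\<dots> = (\<Sum>s\<le>d div 2. \<integral>a. t ^ s * indicator (good_set d s) a \<partial>lborel_dim d)"
    by (rule Bochner_Integration.integral_sum) (intro integrable_mult_right integrable_good_set)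
  also have "\<dots> = (\<Sum>s\<le>d div 2. vol d s * t ^ s)"
  proof (intro sum.cong refl)
    fix s
    have "(\<integral>a. t ^ s * indicator (good_set d s) a \<partial>lborel_dim d) = t ^ s * measure (lborel_dim d) (good_set d s \<inter> space (lborel_dim d))"
      by simp
    also have "good_set d s \<inter> space (lborel_dim d) = good_set d s" by (auto simp: good_set_def)
    finally show "(\<integral>a. t ^ s * indicator (good_set d s) a \<partial>lborel_dim d) = vol d s * t ^ s"
      by (simp only: vol_eq_measure[OF assms] mult.commute)
  qed
  finally show ?thesis .
qed

section \<open>Minors of shifted coefficients\<close>

text \<open>The determinant of matrices of variable size, as opposed to that of matrices indexed by types, which occurs in Jacobians.\<close>

abbreviation jdet :: "'a::comm_ring_1 mat \<Rightarrow> 'a" where "jdet \<equiv> Determinant.det"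

text \<open>The rows \<open>js\<close> of the matrix with the columns \<open>h, X h, X\<^sup>2 h, \<dots>\<close>, as many columns as rows.\<close>

definition minor :: "real poly \<Rightarrow> nat list \<Rightarrow> real" where
  "minor h js = jdet (mat (length js) (length js) (\<lambda>(i, l). coeff (monom 1 l * h) (js ! i)))"

lemma det_mat_eq: "jdet (mat n n f) = (\<Sum>p | p permutes {0..<n}. signof p * (\<Prod>i = 0..<n. f (i, p i)))"
proof -
  have "(\<Prod>i = 0..<n. mat n n f $$ (i, p i)) = (\<Prod>i = 0..<n. f (i, p i))" if "p permutes {0..<n}" for p
    by (rule prod.cong) (use that permutes_in_image[OF that] in auto)
  then show ?thesis unfolding det_def'[OF mat_carrier] by (intro sum.cong refl) auto
qed

lemma det_row_sum:
  assumes "r < n"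
  shows "jdet (mat n n (\<lambda>(i, l). if i = r then \<Sum>j\<in>J. c j * a j l else B i l)) =
    (\<Sum>j\<in>J. c j * jdet (mat n n (\<lambda>(i, l). if i = r then a j l else B i l)))"
proof -
  have sp: "(\<Prod>i = 0..<n. if i = r then x else b i) = x * (\<Prod>i\<in>{0..<n} - {r}. b i)" for x and b :: "nat \<Rightarrow> 'a"
  proof -
    have "(\<Prod>i = 0..<n. if i = r then x else b i) = x * (\<Prod>i\<in>{0..<n} - {r}. if i = r then x else b i)"
      using assms by (subst prod.remove[of _ r]) auto
    also have "(\<Prod>i\<in>{0..<n} - {r}. if i = r then x else b i) = (\<Prod>i\<in>{0..<n} - {r}. b i)"
      by (rule prod.cong) auto
    finally show ?thesis .
  qed
  have L: "(case (i, l) of (i, l) \<Rightarrow> if i = r then \<Sum>j\<in>J. c j * a j l else B i l) = (if i = r then (\<Sum>j\<in>J. c j * a j (l :: nat)) else B i l)" for i l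
    by simp
  show ?thesis
    unfolding det_mat_eq prod.case
  proof -
    have "(\<Sum>p | p permutes {0..<n}. signof p * (\<Prod>i = 0..<n. if i = r then \<Sum>j\<in>J. c j * a j (p i) else B i (p i)))
      = (\<Sum>p | p permutes {0..<n}. \<Sum>j\<in>J. c j * (signof p * (\<Prod>i = 0..<n. if i = r then a j (p i) else B i (p i))))"
    proof (intro sum.cong refl)
      fix p
      have "(\<Prod>i = 0..<n. if i = r then \<Sum>j\<in>J. c j * a j (p i) else B i (p i)) = (\<Prod>i = 0..<n. if i = r then \<Sum>j\<in>J. c j * a j (p r) else B i (p i))"
        by (rule prod.cong) auto
      also have "\<dots> = (\<Sum>j\<in>J. c j * a j (p r)) * (\<Prod>i\<in>{0..<n} - {r}. B i (p i))" by (rule sp)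
      also have "\<dots> = (\<Sum>j\<in>J. c j * (a j (p r) * (\<Prod>i\<in>{0..<n} - {r}. B i (p i))))"
        by (simp add: sum_distrib_right mult.assoc)
      also have "\<dots> = (\<Sum>j\<in>J. c j * (\<Prod>i = 0..<n. if i = r then a j (p i) else B i (p i)))"
      proof (intro sum.cong refl arg_cong2[where f="(*)"])
        fix j
        have "(\<Prod>i = 0..<n. if i = r then a j (p i) else B i (p i)) = (\<Prod>i = 0..<n. if i = r then a j (p r) else B i (p i))"
          by (rule prod.cong) auto
        then show "a j (p r) * (\<Prod>i\<in>{0..<n} - {r}. B i (p i)) = (\<Prod>i = 0..<n. if i = r then a j (p i) else B i (p i))"
          using sp by simp
      qed
      finally show "signof p * (\<Prod>i = 0..<n. if i = r then \<Sum>j\<in>J. c j * a j (p i) else B i (p i)) =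
          (\<Sum>j\<in>J. c j * (signof p * (\<Prod>i = 0..<n. if i = r then a j (p i) else B i (p i))))"
        by (simp only: sum_distrib_left mult.left_commute)
    qed
    also have "\<dots> = (\<Sum>j\<in>J. c j * (\<Sum>p | p permutes {0..<n}. signof p * (\<Prod>i = 0..<n. if i = r then a j (p i) else B i (p i))))"
      by (subst sum.swap) (simp only: sum_distrib_left)
    finally show "(\<Sum>p | p permutes {0..<n}. signof p * (\<Prod>i = 0..<n. if i = r then \<Sum>j\<in>J. c j * a j (p i) else B i (p i))) = \<dots>" .
  qed
qed

lemma poly_eq_sum_monom: "degree p < n \<Longrightarrow> (p :: real poly) = (\<Sum>l<n. smult (coeff p l) (monom 1 l))"
  by (rule poly_eqI) (simp add: coeff_sum coeff_eq_0 mult_delta_right)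

text \<open>Let \<open>v 0\<close>, ..., \<open>v (r - 1)\<close> be linear functionals that vanish on the multiples of \<open>q\<close>, which has degree \<open>r\<close>. The matrix on
the right has the columns \<open>h, X h, X\<^sup>2 h, \<dots>\<close>. The unitriangular change to the columns
\<open>h, X h, \<dots>, X^(r - 1) h, q h, X q h, \<dots>\<close> leaves its determinant unchanged and makes it block triangular.\<close>

lemma minor_mult:
  fixes v :: "nat \<Rightarrow> nat \<Rightarrow> real"
  assumes q: "degree q = r" "lead_coeff q = 1" and h: "h \<noteq> 0"
    and N: "degree h + r + length js = N"
    and van: "\<And>i p. i < r \<Longrightarrow> degree p < N \<Longrightarrow> q dvd p \<Longrightarrow> (\<Sum>j<N. v i j * coeff p j) = 0"
  shows "jdet (mat r r (\<lambda>(i, l). \<Sum>j<N. v i j * coeff (monom 1 l * h) j)) * minor (q * h) js =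
    jdet (mat (r + length js) (r + length js)
      (\<lambda>(i, l). if i < r then \<Sum>j<N. v i j * coeff (monom 1 l * h) j else coeff (monom 1 l * h) (js ! (i - r))))"
proof -
  define m where "m = length js"
  define \<phi> where "\<phi> i p = (if i < r then \<Sum>j<N. v i j * coeff p j else coeff p (js ! (i - r)))" for i p
  define b where "b c = (if c < r then monom 1 c else monom 1 (c - r) * q)" for c
  have q0: "q \<noteq> 0" using q(2) by auto
  have lin: "\<phi> i (\<Sum>l\<in>I. smult (c l) (f l)) = (\<Sum>l\<in>I. c l * \<phi> i (f l))" for i I c and f :: "nat \<Rightarrow> real poly"
    unfolding \<phi>_def by (auto simp: coeff_sum sum_distrib_left sum.swap[of _ I] algebra_simps)
  have db: "degree (b c) = c" for c
    unfolding b_def using q q0 by (auto simp: degree_monom_eq degree_mult_eq)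
  let ?A = "mat (r + m) (r + m) (\<lambda>(i, l). \<phi> i (monom 1 l * h))"
  let ?U = "mat (r + m) (r + m) (\<lambda>(l, c). coeff (b c) l)"
  have detU: "jdet ?U = 1"
  proof -
    have "upper_triangular ?U" by (auto simp: coeff_eq_0 db)
    then have "jdet ?U = prod_list (diag_mat ?U)" by (rule det_upper_triangular) (rule mat_carrier)
    also have "diag_mat ?U = map (\<lambda>c. coeff (b c) c) [0..<r + m]" by (auto simp: diag_mat_def)
    also have "\<dots> = map (\<lambda>c. 1) [0..<r + m]"
    proof (intro map_cong refl)
      fix c
      have "lead_coeff (b c) = 1" unfolding b_def using q(2) by (auto simp: lead_coeff_mult degree_monom_eq)
      then show "coeff (b c) c = 1" by (simp add: db)
    qed
    finally show ?thesis by (simp add: map_replicate_const prod_list_replicate)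
  qed
  have AU: "?A * ?U = mat (r + m) (r + m) (\<lambda>(i, c). \<phi> i (b c * h))"
  proof (rule eq_matI)
    fix i c assume ic: "i < dim_row (mat (r + m) (r + m) (\<lambda>(i, c). \<phi> i (b c * h)))" "c < dim_col (mat (r + m) (r + m) (\<lambda>(i, c). \<phi> i (b c * h)))"
    then have ic: "i < r + m" "c < r + m" by auto
    have "b c = (\<Sum>l<r + m. smult (coeff (b c) l) (monom 1 l))" by (rule poly_eq_sum_monom) (simp add: db ic)
    then have "b c * h = (\<Sum>l<r + m. smult (coeff (b c) l) (monom 1 l)) * h" by simp
    also have "\<dots> = (\<Sum>l<r + m. smult (coeff (b c) l) (monom 1 l * h))" by (simp add: sum_distrib_right)
    finally have "\<phi> i (b c * h) = (\<Sum>l<r + m. coeff (b c) l * \<phi> i (monom 1 l * h))" by (simp only: lin)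
    then show "(?A * ?U) $$ (i, c) = mat (r + m) (r + m) (\<lambda>(i, c). \<phi> i (b c * h)) $$ (i, c)"
      using ic by (simp add: scalar_prod_def lessThan_atLeast0 mult.commute)
  qed auto
  define A1 where "A1 = mat r r (\<lambda>(i, l). \<Sum>j<N. v i j * coeff (monom 1 l * h) j)"
  define A3 where "A3 = mat m r (\<lambda>(i, l). coeff (monom 1 l * h) (js ! i))"
  define A4 where "A4 = mat m m (\<lambda>(i, l). coeff (monom 1 l * (q * h)) (js ! i))"
  have z: "(\<Sum>j<N. v i j * coeff (monom 1 l * q * h) j) = 0" if "i < r" "l < m" for i l
  proof (rule van[OF that(1)])
    have "degree (monom 1 l * q * h) = l + r + degree h" using h q0 q(1) by (simp add: degree_mult_eq degree_monom_eq)
    then show "degree (monom 1 l * q * h) < N" using N that(2) by (simp add: m_def)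
    show "q dvd monom 1 l * q * h" by simp
  qed
  have "?A * ?U = four_block_mat A1 (0\<^sub>m r m) A3 A4"
  proof (rule eq_matI)
    fix i c assume "i < dim_row (four_block_mat A1 (0\<^sub>m r m) A3 A4)" "c < dim_col (four_block_mat A1 (0\<^sub>m r m) A3 A4)"
    then have ic: "i < r + m" "c < r + m" by (auto simp: A1_def A4_def)
    then show "(?A * ?U) $$ (i, c) = four_block_mat A1 (0\<^sub>m r m) A3 A4 $$ (i, c)"
      unfolding AU by (auto simp: A1_def A3_def A4_def \<phi>_def b_def z[unfolded mult.assoc] mult.assoc)
  qed (auto simp: AU A1_def A4_def)
  then have "jdet (?A * ?U) = jdet A1 * jdet A4"
    by (simp only:) (rule det_four_block_mat_upper_right_zero[of _ r _ m], auto simp: A1_def A3_def A4_def)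
  moreover have "jdet (?A * ?U) = jdet ?A * jdet ?U" by (rule det_mult[of _ "r + m"]) auto
  ultimately show ?thesis using detU by (simp add: A1_def A4_def minor_def m_def[symmetric] \<phi>_def[abs_def])
qed

text \<open>The functional for the factor \<open>X - x\<close> is evaluation at \<open>x\<close>.\<close>

lemma minor_linear:
  assumes h: "h \<noteq> 0" and N: "degree h + 1 + length js = N"
  shows "poly h x * minor ([:- x, 1:] * h) js = (\<Sum>j<N. x ^ j * minor h (j # js))"
proof -
  have P: "(\<Sum>j<N. x ^ j * coeff p j) = poly p x" if "degree p < N" for p
  proof -
    have "poly p x = (\<Sum>j\<le>degree p. coeff p j * x ^ j)" by (rule poly_altdef)
    also have "\<dots> = (\<Sum>j<N. coeff p j * x ^ j)"
      by (rule sum.mono_neutral_left) (use that in \<open>auto simp: coeff_eq_0\<close>)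
    finally show ?thesis by (simp add: mult.commute)
  qed
  have "jdet (mat 1 1 (\<lambda>(i, l). \<Sum>j<N. x ^ j * coeff (monom 1 l * h) j)) * minor ([:- x, 1:] * h) js =
    jdet (mat (1 + length js) (1 + length js)
      (\<lambda>(i, l). if i < 1 then \<Sum>j<N. x ^ j * coeff (monom 1 l * h) j else coeff (monom 1 l * h) (js ! (i - 1))))"
  proof (rule minor_mult[where v = "\<lambda>i j. x ^ j", OF _ _ h])
    fix p :: "real poly" assume "degree p < N" "[:- x, 1:] dvd p"
    then show "(\<Sum>j<N. x ^ j * coeff p j) = 0" by (simp only: P poly_eq_0_iff_dvd[symmetric])
  qed (use N in auto)
  moreover have "jdet (mat 1 1 (\<lambda>(i, l). \<Sum>j<N. x ^ j * coeff (monom 1 l * h) j)) = poly h x"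
    using N P[of h] by (subst det_single) (auto simp: monom_0)
  moreover have "jdet (mat (1 + length js) (1 + length js)
      (\<lambda>(i, l). if i < 1 then \<Sum>j<N. x ^ j * coeff (monom 1 l * h) j else coeff (monom 1 l * h) (js ! (i - 1))))
    = jdet (mat (1 + length js) (1 + length js)
      (\<lambda>(i, l). if i = 0 then \<Sum>j<N. x ^ j * coeff (monom 1 l * h) j else coeff (monom 1 l * h) (js ! (i - 1))))"
    by (intro arg_cong[where f = jdet] cong_mat) auto
  moreover have "\<dots> = (\<Sum>j<N. x ^ j * jdet (mat (1 + length js) (1 + length js)
      (\<lambda>(i, l). if i = 0 then coeff (monom 1 l * h) j else coeff (monom 1 l * h) (js ! (i - 1)))))"
    by (rule det_row_sum) simp
  moreover have "jdet (mat (1 + length js) (1 + length js)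
      (\<lambda>(i, l). if i = 0 then coeff (monom 1 l * h) j else coeff (monom 1 l * h) (js ! (i - 1)))) = minor h (j # js)" for j
    unfolding minor_def by (intro arg_cong[where f = jdet] cong_mat) (auto simp: nth_Cons')
  ultimately show ?thesis by simp
qed

lemma mod_quadI: "p = quad u w * s + [:a, b:] \<Longrightarrow> p mod quad u w = [:a, b:]"
  by (simp add: mod_poly_less degree_pCons_eq_if)

lemma mod_quad_sum:
  assumes "degree p < N"
  shows "p mod quad u w = [:\<Sum>j<N. lucas_const u w j * coeff p j, \<Sum>j<N. lucas u w j * coeff p j:]"
proof -
  have "p = (\<Sum>k<N. smult (coeff p k) (monom 1 k))" by (rule poly_eq_sum_monom[OF assms])
  also have "\<dots> = (\<Sum>k<N. quad u w * smult (coeff p k) (power_quot u w k) +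
      [:lucas_const u w k * coeff p k, lucas u w k * coeff p k:])"
    by (subst monom_eq_quad_mult[of _ u w]) (simp add: smult_add_right mult.commute)
  also have "\<dots> = quad u w * (\<Sum>k<N. smult (coeff p k) (power_quot u w k)) +
      [:\<Sum>j<N. lucas_const u w j * coeff p j, \<Sum>j<N. lucas u w j * coeff p j:]"
    unfolding sum.distrib sum_distrib_left sum_pCons2 ..
  finally show ?thesis
    by (rule mod_quadI)
qed

lemma det_2_mat: "jdet (mat 2 2 f) = f (0, 0) * f (1, 1) - f (0, 1) * f (1, 0)"
proof -
  have "{0..<2::nat} = {0, 1}" by auto
  moreover have "{p. p permutes {0, 1::nat}} = {id, Transposition.transpose 0 1}"
    by (simp add: permutes_doubleton_iff[symmetric] set_eq_iff)
  moreover have ne: "id \<noteq> Transposition.transpose 0 (1::nat)"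
    by (metis id_apply transpose_apply_first zero_neq_one)
  moreover have "sign (Transposition.transpose 0 (1::nat)) = - 1" by (simp add: sign_swap_id)
  ultimately show ?thesis unfolding det_mat_eq by simp
qed

text \<open>The two functionals for \<open>quad u w\<close> are the coefficients of the remainder; their values on the powers of \<open>X\<close> are
\<open>lucas_const\<close> and \<open>lucas\<close>. Their matrix at \<open>h\<close> and \<open>X h\<close> has the resultant as determinant. Expanding along the first two rows
gives minors of \<open>h\<close> with two more rows.\<close>

lemma minor_quad:
  assumes h: "h \<noteq> 0" and N: "degree h + 2 + length js = N"
  shows "res u w h * minor (quad u w * h) js =
    (\<Sum>j<N. \<Sum>k<N. lucas_const u w j * lucas u w k * minor h (j # k # js))"
proof -
  define v where "v i = (if i = 0 then lucas_const u w else lucas u w)" for i :: nat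
  define m where "m = length js"
  have V: "(\<Sum>j<N. v i j * coeff p j) = coeff (p mod quad u w) i" if "degree p < N" "i < 2" for i p
    using that(2) unfolding mod_quad_sum[OF that(1)] v_def by (auto simp: less_2_cases_iff One_nat_def)
  have "jdet (mat 2 2 (\<lambda>(i, l). \<Sum>j<N. v i j * coeff (monom 1 l * h) j)) * minor (quad u w * h) js =
    jdet (mat (2 + m) (2 + m)
      (\<lambda>(i, l). if i < 2 then \<Sum>j<N. v i j * coeff (monom 1 l * h) j else coeff (monom 1 l * h) (js ! (i - 2))))"
    unfolding m_def
  proof (rule minor_mult[OF _ _ h])
    show "coeff (quad u w) (degree (quad u w)) = 1" by (simp add: quad_def)
    fix p and i :: nat assume "i < 2" "degree p < N" "quad u w dvd p"
    then show "(\<Sum>j<N. v i j * coeff p j) = 0" by (simp add: V)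
  qed (use N in auto)
  moreover have "jdet (mat 2 2 (\<lambda>(i, l). \<Sum>j<N. v i j * coeff (monom 1 l * h) j)) = res u w h"
  proof -
    define r0 r1 where "r0 = coeff (h mod quad u w) 0" and "r1 = coeff (h mod quad u w) 1"
    have hm: "h = quad u w * (h div quad u w) + [:r0, r1:]"
      using mod_quad_eq[of h u w] by (metis mult_div_mod_eq r0_def r1_def)
    have "[:0, 1:] * h = quad u w * ([:0, 1:] * (h div quad u w) + [:r1:]) + [:- w * r1, r0 - u * r1:]"
      by (subst hm) (simp add: quad_def algebra_simps)
    then have "([:0, 1:] * h) mod quad u w = [:- w * r1, r0 - u * r1:]" by (rule mod_quadI)
    then have m1: "(monom 1 1 * h) mod quad u w = [:- w * r1, r0 - u * r1:]" by (simp add: monom_altdef)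
    have d: "degree (monom 1 0 * h) < N" "degree (monom 1 1 * h) < N" using N h by (auto simp: degree_mult_eq degree_monom_eq)
    show ?thesis unfolding det_2_mat prod.case V[OF d(1)] V[OF d(2)]
      using V[OF d(1), of 0] V[OF d(1), of 1] V[OF d(2), of 0] V[OF d(2), of 1]
      by (simp add: m1 res_eqI[OF hm] monom_0 r0_def[symmetric] r1_def[symmetric] One_nat_def[symmetric])
         (simp add: algebra_simps power2_eq_square One_nat_def r0_def r1_def)
  qed
  moreover have "jdet (mat (2 + m) (2 + m)
      (\<lambda>(i, l). if i < 2 then \<Sum>j<N. v i j * coeff (monom 1 l * h) j else coeff (monom 1 l * h) (js ! (i - 2))))
    = jdet (mat (2 + m) (2 + m)
      (\<lambda>(i, l). if i = 0 then \<Sum>j<N. lucas_const u w j * coeff (monom 1 l * h) j else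
         if i = 1 then \<Sum>j<N. lucas u w j * coeff (monom 1 l * h) j else coeff (monom 1 l * h) (js ! (i - 2))))"
    by (intro arg_cong[where f = jdet] cong_mat) (auto simp: v_def)
  moreover have "\<dots> = (\<Sum>j<N. lucas_const u w j * jdet (mat (2 + m) (2 + m)
      (\<lambda>(i, l). if i = 0 then coeff (monom 1 l * h) j else
         if i = 1 then \<Sum>j<N. lucas u w j * coeff (monom 1 l * h) j else coeff (monom 1 l * h) (js ! (i - 2)))))"
    by (rule det_row_sum) simp
  moreover have "jdet (mat (2 + m) (2 + m)
      (\<lambda>(i, l). if i = 0 then coeff (monom 1 l * h) j else
         if i = 1 then \<Sum>j<N. lucas u w j * coeff (monom 1 l * h) j else coeff (monom 1 l * h) (js ! (i - 2))))
    = jdet (mat (2 + m) (2 + m)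
      (\<lambda>(i, l). if i = 1 then \<Sum>j<N. lucas u w j * coeff (monom 1 l * h) j else
         if i = 0 then coeff (monom 1 l * h) j else coeff (monom 1 l * h) (js ! (i - 2))))" for j
    by (intro arg_cong[where f = jdet] cong_mat) auto
  moreover have "jdet (mat (2 + m) (2 + m)
      (\<lambda>(i, l). if i = 1 then \<Sum>j<N. lucas u w j * coeff (monom 1 l * h) j else
         if i = 0 then coeff (monom 1 l * h) j else coeff (monom 1 l * h) (js ! (i - 2))))
     = (\<Sum>k<N. lucas u w k * jdet (mat (2 + m) (2 + m)
      (\<lambda>(i, l). if i = 1 then coeff (monom 1 l * h) k else
         if i = 0 then coeff (monom 1 l * h) j else coeff (monom 1 l * h) (js ! (i - 2)))))" for j
    by (rule det_row_sum) simp
  moreover have "jdet (mat (2 + m) (2 + m)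
      (\<lambda>(i, l). if i = 1 then coeff (monom 1 l * h) k else
         if i = 0 then coeff (monom 1 l * h) j else coeff (monom 1 l * h) (js ! (i - 2)))) = minor h (j # k # js)" for j k
    unfolding minor_def m_def by (intro arg_cong[where f = jdet] cong_mat) (auto simp: nth_Cons' numeral_2_eq_2 One_nat_def)
  ultimately show ?thesis by (simp add: sum_distrib_left mult.assoc)
qed

lemma minor_swap: "minor h (j # k # js) = - minor h (k # j # js)"
proof -
  let ?f = "\<lambda>js (i, l). coeff (monom 1 l * h) (js ! i)"
  let ?n = "length (j # k # js)"
  have "minor h (k # j # js) = jdet (swaprows 0 1 (mat ?n ?n (?f (j # k # js))))"
    unfolding minor_def by (intro arg_cong[where f = jdet] eq_matI) (auto simp: mat_swaprows_def nth_Cons' One_nat_def)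
  also have "\<dots> = - jdet (mat ?n ?n (?f (j # k # js)))" by (rule det_swaprows[of _ ?n]) auto
  finally show ?thesis by (simp add: minor_def)
qed

section \<open>Moments of quadratic factors\<close>

lemma integral_vec2_iterated:
  fixes f :: "real^2 \<Rightarrow> real"
  assumes "integrable lborel f"
  shows "(\<integral>v. f v \<partial>lborel) = (\<integral>w. \<integral>u. f (vec2 (u, w)) \<partial>lborel \<partial>lborel)"
proof -
  have m: "vec2 \<in> measurable lborel borel" using measurable_vec2 by simp
  have fm: "f \<in> borel_measurable borel" using assms by (simp add: integrable_iff_bounded)
  have "integrable (distr lborel borel vec2) f" unfolding distr_vec2 by (rule assms)
  then have "integrable lborel (\<lambda>p. f (vec2 p))" using integrable_distr_eq[OF m fm] by simp
  then have i: "integrable (lborel \<Otimes>\<^sub>M lborel) (\<lambda>(u, w). f (vec2 (u, w)))" by (simp add: lborel_prod case_prod_beta')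
  have "(\<integral>v. f v \<partial>lborel) = (\<integral>v. f v \<partial>distr lborel borel vec2)" by (simp only: distr_vec2)
  also have "\<dots> = (\<integral>p. f (vec2 p) \<partial>lborel)" by (rule integral_distr[OF m fm])
  also have "\<dots> = (\<integral>(u, w). f (vec2 (u, w)) \<partial>(lborel \<Otimes>\<^sub>M lborel))" by (simp add: lborel_prod case_prod_beta')
  also have "\<dots> = (\<integral>w. \<integral>u. f (vec2 (u, w)) \<partial>lborel \<partial>lborel)"
    using lborel_pair.Fubini_integral[OF i] lborel_pair.integral_fst'[OF i] by simp
  finally show ?thesis .
qed

lemma rsquarefree_quad_iff: "rsquarefree (cpoly (quad u w)) \<longleftrightarrow> u\<^sup>2 \<noteq> 4 * w"
proof -
  obtain x y where xy: "x + y = - of_real u" "x * y = of_real w" "poly (cpoly (quad u w)) x = 0" "poly (cpoly (quad u w)) y = 0"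
    using quad_roots .
  have "(x - y)\<^sup>2 = (x + y)\<^sup>2 - 4 * (x * y)" by (simp add: power2_eq_square algebra_simps)
  also have "\<dots> = of_real (u\<^sup>2 - 4 * w)" unfolding xy by simp
  finally have D: "x = y \<longleftrightarrow> u\<^sup>2 = 4 * w" by (metis eq_iff_diff_eq_0 of_real_eq_0_iff power_eq_0_iff zero_neq_numeral zero_power2 power2_eq_iff_nonneg)
  have ou: "of_real u = - (x + y)" using xy(1) by simp
  have pd: "poly (cpoly (pderiv (quad u w))) z = (z - x) + (z - y)" for z
    by (simp add: quad_def pderiv_pCons map_poly_pCons ou)
  have "rsquarefree (cpoly (quad u w)) \<longleftrightarrow> \<not> (\<exists>z. (z - x) * (z - y) = 0 \<and> (z - x) + (z - y) = 0)"
    unfolding rsquarefree_roots pderiv_cpoly pd poly_quad_roots[OF xy(1,2)] by blast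
  also have "\<dots> \<longleftrightarrow> x \<noteq> y" by auto
  finally show ?thesis using D by simp
qed

text \<open>The stability triangle.\<close>

lemma stable_quad_iff: "schur_stable (quad u w) \<longleftrightarrow> \<bar>u\<bar> < 1 + w \<and> w < 1"
proof -
  obtain x y where xy: "x + y = - of_real u" "x * y = of_real w" "poly (cpoly (quad u w)) x = 0" "poly (cpoly (quad u w)) y = 0"
    using quad_roots .
  have st: "schur_stable (quad u w) \<longleftrightarrow> cmod x < 1 \<and> cmod y < 1"
    unfolding schur_stable_def poly_quad_roots[OF xy(1,2)] by auto
  have im: "Im x = - Im y" "Re x + Re y = - u" "Re x * Re y - Im x * Im y = w" "Re x * Im y + Im x * Re y = 0"
    using xy(1,2) by (auto simp: complex_eq_iff)
  then have "Im y * (Re x - Re y) = 0" by (simp add: algebra_simps)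
  then consider "Im y = 0" | "Im y \<noteq> 0" "Re x = Re y" by auto
  then show ?thesis
  proof cases
    case 1
    define a b where "a = Re x" and "b = Re y"
    have r: "x = of_real a" "y = of_real b" using 1 im(1) by (auto simp: complex_eq_iff a_def b_def)
    have u: "u = - (a + b)" and w: "w = a * b" using im 1 by (simp_all add: a_def b_def)
    have i: "1 + u + w = (1 - a) * (1 - b)" "1 - u + w = (1 + a) * (1 + b)" by (simp_all add: u w algebra_simps)
    have "\<bar>a\<bar> < 1 \<and> \<bar>b\<bar> < 1 \<longleftrightarrow> \<bar>u\<bar> < 1 + w \<and> w < 1"
    proof
      assume ab: "\<bar>a\<bar> < 1 \<and> \<bar>b\<bar> < 1"
      then have "0 < (1 - a) * (1 - b)" "0 < (1 + a) * (1 + b)" by (auto intro!: mult_pos_pos)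
      moreover have "\<bar>a\<bar> * \<bar>b\<bar> < 1 * 1" using ab by (intro mult_strict_mono') auto
      ultimately show "\<bar>u\<bar> < 1 + w \<and> w < 1" unfolding i[symmetric] by (auto simp: w abs_mult[symmetric])
    next
      assume h: "\<bar>u\<bar> < 1 + w \<and> w < 1"
      then have p: "0 < (1 - a) * (1 - b)" "0 < (1 + a) * (1 + b)" unfolding i[symmetric] by auto
      have "a < 1"
      proof (rule ccontr)
        assume "\<not> a < 1"
        then have "1 \<le> a" by simp
        then have "b > 1" using p(1) by (auto simp: zero_less_mult_iff)
        then have "1 * 1 \<le> a * b" using \<open>1 \<le> a\<close> by (intro mult_mono) auto
        then show False using h w by simp
      qed
      moreover have "- 1 < a"
      proof (rule ccontr)
        assume "\<not> - 1 < a"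
        then have "1 \<le> - a" by simp
        then have "- b > 1" using p(2) by (auto simp: zero_less_mult_iff)
        then have "1 * 1 \<le> (- a) * (- b)" using \<open>1 \<le> - a\<close> by (intro mult_mono) auto
        then show False using h w by simp
      qed
      ultimately have "\<bar>a\<bar> < 1" by auto
      moreover have "b < 1" "- 1 < b" using p \<open>a < 1\<close> \<open>- 1 < a\<close> by (auto simp: zero_less_mult_iff)
      ultimately show "\<bar>a\<bar> < 1 \<and> \<bar>b\<bar> < 1" by auto
    qed
    then show ?thesis unfolding st r by simp
  next
    case 2
    have w: "w = (Re y)\<^sup>2 + (Im y)\<^sup>2" "u = - 2 * Re y" using im 2 by (auto simp: power2_eq_square)
    have c: "cmod x = sqrt w" "cmod y = sqrt w" using im 2 by (simp_all add: cmod_def w)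
    have "\<bar>u\<bar> < 1 + w"
    proof -
      have "0 < (1 - \<bar>Re y\<bar>)\<^sup>2 + (Im y)\<^sup>2" using 2 by (simp add: add_nonneg_pos)
      then show ?thesis unfolding w by (simp add: power2_eq_square algebra_simps)
    qed
    then show ?thesis unfolding st c by simp
  qed
qed

lemma card_upper_roots_quad:
  assumes "u\<^sup>2 \<noteq> 4 * w"
  shows "card (upper_roots (quad u w)) = (if u\<^sup>2 < 4 * w then 1 else 0)"
proof -
  obtain x y where xy: "x + y = - of_real u" "x * y = of_real w" "poly (cpoly (quad u w)) x = 0" "poly (cpoly (quad u w)) y = 0"
    using quad_roots .
  have im: "Im x = - Im y" "Re x + Re y = - u" "Re x * Re y - Im x * Im y = w" "Re x * Im y + Im x * Re y = 0"
    using xy(1,2) by (auto simp: complex_eq_iff)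
  then have "Im y * (Re x - Re y) = 0" by (simp add: algebra_simps)
  then consider "Im y = 0" | "Im y \<noteq> 0" "Re x = Re y" by auto
  then show ?thesis
  proof cases
    case 1
    have u: "u = - (Re x + Re y)" and w: "w = Re x * Re y" using im 1 by simp_all
    have "u\<^sup>2 - 4 * w = (Re x - Re y)\<^sup>2" by (simp add: u w power2_eq_square algebra_simps)
    then have "\<not> u\<^sup>2 < 4 * w" by (metis diff_ge_0_iff_ge not_less zero_le_power2)
    moreover have "upper_roots (quad u w) = {}"
      unfolding upper_roots_def poly_quad_roots[OF xy(1,2)] using 1 im(1) by auto
    ultimately show ?thesis by simp
  next
    case 2
    have "w = (Re y)\<^sup>2 + (Im y)\<^sup>2" "u = - 2 * Re y" using im 2 by (auto simp: power2_eq_square)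
    then have "4 * w - u\<^sup>2 = 4 * (Im y)\<^sup>2" by (simp add: power2_eq_square)
    then have "u\<^sup>2 < 4 * w" using 2 by (smt (verit) zero_less_power2)
    moreover have "upper_roots (quad u w) = {if Im x > 0 then x else y}"
      unfolding upper_roots_def poly_quad_roots[OF xy(1,2)] using 2 im(1) by auto
    ultimately show ?thesis by simp
  qed
qed

lemma weight_quad:
  "weight t (quad u w) = (if \<bar>u\<bar> < 1 + w \<and> w < 1 \<and> u\<^sup>2 \<noteq> 4 * w then if u\<^sup>2 < 4 * w then t else 1 else 0)"
  unfolding weight_def stable_quad_iff rsquarefree_quad_iff by (simp add: card_upper_roots_quad)

lemma integrable_weight_quad:
  fixes f :: "real^2 \<Rightarrow> real"
  assumes f: "continuous_on UNIV f" and t: "0 \<le> t" "t \<le> 1"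
  shows "integrable lborel (\<lambda>v. weight t (quad (v $ 1) (v $ 2)) * f v)"
proof -
  let ?B = "cbox (vec2 (- 4, - 4)) (vec2 (4, 4))"
  have "compact (f ` ?B)" by (intro compact_continuous_image continuous_on_subset[OF f]) auto
  then obtain C where C: "\<And>v. v \<in> ?B \<Longrightarrow> \<bar>f v\<bar> \<le> C" using compact_imp_bounded bounded_iff by (metis image_eqI real_norm_def)
  have "integrable lborel (indicator ?B :: _ \<Rightarrow> real)" by (intro integrable_real_indicator emeasure_lborel_cbox_finite) auto
  then have "integrable lborel (\<lambda>v. C * indicator ?B v)" by (rule integrable_mult_right)
  moreover have "f \<in> borel_measurable lborel" using borel_measurable_continuous_onI[OF f] by simp
  then have "(\<lambda>v. weight t (quad (v $ 1) (v $ 2)) * f v) \<in> borel_measurable lborel"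
    by (intro borel_measurable_times measurable_weight_quad measurable_vec_nth)
  ultimately show ?thesis
  proof (rule Bochner_Integration.integrable_bound, intro AE_I2)
    fix v :: "real^2"
    show "norm (weight t (quad (v $ 1) (v $ 2)) * f v) \<le> norm (C * indicator ?B v)"
    proof (cases "weight t (quad (v $ 1) (v $ 2)) = 0")
      case False
      then have "schur_stable (quad (v $ 1) (v $ 2))" by (rule weight_nonzero_stable)
      then have v: "v \<in> ?B"
        using stable_quad_bound[of "v $ 1" "v $ 2"] by (auto simp: mem_box_cart forall_2 abs_le_iff minus_le_iff)
      have "\<bar>weight t (quad (v $ 1) (v $ 2))\<bar> * \<bar>f v\<bar> \<le> 1 * C"
        by (intro mult_mono weight_abs_le_1 t C v) auto
      then show ?thesis using v by (simp add: abs_mult)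
    qed simp
  qed
qed

lemma lucas_reflect: "lucas (- u) w k = (- 1) ^ (k + 1) * lucas u w k"
  by (induction k rule: induct_nat_012) (simp_all add: algebra_simps)

lemma lucas_const_reflect: "lucas_const (- u) w k = (- 1) ^ k * lucas_const u w k"
  by (cases k) (simp_all add: lucas_const_def lucas_reflect power_add)

lemma lucas_const_Suc: "lucas_const u w (Suc k) = - w * lucas u w k"
  by (simp add: lucas_const_def)

lemma lucas_Suc_const: "lucas u w (Suc k) = lucas_const u w k - u * lucas u w k"
  by (cases k) (simp_all add: lucas_const_def)

text \<open>Antisymmetrising in the two indices leaves a single Lucas number, which can be integrated in closed form.\<close>

lemma lucas_casorati: "lucas_const u w j * lucas u w (j + l) - lucas_const u w (j + l) * lucas u w j = w ^ j * lucas u w l"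
proof (induction j)
  case 0
  show ?case by (simp add: lucas_const_def)
next
  case (Suc j)
  have "lucas_const u w (Suc j) * lucas u w (Suc j + l) - lucas_const u w (Suc j + l) * lucas u w (Suc j) =
      w * (lucas_const u w j * lucas u w (j + l) - lucas_const u w (j + l) * lucas u w j)"
    unfolding add_Suc lucas_const_Suc lucas_Suc_const by (simp add: algebra_simps)
  then show ?case using Suc.IH by simp
qed

definition pair_moment :: "real \<Rightarrow> nat \<Rightarrow> nat \<Rightarrow> real" where
  "pair_moment t j k = (\<integral>v. weight t (quad (v $ 1) (v $ 2)) * (lucas_const (v $ 1) (v $ 2) j * lucas (v $ 1) (v $ 2) k) \<partial>(lborel :: (real^2) measure))"

lemma continuous_lucas_nth: "continuous_on UNIV (\<lambda>v::real^2. lucas (v $ 1) (v $ 2) k)"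
    "continuous_on UNIV (\<lambda>v::real^2. lucas_const (v $ 1) (v $ 2) k)"
proof -
  show l: "continuous_on UNIV (\<lambda>v::real^2. lucas (v $ 1) (v $ 2) k)" for k
    by (intro continuous_on_lucas continuous_on_nth continuous_on_id)
  show "continuous_on UNIV (\<lambda>v::real^2. lucas_const (v $ 1) (v $ 2) k)"
    unfolding lucas_const_def
    by (cases "k = 0") (simp, simp only: if_False, intro continuous_intros l continuous_on_nth)
qed

lemma pair_moment_integrable:
  assumes "0 \<le> t" "t \<le> 1"
  shows "integrable (lborel :: (real^2) measure) (\<lambda>v. weight t (quad (v $ 1) (v $ 2)) * (lucas_const (v $ 1) (v $ 2) j * lucas (v $ 1) (v $ 2) k))"
  by (intro integrable_weight_quad continuous_on_mult continuous_lucas_nth assms)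

text \<open>The weight is even in \<open>u\<close>, and the rest of the integrand is odd.\<close>

lemma pair_moment_eq_0:
  assumes "even (j + k)" "0 \<le> t" "t \<le> 1"
  shows "pair_moment t j k = 0"
proof -
  let ?f = "\<lambda>u w. weight t (quad u w) * (lucas_const u w j * lucas u w k)"
  have e: "pair_moment t j k = (\<integral>w. \<integral>u. ?f u w \<partial>lborel \<partial>lborel)"
    unfolding pair_moment_def using integral_vec2_iterated[OF pair_moment_integrable[OF assms(2,3), of j k]] by simp
  have "?f (- u) w = - ?f u w" for u w
  proof -
    have "(- 1 :: real) ^ j * (- 1) ^ (k + 1) = - 1" using assms(1) by (simp flip: power_add)
    then have "lucas_const (- u) w j * lucas (- u) w k = - (lucas_const u w j * lucas u w k)"
      unfolding lucas_reflect lucas_const_reflect by (metis (no_types, lifting) mult.assoc mult.left_commute mult_minus1)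
    then show ?thesis by (simp add: weight_quad)
  qed
  then have "(\<integral>u. ?f u w \<partial>lborel) = - (\<integral>u. ?f u w \<partial>lborel)" for w
    using lborel_integral_real_affine[of "- 1" "\<lambda>u. ?f u w" 0] by simp
  then have "(\<integral>u. ?f u w \<partial>lborel) = 0" for w by (metis equal_neg_zero)
  then show ?thesis unfolding e by simp
qed

text \<open>The power sums \<open>x^k + y^k\<close> of the roots \<open>x\<close> and \<open>y\<close> of \<open>quad u w\<close>. As functions of \<open>u\<close> they are antiderivatives of Lucas
numbers, up to the factor \<open>- 1 / k\<close>.\<close>

fun psum :: "real \<Rightarrow> real \<Rightarrow> nat \<Rightarrow> real" where
  "psum u w 0 = 2"
| "psum u w (Suc 0) = - u"
| "psum u w (Suc (Suc k)) = - u * psum u w (Suc k) - w * psum u w k"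

lemma psum_roots: "psum (- (x + y)) (x * y) k = x ^ k + y ^ k"
  by (induction k rule: induct_nat_012) (simp_all add: algebra_simps)

lemma psum_lucas: "psum u w (Suc k) = lucas u w (Suc (Suc k)) - w * lucas u w k"
proof (induction k rule: induct_nat_012)
  case (ge2 k)
  have "psum u w (Suc (Suc (Suc k))) = - u * psum u w (Suc (Suc k)) - w * psum u w (Suc k)" by (rule psum.simps(3))
  also have "\<dots> = - u * (lucas u w (Suc (Suc (Suc k))) - w * lucas u w (Suc k)) - w * (lucas u w (Suc (Suc k)) - w * lucas u w k)"
    by (simp only: ge2)
  also have "\<dots> = lucas u w (Suc (Suc (Suc (Suc k)))) - w * lucas u w (Suc (Suc k))"
    by (simp add: algebra_simps)
  finally show ?case .
qed simp_all

lemma has_derivative_psum: "((\<lambda>u. psum u w k) has_real_derivative - real k * lucas u w k) (at u)"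
proof (induction k rule: induct_nat_012)
  case 1
  show ?case by (auto intro!: derivative_eq_intros)
next
  case (ge2 k)
  have "((\<lambda>u. - u * psum u w (Suc k) - w * psum u w k) has_real_derivative
      (- 1) * psum u w (Suc k) + (- real (Suc k) * lucas u w (Suc k)) * (- u) - (- real k * lucas u w k) * w) (at u)"
    by (rule derivative_eq_intros ge2 refl)+ simp
  moreover have "(- 1) * psum u w (Suc k) + (- real (Suc k) * lucas u w (Suc k)) * (- u) - (- real k * lucas u w k) * w
      = - real (Suc (Suc k)) * lucas u w (Suc (Suc k))"
    unfolding psum_lucas by (simp add: algebra_simps)
  ultimately show ?case by simp
qed simp

lemma integral_lucas:
  assumes "a \<le> b" "l > 0"
  shows "has_bochner_integral lborel (\<lambda>u. lucas u w l * indicator {a..b} u) ((psum a w l - psum b w l) / real l)"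
proof -
  have "has_bochner_integral lborel (\<lambda>u. lucas u w l * indicator {a..b} u) (- psum b w l / real l - - psum a w l / real l)"
  proof (rule has_bochner_integral_FTC_Icc_real[OF assms(1)])
    fix x
    show "((\<lambda>u. - psum u w l / real l) has_real_derivative lucas x w l) (at x)"
      using DERIV_cdivide[OF DERIV_minus[OF has_derivative_psum[of w l x]], of "real l"] assms(2) by simp
    have "continuous_on UNIV (\<lambda>u. lucas u w l)" by (intro continuous_on_lucas continuous_intros)
    then show "isCont (\<lambda>u. lucas u w l) x" by (simp add: continuous_on_eq_continuous_at)
  qed
  then show ?thesis by (simp add: diff_divide_distrib)
qed

text \<open>For fixed \<open>w\<close> the weight is \<open>1\<close> on \<open>|u| < 1 + w\<close>, except on \<open>|u| < 2 * sqrt w\<close> where it is \<open>t\<close>. At the ends of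
these intervals the roots are \<open>1, w\<close> and \<open>sqrt w\<close> twice, up to a common sign, so the power sums there are explicit.\<close>

lemma integral_weight_lucas_inner:
  assumes w: "- 1 < w" "w < 1" and l: "odd l"
  shows "(\<integral>u. weight t (quad u w) * lucas u w l \<partial>lborel) =
    2 / real l * (1 + w ^ l) + (if w > 0 then (t - 1) * (4 / real l * sqrt w ^ l) else 0)"
proof -
  have l0: "l > 0" using l by (rule odd_pos)
  let ?I = "\<lambda>u. lucas u w l * indicator {- (1 + w)..1 + w} u"
  let ?J = "\<lambda>u. (t - 1) * (lucas u w l * indicator {- 2 * sqrt w..2 * sqrt w} u)"
  have ps: "psum (- (1 + w)) w l = 1 + w ^ l" using psum_roots[of 1 w l] by simp
  have ps2: "psum (1 + w) w l = - (1 + w ^ l)" using psum_roots[of "- 1" "- w" l] l by (simp add: add.commute)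
  have I: "has_bochner_integral lborel ?I (2 / real l * (1 + w ^ l))"
    using integral_lucas[of "- (1 + w)" "1 + w" l w] w l0 unfolding ps ps2 by (simp add: algebra_simps)
  show ?thesis
  proof (cases "w > 0")
    case True
    have s: "sqrt w * sqrt w = w" "0 < sqrt w" "sqrt w < 1" using True w by auto
    have ps3: "psum (- 2 * sqrt w) w l = 2 * sqrt w ^ l" using psum_roots[of "sqrt w" "sqrt w" l] s by simp
    have ps4: "psum (2 * sqrt w) w l = - 2 * sqrt w ^ l" using psum_roots[of "- sqrt w" "- sqrt w" l] s l by simp
    have J: "has_bochner_integral lborel ?J ((t - 1) * (4 / real l * sqrt w ^ l))"
      using integral_lucas[of "- 2 * sqrt w" "2 * sqrt w" l w] s l0 unfolding ps3 ps4
      by (intro has_bochner_integral_mult_right) (simp add: algebra_simps)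
    have lt: "2 * sqrt w < 1 + w"
    proof -
      have "0 < (1 - sqrt w)\<^sup>2" using s by simp
      then show ?thesis using s(1) by (simp add: power2_eq_square algebra_simps)
    qed
    have sq: "u\<^sup>2 < 4 * w \<longleftrightarrow> \<bar>u\<bar> < 2 * sqrt w" "u\<^sup>2 = 4 * w \<longleftrightarrow> \<bar>u\<bar> = 2 * sqrt w" for u
    proof -
      have e: "4 * w = (2 * sqrt w)\<^sup>2" using True by (simp add: power_mult_distrib)
      show "u\<^sup>2 < 4 * w \<longleftrightarrow> \<bar>u\<bar> < 2 * sqrt w" unfolding e using s abs_square_less_1[of u]
        by (metis abs_ge_zero abs_of_pos mult_pos_pos power2_abs power2_less_imp_less power_strict_mono zero_less_numeral less_imp_le)
      show "u\<^sup>2 = 4 * w \<longleftrightarrow> \<bar>u\<bar> = 2 * sqrt w" unfolding e using s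
        by (metis abs_of_pos mult_pos_pos power2_abs power2_eq_iff_nonneg abs_ge_zero zero_less_numeral less_imp_le)
    qed
    have "(\<integral>u. weight t (quad u w) * lucas u w l \<partial>lborel) = (\<integral>u. ?I u + ?J u \<partial>lborel)"
    proof (rule integral_cong_AE)
      show "(\<lambda>u. weight t (quad u w) * lucas u w l) \<in> borel_measurable lborel"
        by (intro borel_measurable_times measurable_weight_quad measurable_lucas) auto
      show "(\<lambda>u. ?I u + ?J u) \<in> borel_measurable lborel"
        using I J by (intro borel_measurable_add) (auto dest!: has_bochner_integral_integrable borel_measurable_integrable simp: has_bochner_integral_iff)
      have "AE u in lborel. u \<noteq> 1 + w \<and> u \<noteq> - (1 + w) \<and> u \<noteq> 2 * sqrt w \<and> u \<noteq> - 2 * sqrt w"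
        by (intro AE_conjI AE_lborel_singleton)
      then show "AE u in lborel. weight t (quad u w) * lucas u w l = ?I u + ?J u"
      proof (rule AE_mp, intro AE_I2 impI)
        fix u assume u: "u \<noteq> 1 + w \<and> u \<noteq> - (1 + w) \<and> u \<noteq> 2 * sqrt w \<and> u \<noteq> - 2 * sqrt w"
        consider "\<bar>u\<bar> < 2 * sqrt w" | "2 * sqrt w < \<bar>u\<bar>" "\<bar>u\<bar> < 1 + w" | "1 + w < \<bar>u\<bar>" using u lt by linarith
        then show "weight t (quad u w) * lucas u w l = ?I u + ?J u"
        proof cases
          case 1
          then have "u \<in> {- 2 * sqrt w..2 * sqrt w}" "u \<in> {- (1 + w)..1 + w}" "\<bar>u\<bar> < 1 + w" "u\<^sup>2 < 4 * w" "u\<^sup>2 \<noteq> 4 * w"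
            using lt sq(1)[of u] by auto
          then show ?thesis using w by (simp add: weight_quad algebra_simps)
        next
          case 2
          then have "u \<notin> {- 2 * sqrt w..2 * sqrt w}" "u \<in> {- (1 + w)..1 + w}" by auto
          then show ?thesis using 2 lt w by (simp add: weight_quad sq)
        next
          case 3
          then have "u \<notin> {- 2 * sqrt w..2 * sqrt w}" "u \<notin> {- (1 + w)..1 + w}" using lt by auto
          then show ?thesis using 3 lt w by (simp add: weight_quad sq)
        qed
      qed
    qed
    also have "\<dots> = 2 / real l * (1 + w ^ l) + (t - 1) * (4 / real l * sqrt w ^ l)"
      by (rule has_bochner_integral_integral_eq[OF has_bochner_integral_add[OF I J]])
    finally show ?thesis using True by simp
  next
    case False
    have "(\<integral>u. weight t (quad u w) * lucas u w l \<partial>lborel) = (\<integral>u. ?I u \<partial>lborel)"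
    proof (rule integral_cong_AE)
      show "(\<lambda>u. weight t (quad u w) * lucas u w l) \<in> borel_measurable lborel"
        by (intro borel_measurable_times measurable_weight_quad measurable_lucas) auto
      show "?I \<in> borel_measurable lborel"
        using I by (auto simp: has_bochner_integral_iff)
      have "AE u in lborel. u \<noteq> 1 + w \<and> u \<noteq> - (1 + w) \<and> u \<noteq> 0"
        by (intro AE_conjI AE_lborel_singleton)
      then show "AE u in lborel. weight t (quad u w) * lucas u w l = ?I u"
      proof (rule AE_mp, intro AE_I2 impI)
        fix u assume u: "u \<noteq> 1 + w \<and> u \<noteq> - (1 + w) \<and> u \<noteq> 0"
        then have "4 * w < u\<^sup>2" using False by (smt (verit) zero_less_power2)
        note u4 = this
        consider "\<bar>u\<bar> < 1 + w" "u \<in> {- (1 + w)..1 + w}" | "1 + w < \<bar>u\<bar>" "u \<notin> {- (1 + w)..1 + w}" using u w by fastforce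
        then show "weight t (quad u w) * lucas u w l = ?I u"
        proof cases
          case 1
          then show ?thesis using u4 w unfolding weight_quad by simp
        next
          case 2
          then show ?thesis using u4 w unfolding weight_quad by simp
        qed
      qed
    qed
    also have "\<dots> = 2 / real l * (1 + w ^ l)" by (rule has_bochner_integral_integral_eq[OF I])
    finally show ?thesis using False by simp
  qed
qed

lemma has_bochner_integral_power:
  "has_bochner_integral lborel (\<lambda>w. w ^ k * indicator {- 1..1} w) (if even k then 2 / (real k + 1) else 0)"
proof -
  have "has_bochner_integral lborel (\<lambda>w::real. w ^ k * indicator {- 1..1} w) (1 ^ Suc k / real (Suc k) - (- 1) ^ Suc k / real (Suc k))"
  proof (rule has_bochner_integral_FTC_Icc_real)
    show "((\<lambda>x. x ^ Suc k / real (Suc k)) has_real_derivative x ^ k) (at x)" for x :: real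
      using DERIV_cdivide[OF DERIV_pow[of "Suc k" x], of "real (Suc k)"] by (simp del: of_nat_Suc)
  qed auto
  moreover have "1 ^ Suc k / real (Suc k) - (- 1) ^ Suc k / real (Suc k) = (if even k then 2 / (real k + 1) else 0)"
    by (auto simp: add.commute add_divide_distrib[symmetric])
  ultimately show ?thesis by simp
qed

lemma has_bochner_integral_sqrt:
  assumes "odd l"
  shows "has_bochner_integral lborel (\<lambda>w. w ^ i * sqrt w ^ l * indicator {0..1} w) (2 / real (2 * i + l + 2))"
proof -
  let ?F = "\<lambda>w. 2 / real (2 * i + l + 2) * (w ^ Suc i * sqrt w ^ l)"
  have c: "continuous_on {0..1} (\<lambda>w::real. w ^ i * sqrt w ^ l)" by (intro continuous_intros)
  have "((\<lambda>w. w ^ i * sqrt w ^ l) has_integral (?F 1 - ?F 0)) {0..1}"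
  proof (rule fundamental_theorem_of_calculus_interior)
    show "continuous_on {0..1} ?F" by (intro continuous_intros)
    fix w :: real assume w: "w \<in> {0<..<1}"
    obtain m where m: "l = Suc m" using assms by (cases l) auto
    define s where "s = sqrt w"
    have s: "s > 0" "w = s * s" using w by (auto simp: s_def)
    have "(?F has_real_derivative 2 / real (2 * i + l + 2) * (real (Suc i) * w ^ i * sqrt w ^ l + w ^ Suc i * (real l * sqrt w ^ m * (inverse (sqrt w) / 2)))) (at w)"
    proof -
      have w0: "0 < w" using w by simp
      have p: "((\<lambda>w. w ^ Suc i) has_real_derivative real (Suc i) * w ^ i) (at w)"
        using DERIV_pow[of "Suc i" w] by simp
      have q: "((\<lambda>w. sqrt w ^ l) has_real_derivative real l * (inverse (sqrt w) / 2 * sqrt w ^ m)) (at w)"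
        using DERIV_power[OF DERIV_real_sqrt[OF w0], of l] by (simp add: m)
      show ?thesis
        by (rule DERIV_cong[OF DERIV_cmult[OF DERIV_mult[OF p q], of "2 / real (2 * i + l + 2)"]]) (simp add: mult_ac)
    qed
    moreover have "2 / real (2 * i + l + 2) * (real (Suc i) * w ^ i * sqrt w ^ l + w ^ Suc i * (real l * sqrt w ^ m * (inverse (sqrt w) / 2)))
        = w ^ i * sqrt w ^ l"
    proof -
      have "w ^ Suc i * (real l * sqrt w ^ m * (inverse (sqrt w) / 2)) = w ^ i * (s * s * (real l * s ^ m * (inverse s / 2)))"
        by (simp add: s_def[symmetric] s(2)[symmetric])
      also have "\<dots> = w ^ i * sqrt w ^ l * (real l / 2)" using s(1) by (simp add: m s_def[symmetric] field_simps)
      finally show ?thesis by (simp add: field_simps)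
    qed
    ultimately show "(?F has_vector_derivative w ^ i * sqrt w ^ l) (at w)"
      by (simp add: has_real_derivative_iff_has_vector_derivative)
  qed simp
  then have "integral {0..1} (\<lambda>w. w ^ i * sqrt w ^ l) = ?F 1 - ?F 0" by (rule integral_unique)
  moreover have si: "set_integrable lborel {0..1} (\<lambda>w. w ^ i * sqrt w ^ l)" by (rule borel_integrable_atLeastAtMost'[OF c])
  ultimately have "(LINT w:{0..1}|lborel. w ^ i * sqrt w ^ l) = ?F 1 - ?F 0"
    using set_borel_integral_eq_integral(2)[OF si] by simp
  then show ?thesis using si
    by (simp add: has_bochner_integral_iff set_integrable_def set_lebesgue_integral_def mult.commute)
qed

lemma moment_lucas:
  assumes t: "0 \<le> t" "t \<le> 1" and l: "odd l"
  shows "(\<integral>v. weight t (quad (v $ 1) (v $ 2)) * (v $ 2 ^ i * lucas (v $ 1) (v $ 2) l) \<partial>(lborel :: (real^2) measure)) =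
    4 / (real l * (if even i then real i + 1 else real (i + l) + 1)) + (t - 1) * (8 / (real l * real (2 * i + l + 2)))"
proof -
  have l0: "l > 0" using l by (rule odd_pos)
  have "integrable (lborel :: (real^2) measure) (\<lambda>v. weight t (quad (v $ 1) (v $ 2)) * (v $ 2 ^ i * lucas (v $ 1) (v $ 2) l))"
    by (intro integrable_weight_quad continuous_on_mult continuous_lucas_nth continuous_on_power continuous_on_nth continuous_on_id t)
  from integral_vec2_iterated[OF this]
  have "(\<integral>v. weight t (quad (v $ 1) (v $ 2)) * (v $ 2 ^ i * lucas (v $ 1) (v $ 2) l) \<partial>(lborel :: (real^2) measure)) =
      (\<integral>w. \<integral>u. weight t (quad u w) * (w ^ i * lucas u w l) \<partial>lborel \<partial>lborel)" by simp
  also have "\<dots> = (\<integral>w. w ^ i * (\<integral>u. weight t (quad u w) * lucas u w l \<partial>lborel) \<partial>lborel)"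
    by (intro Bochner_Integration.integral_cong refl) (simp add: mult.left_commute flip: integral_mult_right_zero)
  also have "\<dots> = (\<integral>w. 2 / real l * (w ^ i * indicator {- 1..1} w + w ^ (i + l) * indicator {- 1..1} w) +
       (t - 1) * (4 / real l) * (w ^ i * sqrt w ^ l * indicator {0..1} w) \<partial>lborel)" (is "_ = (\<integral>w. ?R w \<partial>lborel)")
  proof (rule integral_cong_AE)
    have "(\<lambda>w. \<integral>u. weight t (quad u w) * lucas u w l \<partial>lborel) \<in> borel_measurable lborel"
    proof (rule lborel.borel_measurable_lebesgue_integral)
      have "(\<lambda>p. weight t (quad (snd p) (fst p)) * lucas (snd p) (fst p) l) \<in> borel_measurable (lborel \<Otimes>\<^sub>M lborel)"
        by (intro borel_measurable_times measurable_weight_quad measurable_lucas) auto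
      then show "(\<lambda>(w, u). weight t (quad u w) * lucas u w l) \<in> borel_measurable (lborel \<Otimes>\<^sub>M lborel)"
        by (simp add: case_prod_beta')
    qed
    then show "(\<lambda>w. w ^ i * (\<integral>u. weight t (quad u w) * lucas u w l \<partial>lborel)) \<in> borel_measurable lborel" by simp
    show "?R \<in> borel_measurable lborel" by simp
    have "AE w in lborel. w \<noteq> 1 \<and> w \<noteq> (- 1 :: real)" by (intro AE_conjI AE_lborel_singleton)
    then show "AE w in lborel. w ^ i * (\<integral>u. weight t (quad u w) * lucas u w l \<partial>lborel) = ?R w"
    proof (rule AE_mp, intro AE_I2 impI)
      fix w :: real assume w: "w \<noteq> 1 \<and> w \<noteq> - 1"
      show "w ^ i * (\<integral>u. weight t (quad u w) * lucas u w l \<partial>lborel) = ?R w"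
      proof (cases "- 1 < w \<and> w < 1")
        case True
        have "w \<in> {- 1..1}" using True by auto
        moreover have "sqrt w ^ l * indicator {0..1} w = (if w > 0 then sqrt w ^ l else 0)"
          using True l0 by (auto split: split_indicator)
        moreover have "w ^ i * sqrt w ^ l * indicator {0..1} w = w ^ i * (sqrt w ^ l * indicator {0..1} w)" by simp
        ultimately show ?thesis
          using integral_weight_lucas_inner[of w l t] True l
          by (simp add: algebra_simps power_add add_divide_distrib del: real_sqrt_power)
      next
        case False
        then have "w < - 1 \<or> w > 1" using w by linarith
        then have "weight t (quad u w) = 0" for u by (auto simp: weight_quad)
        moreover have "w \<notin> {- 1..1}" "w \<notin> {0..1}" using \<open>w < - 1 \<or> w > 1\<close> by auto
        ultimately show ?thesis by simp
      qed
    qed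
  qed
  also have "\<dots> = 2 / real l * ((if even i then 2 / (real i + 1) else 0) + (if even (i + l) then 2 / (real (i + l) + 1) else 0)) +
      (t - 1) * (4 / real l) * (2 / real (2 * i + l + 2))"
    by (intro has_bochner_integral_integral_eq has_bochner_integral_add has_bochner_integral_mult_right
        has_bochner_integral_power has_bochner_integral_sqrt l)
  also have "\<dots> = 4 / (real l * (if even i then real i + 1 else real (i + l) + 1)) + (t - 1) * (8 / (real l * real (2 * i + l + 2)))"
    using l by (auto simp: algebra_simps)
  finally show ?thesis .
qed

lemma moment_value_algebra:
  fixes y p s t :: real
  assumes "y \<noteq> 0" "p \<noteq> 0" "s \<noteq> 0" "s = 2 * p + y"
  shows "4 / (y * p) + (t - 1) * (8 / (y * s)) = 4 / p * ((1 - t) / s + t / y)"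
  using assms(1-3) by (simp add: divide_simps) (simp add: assms(4) algebra_simps)

text \<open>By \<open>lucas_casorati\<close> the difference is an integral of \<open>w^j * lucas u w (k - j)\<close> or, if \<open>k < j\<close>, of its negative with \<open>j\<close> and \<open>k\<close>
exchanged. Both cases lead to the same formula.\<close>

theorem pair_moment_value:
  assumes t: "0 \<le> t" "t \<le> 1" and jk: "even j" "odd k"
  shows "pair_moment t j k - pair_moment t k j =
    4 / (real j + 1) * ((1 - t) / (real k + real j + 2) + t / (real k - real j))"
proof -
  have sub: "pair_moment t a b - pair_moment t b a = (\<integral>v. weight t (quad (v $ 1) (v $ 2)) *
      (lucas_const (v $ 1) (v $ 2) a * lucas (v $ 1) (v $ 2) b - lucas_const (v $ 1) (v $ 2) b * lucas (v $ 1) (v $ 2) a) \<partial>(lborel :: (real^2) measure))" for a b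
    unfolding pair_moment_def
    by (subst Bochner_Integration.integral_diff[symmetric]) (simp_all add: pair_moment_integrable[OF t] right_diff_distrib)
  have val: "pair_moment t a (a + l) - pair_moment t (a + l) a =
      4 / (real l * (if even a then real a + 1 else real (a + l) + 1)) + (t - 1) * (8 / (real l * real (2 * a + l + 2)))"
    if "odd l" for a l
    unfolding sub lucas_casorati by (rule moment_lucas[OF t that])
  show ?thesis
  proof (cases "j < k")
    case True
    then obtain l where l: "k = j + l" "l > 0" by (metis less_imp_add_positive)
    then have "odd l" using jk by simp
    have "pair_moment t j k - pair_moment t k j = 4 / (real l * (real j + 1)) + (t - 1) * (8 / (real l * real (2 * j + l + 2)))"
      unfolding l(1) val[OF \<open>odd l\<close>] using jk(1) by simp
    also have "\<dots> = 4 / (real j + 1) * ((1 - t) / real (2 * j + l + 2) + t / real l)"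
      by (rule moment_value_algebra) (use l(2) in auto)
    finally show ?thesis by (simp add: l(1) algebra_simps)
  next
    case False
    then have "k < j" using jk by (metis nat_neq_iff)
    then obtain l where l: "j = k + l" "l > 0" by (metis less_imp_add_positive)
    then have "odd l" using jk by simp
    have "pair_moment t j k - pair_moment t k j = - (pair_moment t k (k + l) - pair_moment t (k + l) k)" by (simp add: l)
    also have "\<dots> = - (4 / (real l * (real (k + l) + 1)) + (t - 1) * (8 / (real l * real (2 * k + l + 2))))"
      unfolding val[OF \<open>odd l\<close>] using jk(2) by simp
    also have "\<dots> = 4 / (real j + 1) * ((1 - t) / (real k + real j + 2) + t / (real k - real j))"
    proof -
      have "4 / (- real l * real (k + l + 1)) + (t - 1) * (8 / (- real l * real (2 * k + l + 2))) =
          4 / real (k + l + 1) * ((1 - t) / real (2 * k + l + 2) + t / (- real l))"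
        by (rule moment_value_algebra) (use l(2) in auto)
      moreover have "real (k + l) + 1 = real (k + l + 1)" "real k + real (k + l) + 2 = real (2 * k + l + 2)"
        "real k - real (k + l) = - real l" by simp_all
      ultimately show ?thesis unfolding l(1)
        by (simp only: mult_minus_left minus_divide_right[symmetric] mult_minus_right minus_add_distrib)
    qed
    finally show ?thesis .
  qed
qed

section \<open>Recursion for integrals of minors\<close>

lemma test_fun_minor: "test_fun d (\<lambda>h. minor h js)"
proof -
  have eq: "minor h js = (\<Sum>p | p permutes {0..<length js}. signof p * (\<Prod>i = 0..<length js. coeff (monom 1 (p i) * h) (js ! i)))" for h
    unfolding minor_def det_mat_eq by simp
  have c: "(\<lambda>a. coeff (monom 1 l * monic_poly d a) k) \<in> borel_measurable (lborel_dim d)" for l k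
    unfolding coeff_monom_mult by (cases "k < l") (simp_all add: measurable_coeff_monic_poly)
  have m: "(\<lambda>a. minor (monic_poly d a) js) \<in> borel_measurable (lborel_dim d)"
    unfolding eq by (intro borel_measurable_sum borel_measurable_times borel_measurable_const borel_measurable_prod c)
  have "\<bar>minor p js\<bar> \<le> (\<Sum>q | q permutes {0..<length js}. 1 * (\<Prod>i = 0..<length js. 2 ^ d))"
    if "degree p = d" "lead_coeff p = 1" "schur_stable p" for p
  proof -
    have b: "\<bar>coeff (monom 1 l * p) k\<bar> \<le> 2 ^ d" for l k
      unfolding coeff_monom_mult using coeff_stable_bound[OF that(3,2), of "k - l"] that(1) by auto
    have "\<bar>minor p js\<bar> \<le> (\<Sum>q | q permutes {0..<length js}. \<bar>signof q * (\<Prod>i = 0..<length js. coeff (monom 1 (q i) * p) (js ! i))\<bar>)"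
      unfolding eq by (rule sum_abs)
    also have "\<dots> \<le> (\<Sum>q | q permutes {0..<length js}. 1 * (\<Prod>i = 0..<length js. 2 ^ d))"
    proof (rule sum_mono)
      fix q
      show "\<bar>signof q * (\<Prod>i = 0..<length js. coeff (monom 1 (q i) * p) (js ! i))\<bar> \<le> 1 * (\<Prod>i = 0..<length js. 2 ^ d)"
        unfolding abs_mult abs_prod
        by (intro mult_mono prod_mono conjI abs_ge_zero b prod_nonneg) (auto simp: sign_def)
    qed
    finally show ?thesis .
  qed
  then show ?thesis using m unfolding test_fun_def by blast
qed

definition wminor :: "real \<Rightarrow> nat \<Rightarrow> nat list \<Rightarrow> real" where
  "wminor t e js = weighted_integral t e (\<lambda>h. minor h js)"

lemma wminor_integrable:
  "0 \<le> t \<Longrightarrow> t \<le> 1 \<Longrightarrow> integrable (lborel_dim e) (\<lambda>a. weight t (monic_poly e a) * minor (monic_poly e a) js)"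
  by (rule integrable_weight_test_fun[OF test_fun_minor])

lemma wminor_swap: "wminor t e (j # k # js) = - wminor t e (k # j # js)"
  unfolding wminor_def weighted_integral_def by (subst minor_swap) simp

lemma wminor_recursion_full:
  assumes N: "e + 2 + length js = N" and t: "0 \<le> t" "t \<le> 1"
  shows "real ((e + 2) div 2) * wminor t (e + 2) js = (\<Sum>j<N. \<Sum>k<N. pair_moment t j k * wminor t e (j # k # js))"
proof -
  let ?\<alpha> = "\<lambda>v::real^2. lucas_const (v $ 1) (v $ 2)" and ?\<beta> = "\<lambda>v::real^2. lucas (v $ 1) (v $ 2)"
  have inner: "(\<integral>h. weight t (monic_poly e h) * (res (v $ 1) (v $ 2) (monic_poly e h) * minor (quad (v $ 1) (v $ 2) * monic_poly e h) js) \<partial>lborel_dim e)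
      = (\<Sum>j<N. \<Sum>k<N. ?\<alpha> v j * ?\<beta> v k * wminor t e (j # k # js))" for v :: "real^2"
  proof -
    have "weight t (monic_poly e h) * (res (v $ 1) (v $ 2) (monic_poly e h) * minor (quad (v $ 1) (v $ 2) * monic_poly e h) js)
      = (\<Sum>j<N. \<Sum>k<N. ?\<alpha> v j * ?\<beta> v k * (weight t (monic_poly e h) * minor (monic_poly e h) (j # k # js)))" for h
      by (subst minor_quad[where N = N]) (use N in \<open>simp_all add: sum_distrib_left mult_ac\<close>)
    then show ?thesis unfolding wminor_def weighted_integral_def
      by (simp only:) (intro has_bochner_integral_integral_eq has_bochner_integral_sum has_bochner_integral_mult_right
          has_bochner_integral_integrable wminor_integrable t)
  qed
  have "real ((e + 2) div 2) * wminor t (e + 2) js =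
    (\<integral>v. weight t (quad (v $ 1) (v $ 2)) * (\<Sum>j<N. \<Sum>k<N. ?\<alpha> v j * ?\<beta> v k * wminor t e (j # k # js)) \<partial>(lborel :: (real^2) measure))"
    unfolding wminor_def[of t "e + 2"] pair_removal[OF test_fun_minor t] inner ..
  also have "\<dots> = (\<integral>v. (\<Sum>j<N. \<Sum>k<N. (weight t (quad (v $ 1) (v $ 2)) * (?\<alpha> v j * ?\<beta> v k)) * wminor t e (j # k # js)) \<partial>(lborel :: (real^2) measure))"
    by (simp add: sum_distrib_left mult_ac)
  also have "\<dots> = (\<Sum>j<N. \<Sum>k<N. pair_moment t j k * wminor t e (j # k # js))"
    unfolding pair_moment_def
    by (intro has_bochner_integral_integral_eq has_bochner_integral_sum has_bochner_integral_mult_left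
        has_bochner_integral_integrable pair_moment_integrable t)
  finally show ?thesis .
qed

lemma sum_split_parity:
  fixes f :: "nat \<Rightarrow> real"
  shows "(\<Sum>j<N. f j) = (\<Sum>a<N - N div 2. f (2 * a)) + (\<Sum>b<N div 2. f (2 * b + 1))"
proof (induction N)
  case (Suc N)
  then show ?case
  proof (cases "even N")
    case True
    then obtain k where "N = 2 * k" by (elim evenE)
    then show ?thesis using Suc.IH by (simp add: Suc_diff_le)
  next
    case False
    then obtain k where "N = 2 * k + 1" by (elim oddE)
    then show ?thesis using Suc.IH by (simp add: One_nat_def)
  qed
qed simp

definition skew_moment :: "real \<Rightarrow> nat \<Rightarrow> nat \<Rightarrow> real" where
  "skew_moment t a b = pair_moment t (2 * a) (2 * b + 1) - pair_moment t (2 * b + 1) (2 * a)"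

text \<open>Moments with even index sum vanish, so one of the two new rows is even and the other one odd; putting the even row first
antisymmetrises the moments.\<close>

lemma wminor_recursion:
  assumes N: "e + 2 + length js = N" and t: "0 \<le> t" "t \<le> 1"
  shows "real ((e + 2) div 2) * wminor t (e + 2) js =
    (\<Sum>(a, b)\<in>{..<N - N div 2} \<times> {..<N div 2}. skew_moment t a b * wminor t e (2 * a # (2 * b + 1) # js))"
proof -
  let ?E = "{..<N - N div 2}" and ?O = "{..<N div 2}"
  let ?f = "\<lambda>j k. pair_moment t j k * wminor t e (j # k # js)"
  have z: "?f j k = 0" if "even (j + k)" for j k using pair_moment_eq_0[OF that t] by simp
  have "(\<Sum>j<N. \<Sum>k<N. ?f j k) = (\<Sum>a\<in>?E. \<Sum>b\<in>?O. ?f (2 * a) (2 * b + 1)) + (\<Sum>b\<in>?O. \<Sum>a\<in>?E. ?f (2 * b + 1) (2 * a))"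
    unfolding sum_split_parity[of _ N] by (simp add: z)
  also have "(\<Sum>b\<in>?O. \<Sum>a\<in>?E. ?f (2 * b + 1) (2 * a)) = (\<Sum>a\<in>?E. \<Sum>b\<in>?O. ?f (2 * b + 1) (2 * a))"
    by (rule sum.swap)
  also have "(\<Sum>a\<in>?E. \<Sum>b\<in>?O. ?f (2 * a) (2 * b + 1)) + \<dots> =
      (\<Sum>a\<in>?E. \<Sum>b\<in>?O. skew_moment t a b * wminor t e (2 * a # (2 * b + 1) # js))"
    unfolding sum.distrib[symmetric] skew_moment_def
    by (intro sum.cong refl) (subst (2) wminor_swap, simp add: algebra_simps)
  also have "\<dots> = (\<Sum>(a, b)\<in>?E \<times> ?O. skew_moment t a b * wminor t e (2 * a # (2 * b + 1) # js))"
    by (rule sum.cartesian_product)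
  finally show ?thesis unfolding wminor_recursion_full[OF N t] .
qed

text \<open>The list of rows that is collected from a list of pairs: \<open>(a, b)\<close> stands for the rows \<open>2 * a\<close> and \<open>2 * b + 1\<close>.\<close>

fun flat :: "(nat \<times> nat) list \<Rightarrow> nat list" where
  "flat [] = []"
| "flat ((a, b) # Q) = 2 * a # (2 * b + 1) # flat Q"

lemma length_flat [simp]: "length (flat Q) = 2 * length Q"
  by (induction Q rule: flat.induct) auto

lemma nth_flat: "i < length Q \<Longrightarrow> flat Q ! (2 * i) = 2 * fst (Q ! i)" "i < length Q \<Longrightarrow> flat Q ! (2 * i + 1) = 2 * snd (Q ! i) + 1"
proof (induction Q arbitrary: i rule: flat.induct)
  case (2 a b Q)
  { case 1 then show ?case using "2.IH"(1) by (cases i) auto }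
  { case 2 then show ?case using "2.IH"(2) by (cases i) (auto simp: One_nat_def) }
qed auto

text \<open>Removing a pair from degree \<open>2 * r + \<delta>\<close> has the factor \<open>r\<close>, hence the factorial. What is left has degree \<open>\<delta>\<close>, which
is \<open>0\<close> or \<open>1\<close>. The number \<open>N\<close> of available rows is the same at every step.\<close>

lemma wminor_unwind:
  assumes t: "0 \<le> t" "t \<le> 1" and \<delta>: "\<delta> < 2" and N: "2 * r + \<delta> + 2 * length P = N"
  shows "fact r * wminor t (2 * r + \<delta>) (flat P) =
    (\<Sum>Q | set Q \<subseteq> {..<N - N div 2} \<times> {..<N div 2} \<and> length Q = r.
       (\<Prod>i<r. skew_moment t (fst (Q ! i)) (snd (Q ! i))) * wminor t \<delta> (flat (Q @ P)))"
  using N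
proof (induction r arbitrary: P)
  case 0
  have "{Q. set Q \<subseteq> {..<N - N div 2} \<times> {..<N div 2} \<and> length Q = 0} = {[]}" by auto
  then show ?case by simp
next
  case (Suc r)
  let ?A = "{..<N - N div 2} \<times> {..<N div 2}"
  let ?L = "\<lambda>r. {Q. set Q \<subseteq> ?A \<and> length Q = r}"
  let ?m = "\<lambda>q. skew_moment t (fst q) (snd q)"
  have e: "2 * Suc r + \<delta> = (2 * r + \<delta>) + 2" "((2 * r + \<delta>) + 2) div 2 = Suc r" using \<delta> by auto
  have "fact (Suc r) * wminor t (2 * Suc r + \<delta>) (flat P) =
      fact r * (real (((2 * r + \<delta>) + 2) div 2) * wminor t ((2 * r + \<delta>) + 2) (flat P))"
    unfolding e by (simp add: algebra_simps)
  also have "\<dots> = fact r * (\<Sum>(a, b)\<in>?A. skew_moment t a b * wminor t (2 * r + \<delta>) (2 * a # (2 * b + 1) # flat P))"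
    by (subst wminor_recursion[where N = N]) (use Suc.prems t in auto)
  also have "\<dots> = (\<Sum>q\<in>?A. ?m q * (fact r * wminor t (2 * r + \<delta>) (flat (q # P))))"
    unfolding sum_distrib_left by (intro sum.cong refl) (auto simp: mult_ac)
  also have "\<dots> = (\<Sum>q\<in>?A. \<Sum>Q\<in>?L r. ?m q * ((\<Prod>i<r. ?m (Q ! i)) * wminor t \<delta> (flat (Q @ q # P))))"
    by (subst Suc.IH) (use Suc.prems in \<open>auto simp: sum_distrib_left\<close>)
  also have "\<dots> = (\<Sum>(q, Q)\<in>?A \<times> ?L r. ?m q * ((\<Prod>i<r. ?m (Q ! i)) * wminor t \<delta> (flat (Q @ q # P))))"
    by (rule sum.cartesian_product)
  also have "\<dots> = (\<Sum>Q\<in>?L (Suc r). (\<Prod>i<Suc r. ?m (Q ! i)) * wminor t \<delta> (flat (Q @ P)))"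
  proof (rule sum.reindex_bij_witness[where i = "\<lambda>Q. (last Q, butlast Q)" and j = "\<lambda>(q, Q). Q @ [q]"])
    fix Q assume Q: "Q \<in> ?L (Suc r)"
    then have ne: "Q \<noteq> []" by auto
    show "(case (last Q, butlast Q) of (q, Q) \<Rightarrow> Q @ [q]) = Q" using ne by simp
    have "set (butlast Q) \<subseteq> set Q" by (auto dest: in_set_butlastD)
    then show "(last Q, butlast Q) \<in> ?A \<times> ?L r" using Q last_in_set[OF ne] by auto
  next
    fix qQ assume "qQ \<in> ?A \<times> ?L r"
    then obtain q Q where q: "qQ = (q, Q)" "q \<in> ?A" "Q \<in> ?L r" by auto
    have "(\<Prod>i<Suc r. ?m ((Q @ [q]) ! i)) = (\<Prod>i<r. ?m (Q ! i)) * ?m q"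
      using q(3) by (simp add: nth_append)
    then show "(\<Prod>i<Suc r. ?m ((case qQ of (q, Q) \<Rightarrow> Q @ [q]) ! i)) * wminor t \<delta> (flat ((case qQ of (q, Q) \<Rightarrow> Q @ [q]) @ P)) =
       (case qQ of (q, Q) \<Rightarrow> ?m q * ((\<Prod>i<r. ?m (Q ! i)) * wminor t \<delta> (flat (Q @ q # P))))"
      unfolding q(1) prod.case by simp
  qed auto
  finally show ?case .
qed

lemma wminor_0: "wminor t 0 js = minor 1 js"
proof -
  have w: "weight t 1 = 1"
    by (simp add: weight_def schur_stable_def upper_roots_def rsquarefree_roots)
  have "wminor t 0 js = (\<integral>a. minor 1 js \<partial>lborel_dim 0)"
    unfolding wminor_def weighted_integral_def by (simp add: monic_poly_def w)
  also have "\<dots> = minor 1 js" by (simp add: PiM_empty One_nat_def)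
  finally show ?thesis .
qed

lemma weight_linear: "weight t [:x, 1:] = (if \<bar>x\<bar> < 1 then 1 else 0)"
proof -
  have p: "poly (cpoly [:x, 1:]) z = 0 \<longleftrightarrow> z = - of_real x" for z
    by (simp add: map_poly_pCons eq_neg_iff_add_eq_0 add.commute)
  have "schur_stable [:x, 1:] \<longleftrightarrow> \<bar>x\<bar> < 1" unfolding schur_stable_def p by simp
  moreover have "rsquarefree (cpoly [:x, 1:])"
    unfolding rsquarefree_roots pderiv_cpoly by (simp add: pderiv_pCons map_poly_pCons)
  moreover have "upper_roots [:x, 1:] = {}" unfolding upper_roots_def p by auto
  ultimately show ?thesis by (simp add: weight_def)
qed

text \<open>For degree one the polynomial is \<open>X + x\<close> with \<open>-1 < x < 1\<close>, and expanding its minor gives the moments of the uniform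
weight, which vanish for odd exponents.\<close>

lemma wminor_1:
  assumes N: "length js + 1 = N"
  shows "wminor t 1 js = (\<Sum>a<N - N div 2. 2 / (2 * real a + 1) * minor 1 (2 * a # js))"
proof -
  have mp: "monic_poly 1 a = [:a 1, 1:]" for a by (simp add: monic_poly_def monom_altdef)
  have mm: "minor [:x, 1:] js = (\<Sum>j<N. (- x) ^ j * minor 1 (j # js))" for x
    using minor_linear[of 1 js N "- x"] N by simp
  let ?f = "\<lambda>x. weight t [:x, 1:] * minor [:x, 1:] js"
  have fm: "?f \<in> borel_measurable lborel" unfolding mm weight_linear by measurable
  have "wminor t 1 js = (\<integral>a. ?f (a 1) \<partial>Pi\<^sub>M {1::nat} (\<lambda>_. lborel))"
    unfolding wminor_def weighted_integral_def mp by simp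
  also have "\<dots> = (\<integral>x. ?f x \<partial>lborel)" by (rule lborel_product.product_integral_singleton[OF fm])
  also have "\<dots> = (\<integral>x. (\<Sum>j<N. (- 1) ^ j * minor 1 (j # js) * (x ^ j * indicator {- 1..1} x)) \<partial>lborel)"
  proof (rule integral_cong_AE[OF fm])
    show "(\<lambda>x. \<Sum>j<N. (- 1) ^ j * minor 1 (j # js) * (x ^ j * indicator {- 1..1} x)) \<in> borel_measurable lborel"
      by measurable
    have "AE x in lborel. x \<noteq> 1 \<and> x \<noteq> (- 1 :: real)" by (intro AE_conjI AE_lborel_singleton)
    then show "AE x in lborel. ?f x = (\<Sum>j<N. (- 1) ^ j * minor 1 (j # js) * (x ^ j * indicator {- 1..1} x))"
    proof (rule AE_mp, intro AE_I2 impI)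
      fix x :: real assume x: "x \<noteq> 1 \<and> x \<noteq> - 1"
      have "(if \<bar>x\<bar> < 1 then 1 else 0) = (indicator {- 1..1} x :: real)" using x by (auto split: split_indicator)
      then show "?f x = (\<Sum>j<N. (- 1) ^ j * minor 1 (j # js) * (x ^ j * indicator {- 1..1} x))"
        unfolding mm weight_linear by (simp add: sum_distrib_left power_minus[of x] mult_ac)
    qed
  qed
  also have "\<dots> = (\<Sum>j<N. (- 1) ^ j * minor 1 (j # js) * (if even j then 2 / (real j + 1) else 0))"
    by (intro has_bochner_integral_integral_eq has_bochner_integral_sum has_bochner_integral_mult_right has_bochner_integral_power)
  also have "\<dots> = (\<Sum>a<N - N div 2. 2 / (2 * real a + 1) * minor 1 (2 * a # js))"
    unfolding sum_split_parity[of _ N] by (simp add: mult.commute)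
  finally show ?thesis .
qed

section \<open>The determinant of the moments\<close>

lemma det_permute_rows_cols:
  assumes r: "\<rho> permutes {0..<N}" and p: "\<pi> permutes {0..<N}"
  shows "jdet (mat N N (\<lambda>(i, l). f (\<rho> i) (\<pi> l))) = signof \<rho> * signof \<pi> * jdet (mat N N (\<lambda>(i, l). f i l))"
proof -
  define A where "A = mat N N (\<lambda>(i, l). f i l)"
  define C where "C = mat N N (\<lambda>(i, l). f i (\<pi> l))"
  have r': "\<rho> i < N" if "i < N" for i using permutes_in_image[OF r, of i] that by simp
  have p': "\<pi> i < N" if "i < N" for i using permutes_in_image[OF p, of i] that by simp
  have "mat N N (\<lambda>(i, l). f (\<rho> i) (\<pi> l)) = mat N N (\<lambda>(i, l). C $$ (\<rho> i, l))"
    by (intro cong_mat) (auto simp: C_def r')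
  then have "jdet (mat N N (\<lambda>(i, l). f (\<rho> i) (\<pi> l))) = signof \<rho> * jdet C"
    using det_permute_rows[OF _ r, of C] by (simp add: C_def)
  also have "jdet C = jdet (transpose_mat C)" by (rule det_transpose[of _ N, symmetric]) (simp add: C_def)
  also have "transpose_mat C = mat N N (\<lambda>(i, l). transpose_mat A $$ (\<pi> i, l))"
    by (rule eq_matI) (auto simp: C_def A_def p')
  also have "jdet \<dots> = signof \<pi> * jdet (transpose_mat A)" by (rule det_permute_rows[OF _ p]) (simp add: A_def)
  also have "jdet (transpose_mat A) = jdet A" by (rule det_transpose[of _ N]) (simp add: A_def)
  finally show ?thesis by (simp add: A_def mult.assoc)
qed

abbreviation selection_det :: "nat \<Rightarrow> (nat \<Rightarrow> nat) \<Rightarrow> real" where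
  "selection_det n f \<equiv> jdet (mat n n (\<lambda>(i, l). of_bool (f i = l)))"

text \<open>The Leibniz formula, written as a sum over all functions: \<open>selection_det n f\<close> is the sign of \<open>f\<close> if \<open>f\<close> is a
permutation and \<open>0\<close> otherwise.\<close>

lemma sum_selection_det:
  fixes x :: "nat \<Rightarrow> nat \<Rightarrow> real"
  shows "(\<Sum>f\<in>PiE {0..<E} (\<lambda>_. {0..<E}). (\<Prod>i = 0..<E. x i (f i)) * selection_det E f) = jdet (mat E E (\<lambda>(i, l). x i l))"
proof -
  have "(\<Sum>f\<in>PiE {0..<E} (\<lambda>_. {0..<E}). (\<Prod>i = 0..<E. x i (f i)) * selection_det E f) =
      (\<Sum>f\<in>PiE {0..<E} (\<lambda>_. {0..<E}). \<Sum>p | p permutes {0..<E}. signof p * (\<Prod>i = 0..<E. x i (f i) * of_bool (f i = p i)))"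
    unfolding det_mat_eq prod.case sum_distrib_left by (simp add: prod.distrib mult_ac)
  also have "\<dots> = (\<Sum>p | p permutes {0..<E}. signof p * (\<Sum>f\<in>PiE {0..<E} (\<lambda>_. {0..<E}). \<Prod>i = 0..<E. x i (f i) * of_bool (f i = p i)))"
    by (subst sum.swap) (simp only: sum_distrib_left)
  also have "\<dots> = (\<Sum>p | p permutes {0..<E}. signof p * (\<Prod>i = 0..<E. x i (p i)))"
  proof (intro sum.cong refl arg_cong2[where f = "(*)"])
    fix p assume "p \<in> {p. p permutes {0..<E}}"
    then have p: "p i < E" if "i < E" for i using permutes_in_image[of p "{0..<E}" i] that by simp
    have "(\<Sum>f\<in>PiE {0..<E} (\<lambda>_. {0..<E}). \<Prod>i = 0..<E. x i (f i) * of_bool (f i = p i)) =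
        (\<Prod>i = 0..<E. \<Sum>j = 0..<E. x i j * of_bool (j = p i))"
      by (rule prod_sum_PiE[symmetric]) auto
    also have "\<dots> = (\<Prod>i = 0..<E. x i (p i))"
      by (rule prod.cong) (auto simp: p of_bool_def mult_delta_right)
    finally show "(\<Sum>f\<in>PiE {0..<E} (\<lambda>_. {0..<E}). \<Prod>i = 0..<E. x i (f i) * of_bool (f i = p i)) = (\<Prod>i = 0..<E. x i (p i))" .
  qed
  finally show ?thesis unfolding det_mat_eq by simp
qed

lemma minor_1: "minor 1 js = jdet (mat (length js) (length js) (\<lambda>(i, l). of_bool (js ! i = l)))"
  unfolding minor_def by (intro arg_cong[where f = jdet] cong_mat) auto

text \<open>The rows that are collected if all pairs have been removed: the pairs \<open>(a i, b i)\<close>, preceded by the even row of the linear factor if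
\<open>N\<close> is odd.\<close>

definition row_list :: "nat \<Rightarrow> (nat \<Rightarrow> nat) \<Rightarrow> (nat \<Rightarrow> nat) \<Rightarrow> nat list" where
  "row_list N a b = (if even N then [] else [2 * a (N div 2)]) @ flat (map (\<lambda>i. (a i, b i)) [0..<N div 2])"

lemma permutes_if_inj:
  assumes "finite S" "inj_on f S" "f ` S \<subseteq> S" "\<And>x. x \<notin> S \<Longrightarrow> f x = x"
  shows "f permutes S"
  by (rule bij_imp_permutes) (use assms endo_inj_surj[of S f] in \<open>auto simp: bij_betw_def\<close>)

text \<open>The minor for the polynomial \<open>1\<close> is the sign of the selected rows as a permutation. The even and the odd rows are permuted
separately: fixed permutations \<open>\<rho>\<close> and \<open>\<pi>\<close> of rows and columns bring the matrix into block diagonal form.\<close>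

lemma minor_row_list:
  "\<exists>\<sigma>::real. \<sigma> \<noteq> 0 \<and> (\<forall>a b. (\<forall>i<N - N div 2. a i < N - N div 2) \<longrightarrow> (\<forall>i<N div 2. b i < N div 2) \<longrightarrow>
     minor 1 (row_list N a b) = \<sigma> * (selection_det (N - N div 2) a * selection_det (N div 2) b))"
proof -
  define n where "n = N div 2"
  define E where "E = N - n"
  have NE: "N = E + n" and En: "E = n \<or> E = n + 1" and ev: "even N \<longleftrightarrow> E = n" unfolding E_def n_def by presburger+
  define \<pi> where "\<pi> l = (if l < N then if l < E then 2 * l else 2 * (l - E) + 1 else l)" for l
  define \<rho> where "\<rho> l = (if l < N then if E = n then (if l < E then 2 * l else 2 * (l - E) + 1)
     else (if l < n then 2 * l + 1 else if l = n then 0 else 2 * (l - E) + 2) else l)" for l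
  have p: "\<pi> permutes {0..<N}"
  proof (rule permutes_if_inj)
    show "inj_on \<pi> {0..<N}" by (rule inj_onI) (auto simp: \<pi>_def split: if_splits; presburger)
    show "\<pi> ` {0..<N} \<subseteq> {0..<N}" using En NE by (auto simp: \<pi>_def)
  qed (auto simp: \<pi>_def)
  have r: "\<rho> permutes {0..<N}"
  proof (rule permutes_if_inj)
    show "inj_on \<rho> {0..<N}" using En NE by (intro inj_onI) (auto simp: \<rho>_def split: if_splits; presburger)
    show "\<rho> ` {0..<N} \<subseteq> {0..<N}" using En NE by (auto simp: \<rho>_def)
  qed (auto simp: \<rho>_def)
  define \<sigma> :: real where "\<sigma> = signof \<rho> * signof \<pi>"
  have \<sigma>2: "\<sigma> * \<sigma> = 1" "\<sigma> \<noteq> 0" by (auto simp: \<sigma>_def sign_def)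
  have "minor 1 (row_list N a b) = \<sigma> * (selection_det E a * selection_det n b)"
    if a: "\<forall>i<E. a i < E" and b: "\<forall>i<n. b i < n" for a b
  proof -
    let ?js = "row_list N a b"
    have len: "length ?js = N" using En NE ev unfolding row_list_def n_def[symmetric] by auto
    have js_e: "?js ! \<rho> i = 2 * a i" if "i < E" for i
      using that En NE ev nth_flat(1)[of i "map (\<lambda>i. (a i, b i)) [0..<n]"]
      unfolding row_list_def n_def[symmetric] \<rho>_def by (auto simp: nth_append nth_Cons')
    have js_o: "?js ! \<rho> (i + E) = 2 * b i + 1" if "i < n" for i
      using that En NE ev nth_flat(2)[of i "map (\<lambda>i. (a i, b i)) [0..<n]"]
      unfolding row_list_def n_def[symmetric] \<rho>_def by (auto simp: nth_append nth_Cons' One_nat_def)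
    have js_o': "?js ! \<rho> i = 2 * b (i - E) + 1" if "\<not> i < E" "i < N" for i
      using js_o[of "i - E"] that NE by simp
    have pe: "\<pi> l = 2 * l" if "l < E" for l using that NE by (simp add: \<pi>_def)
    have po: "\<pi> l = 2 * (l - E) + 1" if "\<not> l < E" "l < N" for l using that NE by (simp add: \<pi>_def)
    have par: "2 * x \<noteq> 2 * y + (1::nat)" "2 * y + 1 \<noteq> 2 * (x::nat)" for x y by presburger+
    have "mat N N (\<lambda>(i, l). of_bool (?js ! \<rho> i = \<pi> l) :: real) = four_block_mat (mat E E (\<lambda>(i, l). of_bool (a i = l)))
        (0\<^sub>m E n) (0\<^sub>m n E) (mat n n (\<lambda>(i, l). of_bool (b i = l)))"
    proof (rule eq_matI)
      fix i l assume "i < dim_row (four_block_mat (mat E E (\<lambda>(i, l). of_bool (a i = l) :: real))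
        (0\<^sub>m E n) (0\<^sub>m n E) (mat n n (\<lambda>(i, l). of_bool (b i = l))))" "l < dim_col (four_block_mat (mat E E (\<lambda>(i, l). of_bool (a i = l) :: real))
        (0\<^sub>m E n) (0\<^sub>m n E) (mat n n (\<lambda>(i, l). of_bool (b i = l))))"
      then have il: "i < E + n" "l < E + n" by auto
      then show "mat N N (\<lambda>(i, l). of_bool (?js ! \<rho> i = \<pi> l) :: real) $$ (i, l) = four_block_mat (mat E E (\<lambda>(i, l). of_bool (a i = l)))
        (0\<^sub>m E n) (0\<^sub>m n E) (mat n n (\<lambda>(i, l). of_bool (b i = l))) $$ (i, l)"
        using il NE[symmetric] by (cases "i < E"; cases "l < E") (simp_all add: js_e js_o' pe po par)
    qed (use NE in auto)
    then have "jdet (mat N N (\<lambda>(i, l). of_bool (?js ! \<rho> i = \<pi> l) :: real)) = selection_det E a * selection_det n b"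
      by (simp only:) (rule det_four_block_mat_upper_right_zero, auto)
    moreover have "jdet (mat N N (\<lambda>(i, l). of_bool (?js ! \<rho> i = \<pi> l) :: real)) = \<sigma> * minor 1 ?js"
      unfolding minor_1 len \<sigma>_def by (rule det_permute_rows_cols[OF r p])
    ultimately have "\<sigma> * (\<sigma> * minor 1 ?js) = \<sigma> * (selection_det E a * selection_det n b)" by simp
    then show ?thesis unfolding mult.assoc[symmetric] \<sigma>2 by (simp add: mult.assoc)
  qed
  then show ?thesis using \<sigma>2(2) unfolding E_def n_def by blast
qed

text \<open>For odd \<open>d\<close> there is one more even row than there are pairs; the last row of this matrix holds the integrals of \<open>wminor_1\<close>.\<close>

definition moment_mat :: "nat \<Rightarrow> real \<Rightarrow> real mat" where
  "moment_mat d t = mat (d - d div 2) (d - d div 2) (\<lambda>(i, l). if i < d div 2 then skew_moment t l i else 2 / (2 * real l + 1))"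

text \<open>Selecting rows is multiplication by a matrix of zeros and ones.\<close>

lemma det_select_rows:
  fixes x :: "nat \<Rightarrow> nat \<Rightarrow> real"
  assumes nE: "n \<le> E" and b: "\<And>i. i < n \<Longrightarrow> b i < n"
  shows "jdet (mat E E (\<lambda>(i, l). if i < n then x (b i) l else x i l)) = selection_det n b * jdet (mat E E (\<lambda>(i, l). x i l))"
proof -
  define P where "P = mat E E (\<lambda>(i, l). if i < n then of_bool (b i = l) else of_bool (i = l) :: real)"
  obtain k where E: "E = n + k" using nE by (metis le_iff_add)
  have "P = four_block_mat (mat n n (\<lambda>(i, l). of_bool (b i = l))) (0\<^sub>m n k) (0\<^sub>m k n) (1\<^sub>m k)"
  proof (rule eq_matI)
    fix i l assume "i < dim_row (four_block_mat (mat n n (\<lambda>(i, l). of_bool (b i = l) :: real)) (0\<^sub>m n k) (0\<^sub>m k n) (1\<^sub>m k))"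
      "l < dim_col (four_block_mat (mat n n (\<lambda>(i, l). of_bool (b i = l) :: real)) (0\<^sub>m n k) (0\<^sub>m k n) (1\<^sub>m k))"
    then have "i < n + k" "l < n + k" by auto
    then show "P $$ (i, l) = four_block_mat (mat n n (\<lambda>(i, l). of_bool (b i = l))) (0\<^sub>m n k) (0\<^sub>m k n) (1\<^sub>m k) $$ (i, l)"
      using b[of i] by (auto simp: P_def E)
  qed (auto simp: P_def E)
  then have "jdet P = selection_det n b * jdet (1\<^sub>m k)"
    by (simp only:) (rule det_four_block_mat_upper_right_zero, auto)
  moreover have "mat E E (\<lambda>(i, l). if i < n then x (b i) l else x i l) = P * mat E E (\<lambda>(i, l). x i l)"
  proof (rule eq_matI)
    fix i l assume "i < dim_row (P * mat E E (\<lambda>(i, l). x i l))" "l < dim_col (P * mat E E (\<lambda>(i, l). x i l))"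
    then have il: "i < E" "l < E" by (auto simp: P_def)
    define r where "r = (if i < n then b i else i)"
    have r: "r < E" using b[of i] il nE by (auto simp: r_def)
    have "(P * mat E E (\<lambda>(i, l). x i l)) $$ (i, l) = (\<Sum>j = 0..<E. of_bool (r = j) * x j l)"
      using il by (simp add: P_def scalar_prod_def r_def)
    also have "\<dots> = x r l" using r by (simp add: of_bool_def mult_delta_left)
    finally show "mat E E (\<lambda>(i, l). if i < n then x (b i) l else x i l) $$ (i, l) = (P * mat E E (\<lambda>(i, l). x i l)) $$ (i, l)"
      using il by (simp add: r_def)
  qed (auto simp: P_def)
  moreover have "jdet (P * mat E E (\<lambda>(i, l). x i l)) = jdet P * jdet (mat E E (\<lambda>(i, l). x i l))"
    by (rule det_mult[of _ E]) (auto simp: P_def)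
  ultimately show ?thesis by simp
qed

text \<open>After all pairs are removed, the integral is a sum over functions \<open>a\<close> (even rows) and \<open>b\<close> (odd rows) of products
of moments times signs. For fixed \<open>b\<close> the sum over \<open>a\<close> is the determinant of the matrix of moments with rows permuted
by \<open>b\<close>, so that the sign of \<open>b\<close> appears twice and the sum over \<open>b\<close> counts permutations.\<close>

theorem weighted_integral_eq_det:
  assumes "d \<ge> 1"
  shows "\<exists>C. C \<noteq> 0 \<and> (\<forall>t. 0 \<le> t \<longrightarrow> t \<le> 1 \<longrightarrow> weighted_integral t d (\<lambda>_. 1) = C * jdet (moment_mat d t))"
proof -
  define n where "n = d div 2"
  define E where "E = d - n"
  have dE: "d = E + n" and En: "E = n \<or> E = n + 1" and ev: "even d \<longleftrightarrow> E = n" unfolding E_def n_def by presburger+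
  have nE: "n \<le> E" using En by auto
  obtain \<sigma> :: real where \<sigma>: "\<sigma> \<noteq> 0" "\<And>a b. (\<And>i. i < E \<Longrightarrow> a i < E) \<Longrightarrow> (\<And>i. i < n \<Longrightarrow> b i < n) \<Longrightarrow>
     minor 1 (row_list d a b) = \<sigma> * (selection_det E a * selection_det n b)"
    using minor_row_list[of d] unfolding n_def[symmetric] E_def[symmetric] by blast
  let ?FA = "PiE {0..<E} (\<lambda>_. {0..<E})" and ?FB = "PiE {0..<n} (\<lambda>_. {0..<n})"
  \<comment> \<open>The number of permutations of \<open>{0..<n}\<close>, which is positive because of the identity.\<close>
  define S where "S = (\<Sum>b\<in>?FB. (selection_det n b)\<^sup>2)"
  have "selection_det n (\<lambda>i\<in>{0..<n}. i) = 1"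
  proof -
    have "mat n n (\<lambda>(i, l). of_bool ((\<lambda>i\<in>{0..<n}. i) i = l)) = (1\<^sub>m n :: real mat)" by (rule eq_matI) auto
    then show ?thesis by simp
  qed
  moreover have "(\<lambda>i\<in>{0..<n}. i) \<in> ?FB" by auto
  moreover have "finite ?FB" by (intro finite_PiE) auto
  ultimately have "0 < S" unfolding S_def
    by (intro sum_pos2[of _ "\<lambda>i\<in>{0..<n}. i"]) auto
  show ?thesis
  proof (intro exI[of _ "\<sigma> * S / fact n"] conjI allI impI)
    show "\<sigma> * S / fact n \<noteq> 0" using \<sigma>(1) \<open>0 < S\<close> by simp
    fix t :: real assume t: "0 \<le> t" "t \<le> 1"
    define x where "x i l = (if i < n then skew_moment t l i else 2 / (2 * real l + 1))" for i l
    let ?A = "{..<E} \<times> {..<n}"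
    let ?L = "{Q. set Q \<subseteq> ?A \<and> length Q = n}"
    let ?m = "\<lambda>q. skew_moment t (fst q) (snd q)"
    let ?T = "\<lambda>a b. (\<Prod>i = 0..<E. if i < n then x (b i) (a i) else x i (a i)) * minor 1 (row_list d a b)"
    have split: "(\<Prod>i = 0..<E. if i < n then x (b i) (a i) else x i (a i)) =
        (\<Prod>i<n. skew_moment t (a i) (b i)) * (if E = n then 1 else 2 / (2 * real (a n) + 1))"
      if "\<And>i. i < n \<Longrightarrow> b i < n" for a b
    proof -
      have p: "(\<Prod>i<n. if i < n then x (b i) (a i) else x i (a i)) = (\<Prod>i<n. skew_moment t (a i) (b i))"
        by (rule prod.cong) (use that in \<open>auto simp: x_def\<close>)
      show ?thesis
      proof (cases "E = n")
        case True then show ?thesis using p by (simp add: lessThan_atLeast0)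
      next
        case False
        then have "E = Suc n" using En by auto
        then show ?thesis using p by (simp add: lessThan_atLeast0 x_def)
      qed
    qed
    have "fact n * weighted_integral t d (\<lambda>_. 1) = (\<Sum>(a, b)\<in>?FA \<times> ?FB. ?T a b)"
    proof (cases "even d")
      case True
      then have e: "E = n" "d = 2 * n + 0" "even d" using ev dE by auto
      have "fact n * weighted_integral t d (\<lambda>_. 1) = fact n * wminor t (2 * n + 0) (flat [])"
        unfolding wminor_def e(2)[symmetric] by (simp add: minor_def)
      also have "\<dots> = (\<Sum>Q\<in>?L. (\<Prod>i<n. ?m (Q ! i)) * wminor t 0 (flat (Q @ [])))"
        using wminor_unwind[OF t, of 0 n "[]" d] e unfolding n_def[symmetric] E_def[symmetric] by simp
      also have "\<dots> = (\<Sum>(a, b)\<in>?FA \<times> ?FB. ?T a b)"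
      proof (rule sum.reindex_bij_witness[where i = "\<lambda>(a, b). map (\<lambda>i. (a i, b i)) [0..<n]"
            and j = "\<lambda>Q. (\<lambda>i\<in>{0..<n}. fst (Q ! i), \<lambda>i\<in>{0..<n}. snd (Q ! i))"])
        fix Q assume Q: "Q \<in> ?L"
        then have mem: "Q ! i \<in> ?A" if "i < n" for i using that nth_mem[of i Q] by auto
        show eq: "(case (\<lambda>i\<in>{0..<n}. fst (Q ! i), \<lambda>i\<in>{0..<n}. snd (Q ! i)) of (a, b) \<Rightarrow> map (\<lambda>i. (a i, b i)) [0..<n]) = Q"
          using Q by (auto intro!: nth_equalityI)
        show "(\<lambda>i\<in>{0..<n}. fst (Q ! i), \<lambda>i\<in>{0..<n}. snd (Q ! i)) \<in> ?FA \<times> ?FB"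
          using mem e(1) by (auto simp: mem_Times_iff)
        have "(\<Prod>i = 0..<E. if i < n then x ((\<lambda>i\<in>{0..<n}. snd (Q ! i)) i) ((\<lambda>i\<in>{0..<n}. fst (Q ! i)) i) else x i ((\<lambda>i\<in>{0..<n}. fst (Q ! i)) i))
            = (\<Prod>i<n. ?m (Q ! i))"
          by (subst split) (use mem e(1) in \<open>auto simp: mem_Times_iff\<close>)
        moreover have "row_list d (\<lambda>i\<in>{0..<n}. fst (Q ! i)) (\<lambda>i\<in>{0..<n}. snd (Q ! i)) = flat (Q @ [])"
          using eq e(3) by (simp add: row_list_def n_def[symmetric])
        ultimately show "(case (\<lambda>i\<in>{0..<n}. fst (Q ! i), \<lambda>i\<in>{0..<n}. snd (Q ! i)) of (a, b) \<Rightarrow> ?T a b) =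
           (\<Prod>i<n. ?m (Q ! i)) * wminor t 0 (flat (Q @ []))"
          by (simp add: wminor_0)
      next
        fix ab assume "ab \<in> ?FA \<times> ?FB"
        then obtain a b where ab: "ab = (a, b)" "a \<in> ?FA" "b \<in> ?FB" by auto
        show "(\<lambda>i\<in>{0..<n}. fst ((case ab of (a, b) \<Rightarrow> map (\<lambda>i. (a i, b i)) [0..<n]) ! i),
            \<lambda>i\<in>{0..<n}. snd ((case ab of (a, b) \<Rightarrow> map (\<lambda>i. (a i, b i)) [0..<n]) ! i)) = ab"
          using ab e(1) by (auto simp: fun_eq_iff PiE_def extensional_def)
        show "(case ab of (a, b) \<Rightarrow> map (\<lambda>i. (a i, b i)) [0..<n]) \<in> ?L"
          using ab e(1) by (auto simp: PiE_def Pi_def)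
      qed
      finally show ?thesis .
    next
      case False
      then have e: "E = n + 1" "d = 2 * n + 1" "odd d" using ev dE En by auto
      have "fact n * weighted_integral t d (\<lambda>_. 1) = fact n * wminor t (2 * n + 1) (flat [])"
        unfolding wminor_def e(2)[symmetric] by (simp add: minor_def)
      also have "\<dots> = (\<Sum>Q\<in>?L. (\<Prod>i<n. ?m (Q ! i)) * wminor t 1 (flat (Q @ [])))"
        using wminor_unwind[OF t, of 1 n "[]" d] e unfolding n_def[symmetric] E_def[symmetric] by simp
      also have "\<dots> = (\<Sum>Q\<in>?L. \<Sum>c<E. (\<Prod>i<n. ?m (Q ! i)) * (2 / (2 * real c + 1) * minor 1 (2 * c # flat Q)))"
      proof (intro sum.cong refl)
        fix Q assume "Q \<in> ?L"
        then have "length (flat Q) + 1 = d" using e(2) by simp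
        then show "(\<Prod>i<n. ?m (Q ! i)) * wminor t 1 (flat (Q @ [])) =
            (\<Sum>c<E. (\<Prod>i<n. ?m (Q ! i)) * (2 / (2 * real c + 1) * minor 1 (2 * c # flat Q)))"
          using wminor_1[of "flat Q" d t] unfolding n_def[symmetric] E_def[symmetric] by (simp add: sum_distrib_left)
      qed
      also have "\<dots> = (\<Sum>(Q, c)\<in>?L \<times> {..<E}. (\<Prod>i<n. ?m (Q ! i)) * (2 / (2 * real c + 1) * minor 1 (2 * c # flat Q)))"
        by (rule sum.cartesian_product)
      also have "\<dots> = (\<Sum>(a, b)\<in>?FA \<times> ?FB. ?T a b)"
      proof (rule sum.reindex_bij_witness[where i = "\<lambda>(a, b). (map (\<lambda>i. (a i, b i)) [0..<n], a n)"
            and j = "\<lambda>(Q, c). (\<lambda>i\<in>{0..<E}. if i < n then fst (Q ! i) else c, \<lambda>i\<in>{0..<n}. snd (Q ! i))"])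
        fix Qc assume "Qc \<in> ?L \<times> {..<E}"
        then obtain Q c where Qc: "Qc = (Q, c)" and Q: "Q \<in> ?L" and c: "c < E" by auto
        have mem: "Q ! i \<in> ?A" if "i < n" for i using that Q nth_mem[of i Q] by auto
        let ?a = "\<lambda>i\<in>{0..<E}. if i < n then fst (Q ! i) else c" and ?b = "\<lambda>i\<in>{0..<n}. snd (Q ! i)"
        have eq: "map (\<lambda>i. (?a i, ?b i)) [0..<n] = Q"
          using Q e(1) by (auto intro!: nth_equalityI)
        have an: "?a n = c" using e(1) by simp
        show "(case case Qc of (Q, c) \<Rightarrow> (\<lambda>i\<in>{0..<E}. if i < n then fst (Q ! i) else c, \<lambda>i\<in>{0..<n}. snd (Q ! i)) of
            (a, b) \<Rightarrow> (map (\<lambda>i. (a i, b i)) [0..<n], a n)) = Qc"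
          unfolding Qc prod.case using eq an by simp
        show "(case Qc of (Q, c) \<Rightarrow> (\<lambda>i\<in>{0..<E}. if i < n then fst (Q ! i) else c, \<lambda>i\<in>{0..<n}. snd (Q ! i))) \<in> ?FA \<times> ?FB"
          unfolding Qc prod.case using mem c by (auto simp: mem_Times_iff)
        have "(\<Prod>i = 0..<E. if i < n then x (?b i) (?a i) else x i (?a i))
            = (\<Prod>i<n. skew_moment t (?a i) (?b i)) * (2 / (2 * real c + 1))"
          by (subst split) (use mem e(1) an in \<open>auto simp: mem_Times_iff\<close>)
        also have "(\<Prod>i<n. skew_moment t (?a i) (?b i)) = (\<Prod>i<n. ?m (Q ! i))"
          by (rule prod.cong) (use e(1) in auto)
        finally have 1: "(\<Prod>i = 0..<E. if i < n then x (?b i) (?a i) else x i (?a i)) = (\<Prod>i<n. ?m (Q ! i)) * (2 / (2 * real c + 1))" .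
        have 2: "row_list d ?a ?b = 2 * c # flat Q"
          unfolding row_list_def n_def[symmetric] eq an using e(3) by simp
        show "(case case Qc of (Q, c) \<Rightarrow> (\<lambda>i\<in>{0..<E}. if i < n then fst (Q ! i) else c, \<lambda>i\<in>{0..<n}. snd (Q ! i)) of (a, b) \<Rightarrow> ?T a b) =
           (case Qc of (Q, c) \<Rightarrow> (\<Prod>i<n. ?m (Q ! i)) * (2 / (2 * real c + 1) * minor 1 (2 * c # flat Q)))"
          unfolding Qc prod.case 1 2 by (simp only: mult.assoc)
      next
        fix ab assume "ab \<in> ?FA \<times> ?FB"
        then obtain a b where ab: "ab = (a, b)" "a \<in> ?FA" "b \<in> ?FB" by auto
        have "(\<lambda>i\<in>{0..<E}. if i < n then fst (map (\<lambda>i. (a i, b i)) [0..<n] ! i) else a n) = a"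
        proof
          fix i
          consider "i < n" | "i = n" | "i \<notin> {0..<E}" using e(1) by fastforce
          then show "(\<lambda>i\<in>{0..<E}. if i < n then fst (map (\<lambda>i. (a i, b i)) [0..<n] ! i) else a n) i = a i"
          proof cases
            case 3 then show ?thesis using PiE_arb[OF ab(2)] by simp
          qed (use e(1) in simp_all)
        qed
        moreover have "(\<lambda>i\<in>{0..<n}. snd (map (\<lambda>i. (a i, b i)) [0..<n] ! i)) = b"
          using ab(3) by (auto simp: fun_eq_iff PiE_def extensional_def)
        ultimately show "(case case ab of (a, b) \<Rightarrow> (map (\<lambda>i. (a i, b i)) [0..<n], a n) of (Q, c) \<Rightarrow>
            (\<lambda>i\<in>{0..<E}. if i < n then fst (Q ! i) else c, \<lambda>i\<in>{0..<n}. snd (Q ! i))) = ab"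
          unfolding ab(1) prod.case by simp
        show "(case ab of (a, b) \<Rightarrow> (map (\<lambda>i. (a i, b i)) [0..<n], a n)) \<in> ?L \<times> {..<E}"
          using ab e(1) by (auto simp: PiE_def Pi_def)
      qed
      finally show ?thesis .
    qed
    also have "\<dots> = (\<Sum>(a, b)\<in>?FA \<times> ?FB. (\<Prod>i = 0..<E. if i < n then x (b i) (a i) else x i (a i)) * (\<sigma> * (selection_det E a * selection_det n b)))"
    proof (intro sum.cong refl)
      fix ab assume "ab \<in> ?FA \<times> ?FB"
      then obtain a b where ab: "ab = (a, b)" "a \<in> ?FA" "b \<in> ?FB" by auto
      have "minor 1 (row_list d a b) = \<sigma> * (selection_det E a * selection_det n b)"
        by (rule \<sigma>(2)) (use ab in \<open>auto simp: PiE_def Pi_def\<close>)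
      then show "(case ab of (a, b) \<Rightarrow> ?T a b) = (case ab of (a, b) \<Rightarrow> (\<Prod>i = 0..<E. if i < n then x (b i) (a i) else x i (a i)) * (\<sigma> * (selection_det E a * selection_det n b)))"
        unfolding ab(1) prod.case by simp
    qed
    also have "\<dots> = (\<Sum>a\<in>?FA. \<Sum>b\<in>?FB. (\<Prod>i = 0..<E. if i < n then x (b i) (a i) else x i (a i)) * (\<sigma> * (selection_det E a * selection_det n b)))"
      by (rule sum.cartesian_product[symmetric])
    also have "\<dots> = (\<Sum>b\<in>?FB. \<sigma> * selection_det n b * (\<Sum>a\<in>?FA. (\<Prod>i = 0..<E. if i < n then x (b i) (a i) else x i (a i)) * selection_det E a))"
      by (subst sum.swap) (simp add: sum_distrib_left mult_ac)
    also have "\<dots> = (\<Sum>b\<in>?FB. \<sigma> * selection_det n b * (selection_det n b * jdet (mat E E (\<lambda>(i, l). x i l))))"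
    proof (intro sum.cong refl arg_cong2[where f = "(*)"])
      fix b assume b: "b \<in> ?FB"
      have "(\<Sum>a\<in>?FA. (\<Prod>i = 0..<E. if i < n then x (b i) (a i) else x i (a i)) * selection_det E a) =
          jdet (mat E E (\<lambda>(i, l). if i < n then x (b i) l else x i l))"
        by (rule sum_selection_det)
      also have "\<dots> = selection_det n b * jdet (mat E E (\<lambda>(i, l). x i l))"
        by (rule det_select_rows[OF nE]) (use b in \<open>auto simp: PiE_def Pi_def\<close>)
      finally show "(\<Sum>a\<in>?FA. (\<Prod>i = 0..<E. if i < n then x (b i) (a i) else x i (a i)) * selection_det E a) = selection_det n b * jdet (mat E E (\<lambda>(i, l). x i l))" .
    qed
    also have "\<dots> = \<sigma> * S * jdet (mat E E (\<lambda>(i, l). x i l))"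
      unfolding S_def by (simp add: sum_distrib_left sum_distrib_right power2_eq_square mult_ac)
    also have "mat E E (\<lambda>(i, l). x i l) = moment_mat d t"
      unfolding moment_mat_def x_def n_def[symmetric] E_def[symmetric] ..
    finally show "weighted_integral t d (\<lambda>_. 1) = \<sigma> * S / fact n * jdet (moment_mat d t)"
      by (simp add: field_simps)
  qed
qed

section \<open>Cauchy determinants and principal minors\<close>

lemma det_scale:
  "jdet (mat n n (\<lambda>(i, l). a i * b l * f i l)) = (\<Prod>i = 0..<n. a i) * (\<Prod>i = 0..<n. b i) * jdet (mat n n (\<lambda>(i, l). f i l :: real))"
proof -
  have "(\<Prod>i = 0..<n. a i * b (p i) * f i (p i)) = (\<Prod>i = 0..<n. a i) * (\<Prod>i = 0..<n. b i) * (\<Prod>i = 0..<n. f i (p i))"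
    if "p permutes {0..<n}" for p
    by (simp add: prod.distrib prod.permute[OF that, of b] comp_def)
  then show ?thesis
    unfolding det_mat_eq by (simp add: sum_distrib_left mult_ac)
qed

text \<open>The Schur complement with respect to the last diagonal entry.\<close>

lemma det_pivot:
  fixes f :: "nat \<Rightarrow> nat \<Rightarrow> real"
  assumes "f m m \<noteq> 0"
  shows "jdet (mat (Suc m) (Suc m) (\<lambda>(i, l). f i l)) =
    f m m * jdet (mat m m (\<lambda>(i, l). f i l - f i m * f m l / f m m))"
proof -
  define U where "U = four_block_mat (1\<^sub>m m) (mat m 1 (\<lambda>(i, l). f i m / f m m)) (0\<^sub>m 1 m) (1\<^sub>m 1 :: real mat)"
  define V where "V = four_block_mat (mat m m (\<lambda>(i, l). f i l - f i m * f m l / f m m)) (0\<^sub>m m 1)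
    (mat 1 m (\<lambda>(i, l). f m l)) (mat 1 1 (\<lambda>_. f m m))"
  have U: "U \<in> carrier_mat (Suc m) (Suc m)" and V: "V \<in> carrier_mat (Suc m) (Suc m)"
    unfolding Suc_eq_plus1 U_def V_def by (intro four_block_carrier_mat; simp)+
  have "mat (Suc m) (Suc m) (\<lambda>(i, l). f i l) = U * V"
  proof (rule eq_matI)
    fix i l assume "i < dim_row (U * V)" "l < dim_col (U * V)"
    then have il: "i < Suc m" "l < Suc m" using U V by auto
    have "(U * V) $$ (i, l) = (\<Sum>j = 0..<Suc m. U $$ (i, j) * V $$ (j, l))"
      using il U V by (auto simp: scalar_prod_def)
    also have "\<dots> = (\<Sum>j = 0..<m. U $$ (i, j) * V $$ (j, l)) + U $$ (i, m) * V $$ (m, l)" by simp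
    also have "(\<Sum>j = 0..<m. U $$ (i, j) * V $$ (j, l)) = (\<Sum>j = 0..<m. if j = i then V $$ (j, l) else 0)"
      using il by (intro sum.cong refl) (auto simp: U_def)
    also have "\<dots> = (if i < m then V $$ (i, l) else 0)" by simp
    also have "\<dots> + U $$ (i, m) * V $$ (m, l) = f i l"
      using il assms by (auto simp: U_def V_def less_Suc_eq)
    finally show "mat (Suc m) (Suc m) (\<lambda>(i, l). f i l) $$ (i, l) = (U * V) $$ (i, l)" using il by simp
  qed (use U V in auto)
  moreover have "jdet (U * V) = jdet U * jdet V" by (rule det_mult[OF U V])
  moreover have "jdet U = jdet (1\<^sub>m m) * jdet (1\<^sub>m 1 :: real mat)"
    unfolding U_def by (rule det_four_block_mat_lower_left_zero) auto
  moreover have "jdet V = jdet (mat m m (\<lambda>(i, l). f i l - f i m * f m l / f m m)) * jdet (mat 1 1 (\<lambda>_. f m m))"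
    unfolding V_def by (rule det_four_block_mat_upper_right_zero) auto
  moreover have "jdet (mat 1 1 (\<lambda>_. f m m)) = f m m" by (subst det_single) auto
  ultimately show ?thesis by simp
qed

text \<open>The Schur complement of a Cauchy matrix is again a Cauchy matrix with scaled rows and columns.\<close>

lemma det_cauchy:
  fixes x y :: "nat \<Rightarrow> real"
  assumes "\<And>i l. i < m \<Longrightarrow> l < m \<Longrightarrow> x i + y l \<noteq> 0"
  shows "jdet (mat m m (\<lambda>(i, l). 1 / (x i + y l))) =
    (\<Prod>i = 0..<m. 1 / (x i + y i)) * (\<Prod>j = 0..<m. \<Prod>i = 0..<j. (x i - x j) * (y i - y j) / ((x i + y j) * (x j + y i)))"
  using assms
proof (induction m)
  case (Suc m)
  have "jdet (mat (Suc m) (Suc m) (\<lambda>(i, l). 1 / (x i + y l))) =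
    1 / (x m + y m) * jdet (mat m m (\<lambda>(i, l). 1 / (x i + y l) - 1 / (x i + y m) * (1 / (x m + y l)) / (1 / (x m + y m))))"
    by (rule det_pivot) (use Suc.prems in auto)
  also have "mat m m (\<lambda>(i, l). 1 / (x i + y l) - 1 / (x i + y m) * (1 / (x m + y l)) / (1 / (x m + y m))) =
    mat m m (\<lambda>(i, l). ((x i - x m) / (x i + y m)) * ((y l - y m) / (x m + y l)) * (1 / (x i + y l)))"
  proof (rule cong_mat[OF refl refl], unfold prod.case)
    fix i l assume il: "i < m" "l < m"
    then have "x i + y l \<noteq> 0" "x i + y m \<noteq> 0" "x m + y l \<noteq> 0" "x m + y m \<noteq> 0" using Suc.prems by auto
    then show "1 / (x i + y l) - 1 / (x i + y m) * (1 / (x m + y l)) / (1 / (x m + y m)) =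
      ((x i - x m) / (x i + y m)) * ((y l - y m) / (x m + y l)) * (1 / (x i + y l))"
      by (simp add: divide_simps) (simp add: algebra_simps)
  qed
  also have "jdet \<dots> = (\<Prod>i = 0..<m. (x i - x m) / (x i + y m)) * (\<Prod>i = 0..<m. (y i - y m) / (x m + y i)) *
     jdet (mat m m (\<lambda>(i, l). 1 / (x i + y l)))"
    by (rule det_scale)
  also have "jdet (mat m m (\<lambda>(i, l). 1 / (x i + y l))) = (\<Prod>i = 0..<m. 1 / (x i + y i)) *
     (\<Prod>j = 0..<m. \<Prod>i = 0..<j. (x i - x j) * (y i - y j) / ((x i + y j) * (x j + y i)))"
    using Suc by simp
  also have "(\<Prod>i = 0..<m. (x i - x m) / (x i + y m)) * (\<Prod>i = 0..<m. (y i - y m) / (x m + y i)) =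
     (\<Prod>i = 0..<m. (x i - x m) * (y i - y m) / ((x i + y m) * (x m + y i)))"
    unfolding prod.distrib[symmetric] by (simp only: times_divide_times_eq)
  finally show ?case by simp
qed simp

text \<open>The Leibniz sum over the permutations of an index set. It agrees with \<open>det_on\<close>, and since the order of the
index set does not enter it is the form in which principal minors can be handled.\<close>

definition set_det :: "nat set \<Rightarrow> (nat \<Rightarrow> nat \<Rightarrow> real) \<Rightarrow> real" where
  "set_det K f = (\<Sum>p | p permutes K. signof p * (\<Prod>i\<in>K. f i (p i)))"

text \<open>Transport along an injection takes transpositions to transpositions.\<close>

lemma sign_map_permutation:
  assumes "finite A" "p permutes A" "inj_on f A"
  shows "sign (map_permutation A f p) = sign p"
  using assms(2,1)
proof (induction rule: permutes_induct)
  case id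
  then show ?case using assms by (simp add: map_permutation_id' map_permutation_ident' id_def)
next
  case (swap a b p)
  have m: "map_permutation A f p permutes f ` A"
    by (rule map_permutation_permutes) (use assms swap in \<open>auto simp: bij_betw_def\<close>)
  have "map_permutation A f (Transposition.transpose a b \<circ> p) = Transposition.transpose (f a) (f b) \<circ> map_permutation A f p"
    using map_permutation_compose'[OF assms(3) swap(4), of "Transposition.transpose a b"] map_permutation_transpose[OF assms(3) swap(1,2)] by simp
  moreover have "f a \<noteq> f b" using assms(3) swap(1-3) by (auto dest: inj_onD)
  moreover have "permutation p" "permutation (map_permutation A f p)"
    using permutes_imp_permutation[OF assms(1) swap(4)] permutes_imp_permutation[OF _ m] assms(1) by auto
  ultimately show ?case using swap(3,5) by (simp only: sign_compose permutation_swap_id sign_swap_id if_False)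
qed

lemma bij_betw_nth_sorted: "finite K \<Longrightarrow> bij_betw ((!) (sorted_list_of_set K)) {0..<card K} (K :: nat set)"
  by (rule bij_betw_nth) (auto simp: lessThan_atLeast0)

lemma det_on_eq_set_det:
  assumes K: "finite K"
  shows "det_on K f = set_det K f"
proof -
  define e where "e = (!) (sorted_list_of_set K)"
  define g where "g = the_inv_into {0..<card K} e"
  have bij: "bij_betw e {0..<card K} K" unfolding e_def by (rule bij_betw_nth_sorted[OF K])
  have bij': "bij_betw g K {0..<card K}" unfolding g_def by (rule bij_betw_the_inv_into[OF bij])
  have inj: "inj_on e {0..<card K}" using bij by (simp add: bij_betw_def)
  have ge: "g (e i) = i" if "i \<in> {0..<card K}" for i unfolding g_def using the_inv_into_f_f[OF inj that] .
  have eg: "e (g i) = i" if "i \<in> K" for i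
    unfolding g_def by (rule f_the_inv_into_f_bij_betw[OF bij]) (use that in auto)
  have "det_on K f = (\<Sum>p | p permutes {0..<card K}. signof p * (\<Prod>i = 0..<card K. f (e i) (e (p i))))"
    unfolding mat_on_def det_mat_eq by (simp add: e_def)
  also have "\<dots> = set_det K f"
    unfolding set_det_def
  proof (rule sum.reindex_bij_witness[where i = "map_permutation K g" and j = "map_permutation {0..<card K} e"])
    fix p assume "p \<in> {p. p permutes {0..<card K}}"
    then have p: "p permutes {0..<card K}" by simp
    show "map_permutation K g (map_permutation {0..<card K} e p) = p"
      by (rule map_permutation_compose_inv[OF bij p]) (rule ge)
    show "map_permutation {0..<card K} e p \<in> {p. p permutes K}"
      using map_permutation_permutes[OF bij p] by simp
    have "(\<Prod>i\<in>K. f i (map_permutation {0..<card K} e p i)) =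
        (\<Prod>i = 0..<card K. f (e i) (map_permutation {0..<card K} e p (e i)))"
      by (rule prod.reindex_bij_betw[OF bij, symmetric])
    also have "\<dots> = (\<Prod>i = 0..<card K. f (e i) (e (p i)))"
      by (intro prod.cong refl) (simp add: map_permutation_apply[OF inj])
    finally show "signof (map_permutation {0..<card K} e p) * (\<Prod>i\<in>K. f i (map_permutation {0..<card K} e p i)) =
        signof p * (\<Prod>i = 0..<card K. f (e i) (e (p i)))"
      by (simp add: sign_map_permutation[OF _ p inj])
  next
    fix p assume "p \<in> {p. p permutes K}"
    then have p: "p permutes K" by simp
    show "map_permutation {0..<card K} e (map_permutation K g p) = p"
      by (rule map_permutation_compose_inv[OF bij' p]) (rule eg)
    show "map_permutation K g p \<in> {p. p permutes {0..<card K}}"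
      using map_permutation_permutes[OF bij' p] by simp
  qed
  finally show ?thesis .
qed

lemma det_on_cong: "finite K \<Longrightarrow> (\<And>j k. j \<in> K \<Longrightarrow> k \<in> K \<Longrightarrow> f j k = g j k) \<Longrightarrow> det_on K f = det_on K g"
  unfolding det_on_eq_set_det set_det_def
  by (intro sum.cong refl arg_cong2[where f = "(*)"] prod.cong) (auto simp: permutes_in_image)

lemma det_on_scale:
  assumes K: "finite K"
  shows "det_on K (\<lambda>j k. a j * b k * f j k) = (\<Prod>k\<in>K. a k * b k) * det_on K f"
proof -
  have "(\<Prod>i\<in>K. a i * b (p i) * f i (p i)) = (\<Prod>k\<in>K. a k * b k) * (\<Prod>i\<in>K. f i (p i))" if "p permutes K" for p
    by (simp add: prod.distrib prod.permute[OF that, of b] comp_def)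
  then show ?thesis unfolding det_on_eq_set_det[OF K] set_det_def
    by (simp add: sum_distrib_left mult_ac)
qed

lemma det_on_Ints: "finite K \<Longrightarrow> (\<And>j k. j \<in> K \<Longrightarrow> k \<in> K \<Longrightarrow> f j k \<in> \<int>) \<Longrightarrow> det_on K f \<in> \<int>"
  unfolding det_on_eq_set_det set_det_def
  by (intro Ints_sum Ints_mult Ints_prod) (auto simp: permutes_in_image)

lemma det_on_cauchy:
  assumes K: "finite K" "0 \<notin> K"
  shows "det_on K (\<lambda>j k. 1 / (real j + real k)) = (\<Prod>k\<in>K. 1 / (2 * real k)) *
    (\<Prod>(j, k) | j \<in> K \<and> k \<in> K \<and> j < k. (real k - real j)\<^sup>2 / (real k + real j)\<^sup>2)"
proof -
  define e where "e = (!) (sorted_list_of_set K)"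
  define m where "m = card K"
  have bij: "bij_betw e {0..<m} K" unfolding e_def m_def by (rule bij_betw_nth_sorted[OF K(1)])
  have pos: "0 < e i" if "i < m" for i using bij_betwE[OF bij] that K(2) by (metis atLeastLessThan_iff gr0I le0)
  have mono: "e i < e j" if "i < j" "j < m" for i j
    unfolding e_def using that sorted_wrt_nth_less[of "(<)" "sorted_list_of_set K" i j] by (simp add: m_def)
  have mono_iff: "e i < e j \<longleftrightarrow> i < j" if "i < m" "j < m" for i j
    using mono[of i j] mono[of j i] that by (cases i j rule: linorder_cases) auto
  have "det_on K (\<lambda>j k. 1 / (real j + real k)) = jdet (mat m m (\<lambda>(i, l). 1 / (real (e i) + real (e l))))"
    unfolding mat_on_def m_def e_def ..
  also have "\<dots> = (\<Prod>i = 0..<m. 1 / (real (e i) + real (e i))) * (\<Prod>j = 0..<m. \<Prod>i = 0..<j.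
      (real (e i) - real (e j)) * (real (e i) - real (e j)) / ((real (e i) + real (e j)) * (real (e j) + real (e i))))"
    by (rule det_cauchy) (use pos in \<open>auto simp: add_nonneg_eq_0_iff\<close>)
  also have "(\<Prod>i = 0..<m. 1 / (real (e i) + real (e i))) = (\<Prod>k\<in>K. 1 / (2 * real k))"
    unfolding prod.reindex_bij_betw[OF bij, symmetric] by simp
  also have "(\<Prod>j = 0..<m. \<Prod>i = 0..<j.
      (real (e i) - real (e j)) * (real (e i) - real (e j)) / ((real (e i) + real (e j)) * (real (e j) + real (e i)))) =
      (\<Prod>j = 0..<m. \<Prod>i = 0..<j. (real (e j) - real (e i))\<^sup>2 / (real (e j) + real (e i))\<^sup>2)"
    by (intro prod.cong refl arg_cong2[where f = "(/)"]) (auto simp: power2_eq_square algebra_simps)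
  also have "\<dots> = (\<Prod>(j, i)\<in>Sigma {0..<m} (\<lambda>j. {0..<j}). (real (e j) - real (e i))\<^sup>2 / (real (e j) + real (e i))\<^sup>2)"
    by (rule prod.Sigma) auto
  also have "\<dots> = (\<Prod>(j, k) | j \<in> K \<and> k \<in> K \<and> j < k. (real k - real j)\<^sup>2 / (real k + real j)\<^sup>2)"
  proof (rule prod.reindex_bij_witness[where j = "\<lambda>(j, i). (e i, e j)"
        and i = "\<lambda>(j, k). (the_inv_into {0..<m} e k, the_inv_into {0..<m} e j)"])
    have inj: "inj_on e {0..<m}" using bij by (simp add: bij_betw_def)
    note ef = f_the_inv_into_f_bij_betw[OF bij]
    note fe = the_inv_into_f_f[OF inj]
    have inK: "e i \<in> K" if "i < m" for i using bij_betwE[OF bij] that by simp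
    have inv: "the_inv_into {0..<m} e k < m" if "k \<in> K" for k
      using bij_betwE[OF bij_betw_the_inv_into[OF bij]] that by simp
    show "(case case a of (j, i) \<Rightarrow> (e i, e j) of (j, k) \<Rightarrow> (the_inv_into {0..<m} e k, the_inv_into {0..<m} e j)) = a"
      if "a \<in> Sigma {0..<m} (\<lambda>j. {0..<j})" for a using that by (auto simp: fe)
    show "(case a of (j, i) \<Rightarrow> (e i, e j)) \<in> {(j, k). j \<in> K \<and> k \<in> K \<and> j < k}"
      if "a \<in> Sigma {0..<m} (\<lambda>j. {0..<j})" for a using that by (auto simp: inK mono)
    show "(case case a of (j, k) \<Rightarrow> (the_inv_into {0..<m} e k, the_inv_into {0..<m} e j) of (j, i) \<Rightarrow> (e i, e j)) = a"
      if "a \<in> {(j, k). j \<in> K \<and> k \<in> K \<and> j < k}" for a using that by (auto simp: ef)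
    show "(case a of (j, k) \<Rightarrow> (the_inv_into {0..<m} e k, the_inv_into {0..<m} e j)) \<in> Sigma {0..<m} (\<lambda>j. {0..<j})"
      if "a \<in> {(j, k). j \<in> K \<and> k \<in> K \<and> j < k}" for a
      using that inv mono_iff[of "the_inv_into {0..<m} e (fst a)" "the_inv_into {0..<m} e (snd a)"] by (auto simp: ef)
  qed auto
  finally show ?thesis .
qed

text \<open>Expand each product in the Leibniz formula over the set \<open>K\<close> of those indices where the second summand is chosen. Since
the first summand is diagonal, only permutations that fix the complement of \<open>K\<close> contribute.\<close>

lemma det_affine:
  "jdet (mat n n (\<lambda>(i, l). c * of_bool (i = l) + t * M (Suc i) (Suc l))) =
    (\<Sum>K\<in>Pow {1..n}. c ^ (n - card K) * t ^ card K * det_on K M)"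
proof -
  have sl: "sorted_list_of_set {1..n} = [1..<Suc n]"
    using sorted_list_of_set_range[of 1 "Suc n"] by (simp add: atLeastLessThanSuc_atLeastAtMost)
  have "jdet (mat n n (\<lambda>(i, l). c * of_bool (i = l) + t * M (Suc i) (Suc l))) =
      det_on {1..n} (\<lambda>i l. c * of_bool (i = l) + t * M i l)"
    unfolding mat_on_def sl card_atLeastAtMost diff_Suc_1
    by (intro arg_cong[where f = jdet] cong_mat) (auto simp: plus_1_eq_Suc simp del: upt_Suc)
  also have "\<dots> = (\<Sum>p | p permutes {1..n}. \<Sum>K\<in>Pow {1..n}. signof p *
      ((\<Prod>i\<in>K. t * M i (p i)) * (\<Prod>i\<in>{1..n} - K. c * of_bool (i = p i))))"
    unfolding det_on_eq_set_det[OF finite_atLeastAtMost] set_det_def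
    by (subst add.commute) (simp add: prod_add sum_distrib_left)
  also have "\<dots> = (\<Sum>K\<in>Pow {1..n}. \<Sum>p | p permutes {1..n}. signof p *
      ((\<Prod>i\<in>K. t * M i (p i)) * (\<Prod>i\<in>{1..n} - K. c * of_bool (i = p i))))"
    by (rule sum.swap)
  also have "\<dots> = (\<Sum>K\<in>Pow {1..n}. c ^ (n - card K) * t ^ card K * det_on K M)"
  proof (intro sum.cong refl)
    fix K assume "K \<in> Pow {1..n}"
    then have K: "K \<subseteq> {1..n}" "finite K" by (auto intro: finite_subset)
    have "(\<Sum>p | p permutes {1..n}. signof p * ((\<Prod>i\<in>K. t * M i (p i)) * (\<Prod>i\<in>{1..n} - K. c * of_bool (i = p i)))) =
        (\<Sum>p | p permutes K. signof p * ((\<Prod>i\<in>K. t * M i (p i)) * (\<Prod>i\<in>{1..n} - K. c * of_bool (i = p i))))"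
    proof (rule sum.mono_neutral_right)
      show "{p. p permutes K} \<subseteq> {p. p permutes {1..n}}" using K(1) permutes_subset by blast
      show "\<forall>p\<in>{p. p permutes {1..n}} - {p. p permutes K}.
          signof p * ((\<Prod>i\<in>K. t * M i (p i)) * (\<Prod>i\<in>{1..n} - K. c * of_bool (i = p i))) = 0"
      proof
        fix p assume "p \<in> {p. p permutes {1..n}} - {p. p permutes K}"
        then obtain i where i: "i \<in> {1..n} - K" "i \<noteq> p i" using permutes_superset[of p "{1..n}" K] by fastforce
        then have "(\<Prod>i\<in>{1..n} - K. c * of_bool (i = p i)) = 0" by (intro prod_zero bexI[OF _ i(1)]) (use i(2) in simp_all)
        then show "signof p * ((\<Prod>i\<in>K. t * M i (p i)) * (\<Prod>i\<in>{1..n} - K. c * of_bool (i = p i))) = 0" by simp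
      qed
    qed (simp add: finite_permutations)
    also have "\<dots> = (\<Sum>p | p permutes K. c ^ (n - card K) * t ^ card K * (signof p * (\<Prod>i\<in>K. M i (p i))))"
    proof (intro sum.cong refl)
      fix p assume "p \<in> {p. p permutes K}"
      then have "(\<Prod>i\<in>{1..n} - K. c * of_bool (i = p i)) = (\<Prod>i\<in>{1..n} - K. c)"
        by (intro prod.cong refl) (auto simp: permutes_not_in)
      also have "\<dots> = c ^ (n - card K)" using K by (simp add: card_Diff_subset)
      finally show "signof p * ((\<Prod>i\<in>K. t * M i (p i)) * (\<Prod>i\<in>{1..n} - K. c * of_bool (i = p i))) =
          c ^ (n - card K) * t ^ card K * (signof p * (\<Prod>i\<in>K. M i (p i)))"
        by (simp add: prod.distrib mult_ac)
    qed
    also have "\<dots> = c ^ (n - card K) * t ^ card K * det_on K M"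
      unfolding det_on_eq_set_det[OF K(2)] set_det_def by (simp add: sum_distrib_left)
    finally show "(\<Sum>p | p permutes {1..n}. signof p * ((\<Prod>i\<in>K. t * M i (p i)) * (\<Prod>i\<in>{1..n} - K. c * of_bool (i = p i)))) =
        c ^ (n - card K) * t ^ card K * det_on K M" .
  qed
  finally show ?thesis .
qed

section \<open>Partial fractions for the matrix of moments\<close>

text \<open>These products vanish at the nodes \<open>2 l + 1\<close> with \<open>l < d - d div 2\<close> and \<open>- 2 m\<close> with \<open>1 \<le> m \<le> d div 2\<close>, which are the
parameters of the matrix of moments.\<close>

definition odd_prod :: "nat \<Rightarrow> real \<Rightarrow> real" where
  "odd_prod d x = (\<Prod>l<d - d div 2. x - (2 * real l + 1))"

definition even_prod :: "nat \<Rightarrow> real \<Rightarrow> real" where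
  "even_prod d x = (\<Prod>m = 1..d div 2. x + 2 * real m)"

text \<open>The factors of the coefficients in the partial fractions of lemma \<open>interpolation\<close>.\<close>

definition node_weight :: "nat \<Rightarrow> nat \<Rightarrow> real" where
  "node_weight d k = - odd_prod d (- 2 * real k) / (\<Prod>m\<in>{1..d div 2} - {k}. 2 * real m - 2 * real k)"

definition value_ratio :: "nat \<Rightarrow> nat \<Rightarrow> real" where
  "value_ratio d i = even_prod d (2 * real i) / odd_prod d (2 * real i)"

lemma odd_neq_even: "2 * real i - (2 * real l + 1) \<noteq> 0"
proof
  assume "2 * real i - (2 * real l + 1) = 0"
  then have "real (2 * i) = real (2 * l + 1)" by simp
  then have "2 * i = 2 * l + 1" by (simp only: of_nat_eq_iff)
  then show False by presburger
qed

lemma odd_prod_even_nonzero: "odd_prod d (2 * real i) \<noteq> 0"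
  unfolding odd_prod_def by (subst prod_zero_iff) (use odd_neq_even in auto)

lemma even_prod_zero: "k \<in> {1..d div 2} \<Longrightarrow> even_prod d (- 2 * real k) = 0"
  unfolding even_prod_def by (rule prod_zero) (auto intro!: bexI[of _ k])

lemma degree_monic_diff:
  fixes p q :: "real poly"
  assumes "degree p = Suc m" "degree q = Suc m" "lead_coeff p = lead_coeff q"
  shows "degree (p - q) \<le> m"
proof (rule degree_le, intro allI impI)
  fix i assume "m < i"
  then show "coeff (p - q) i = 0"
    using assms by (cases "i = Suc m") (auto simp: coeff_eq_0)
qed

lemma monic_prod_linear:
  fixes a :: "'b \<Rightarrow> real"
  shows "degree (\<Prod>i\<in>A. [:a i, 1:]) = card A" "lead_coeff (\<Prod>i\<in>A. [:a i, 1:]) = 1"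
  by (simp add: degree_prod_eq_sum_degree) (subst lead_coeff_prod, simp)

lemma poly_prod_linear: "poly (\<Prod>i\<in>A. [:a i, 1:]) x = (\<Prod>i\<in>A. x + (a i :: real))"
  unfolding poly_prod by (intro prod.cong refl) simp

text \<open>Multiply by the denominators and let \<open>Q\<close> and \<open>S\<close> be the polynomials of \<open>odd_prod\<close> and \<open>even_prod\<close>. The assertion is that \<open>R\<close> below
vanishes at the zeros of \<open>Q\<close>. It holds identically: \<open>R\<close> has degree at most \<open>n\<close>, and it vanishes at \<open>y\<close> and at the \<open>n\<close>
zeros of \<open>S\<close>, by the choice of the coefficients.\<close>

lemma interpolation:
  assumes i: "i \<in> {1..d div 2}" and l: "l < d - d div 2"
  shows "1 / (2 * real i - (2 * real l + 1)) =
    (\<Sum>k\<in>{1..d div 2}. value_ratio d i * node_weight d k / (2 * real i + 2 * real k) / (2 * real l + 1 + 2 * real k))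
    + (if even d then 0 else value_ratio d i)"
proof -
  define n where "n = d div 2"
  define E where "E = d - n"
  have n1: "0 < n" using i by (auto simp: n_def)
  have En: "E = (if even d then n else Suc n)" unfolding E_def n_def by (auto elim!: evenE oddE)
  define Q where "Q = (\<Prod>l<E. [:- (2 * real l + 1), 1:])"
  define S where "S = (\<Prod>m = 1..n. [:2 * real m, 1:])"
  define T where "T k = (\<Prod>m\<in>{1..n} - {k}. [:2 * real m, 1:])" for k
  define y where "y = 2 * real i"
  define g where "g = value_ratio d i"
  define c where "c k = g * node_weight d k / (y + 2 * real k)" for k
  \<comment> \<open>For odd \<open>d\<close> the degree of \<open>Q\<close> exceeds \<open>n\<close> by one; the multiple of \<open>S\<close> removes the top coefficient and
accounts for the constant term of the expansion.\<close>
  define P where "P = (if even d then Q else Q - [:- y, 1:] * S)"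
  define R where "R = S - smult g P - [:y, -1:] * (\<Sum>k = 1..n. smult (c k) (T k))"
  have polyQ: "poly Q x = odd_prod d x" for x
    unfolding Q_def odd_prod_def n_def[symmetric] E_def[symmetric] poly_prod_linear by (simp add: algebra_simps)
  have polyS: "poly S x = even_prod d x" for x
    unfolding S_def even_prod_def n_def[symmetric] poly_prod_linear by simp
  have polyT: "poly (T k) x = (\<Prod>m\<in>{1..n} - {k}. x + 2 * real m)" for k x
    unfolding T_def poly_prod_linear ..
  have ST: "poly S x = (x + 2 * real k) * poly (T k) x" if "k \<in> {1..n}" for k x
    unfolding polyT S_def poly_prod_linear by (rule prod.remove) (use that in auto)
  have y: "y > 0" using i by (simp add: y_def)
  have Qy: "odd_prod d y \<noteq> 0" unfolding y_def by (rule odd_prod_even_nonzero)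
  have gy: "g * odd_prod d y = even_prod d y" using Qy unfolding g_def value_ratio_def y_def by simp
  have T0: "poly (T k) (- 2 * real k) \<noteq> 0" if "k \<in> {1..n}" for k
    unfolding polyT by (subst prod_zero_iff) auto
  have TK: "poly (T k) (- 2 * real k) = (\<Prod>m\<in>{1..n} - {k}. 2 * real m - 2 * real k)" for k
    unfolding polyT by (intro prod.cong refl) simp
  have ck: "c k * poly (T k) (- 2 * real k) = - g * odd_prod d (- 2 * real k) / (y + 2 * real k)" if "k \<in> {1..n}" for k
    using T0[OF that] unfolding c_def node_weight_def n_def[symmetric] TK by simp
  have "degree R \<le> n"
  proof -
    have dT: "degree (T k) = n - 1" if "k \<in> {1..n}" for k
      unfolding T_def using that by (subst monic_prod_linear(1)) auto
    have dS: "degree S = n" and dQ: "degree Q = E" unfolding S_def Q_def by (simp_all add: monic_prod_linear(1))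
    have lS: "coeff S n = 1" and lQ: "coeff Q E = 1"
      using monic_prod_linear(2)[of "\<lambda>m. 2 * real m" "{1..n}"] monic_prod_linear(2)[of "\<lambda>l. - (2 * real l + 1)" "{..<E}"]
      unfolding dS[unfolded S_def] dQ[unfolded Q_def] S_def Q_def by simp_all
    have "degree P \<le> n"
    proof (cases "even d")
      case True then show ?thesis using dQ En by (simp add: P_def)
    next
      case False
      have nz: "S \<noteq> 0" using lS by auto
      have "degree ([:- y, 1:] * S) = Suc n" using dS nz by (subst degree_mult_eq) auto
      moreover have "lead_coeff ([:- y, 1:] * S) = 1" using dS lS by (subst lead_coeff_mult) simp
      ultimately show ?thesis using False dQ lQ En degree_monic_diff[of Q n "[:- y, 1:] * S"] by (simp add: P_def)
    qed
    moreover have "degree (\<Sum>k = 1..n. smult (c k) (T k)) \<le> n - 1"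
      by (rule degree_sum_le) (use dT in \<open>auto intro: order_trans[OF degree_smult_le]\<close>)
    then have "degree ([:y, -1:] * (\<Sum>k = 1..n. smult (c k) (T k))) \<le> n"
      using degree_mult_le[of "[:y, -1:]" "\<Sum>k = 1..n. smult (c k) (T k)"] n1 by simp
    ultimately show ?thesis unfolding R_def using dS
      by (intro degree_diff_le) (auto intro: order_trans[OF degree_smult_le])
  qed
  have R0: "poly R x = 0" if x: "x \<in> insert y ((\<lambda>k. - 2 * real k) ` {1..n})" for x
  proof (cases "x = y")
    case True
    have "poly P y = odd_prod d y" by (simp add: P_def polyQ)
    then show ?thesis using gy True by (simp add: R_def polyS)
  next
    case False
    then obtain k where k: "k \<in> {1..n}" "x = - 2 * real k" using x by auto
    have S0: "poly S x = 0" using even_prod_zero[of k d] k by (simp add: polyS n_def)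
    have "poly P x = odd_prod d x" using S0 by (simp add: P_def polyQ)
    moreover have "(\<Sum>j = 1..n. c j * poly (T j) x) = c k * poly (T k) x"
    proof (rule sum.remove[THEN trans])
      have "(\<Sum>j\<in>{1..n} - {k}. c j * poly (T j) x) = 0"
        unfolding polyT by (intro sum.neutral ballI mult_eq_0_iff[THEN iffD2] disjI2 prod_zero) (use k in auto)
      then show "c k * poly (T k) x + (\<Sum>j\<in>{1..n} - {k}. c j * poly (T j) x) = c k * poly (T k) x" by simp
    qed (use k in auto)
    moreover have "(y - x) * (c k * poly (T k) x) = - g * odd_prod d x"
      using ck[OF k(1)] y k(2) by simp
    ultimately show ?thesis using S0 by (simp add: R_def poly_sum left_diff_distrib)
  qed
  have "R = 0"
  proof (rule ccontr)
    assume "R \<noteq> 0"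
    have "card (insert y ((\<lambda>k. - 2 * real k) ` {1..n})) \<le> card {x. poly R x = 0}"
      by (rule card_mono) (use R0 poly_roots_finite[OF \<open>R \<noteq> 0\<close>] in auto)
    also have "\<dots> \<le> n" using card_poly_roots_bound[OF \<open>R \<noteq> 0\<close>] \<open>degree R \<le> n\<close> by simp
    also have "card (insert y ((\<lambda>k. - 2 * real k) ` {1..n})) = Suc n"
      using y by (subst card_insert_disjoint) (auto simp: card_image inj_on_def)
    finally show False by simp
  qed
  have aux: "1 / w = z" if "u \<noteq> 0" "w \<noteq> 0" "u = w * u * z" for u w z :: real
    using that by (metis mult.commute mult.left_commute mult_cancel_left1 nonzero_eq_divide_eq)
  define x where "x = 2 * real l + 1"
  have "poly Q x = 0" unfolding polyQ odd_prod_def x_def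
    by (rule prod_zero) (use l in \<open>auto intro!: bexI[of _ l]\<close>)
  then have Px: "poly P x = (if even d then 0 else (y - x) * poly S x)" by (simp add: P_def algebra_simps)
  have x0: "x + 2 * real k \<noteq> 0" for k unfolding x_def by (simp add: add_nonneg_eq_0_iff)
  have Sx: "poly S x \<noteq> 0" unfolding S_def poly_prod_linear by (subst prod_zero_iff) (use x0 in auto)
  have yx: "y - x \<noteq> 0" unfolding y_def x_def by (rule odd_neq_even)
  have "poly S x - g * poly P x = (y - x) * (\<Sum>k = 1..n. c k * poly (T k) x)"
  proof -
    have "poly R x = poly S x - g * poly P x - (y - x) * (\<Sum>k = 1..n. c k * poly (T k) x)"
      by (simp add: R_def poly_sum left_diff_distrib)
    then show ?thesis using \<open>R = 0\<close> by simp
  qed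
  moreover have "poly (T k) x = poly S x / (x + 2 * real k)" if "k \<in> {1..n}" for k
    using ST[OF that, of x] x0[of k] by simp
  then have "(\<Sum>k = 1..n. c k * poly (T k) x) = poly S x * (\<Sum>k = 1..n. c k / (x + 2 * real k))"
    by (simp add: sum_distrib_left mult_ac)
  ultimately have "poly S x = (y - x) * poly S x * ((\<Sum>k = 1..n. c k / (x + 2 * real k)) + (if even d then 0 else g))"
    unfolding Px by (simp add: algebra_simps split: if_splits)
  then have "1 / (y - x) = (\<Sum>k = 1..n. c k / (x + 2 * real k)) + (if even d then 0 else g)"
    using aux[OF Sx yx] by blast
  then show ?thesis unfolding c_def g_def y_def x_def n_def .
qed

lemma skew_moment_eq:
  assumes "0 \<le> t" "t \<le> 1"
  shows "skew_moment t l i = 4 / (2 * real l + 1) * ((1 - t) * (1 / (2 * real l + 1 + 2 * real (Suc i)))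
     + t * (1 / (2 * real (Suc i) - (2 * real l + 1))))"
  using assms pair_moment_value[of t "2 * l" "2 * i + 1"] unfolding skew_moment_def
  by (simp add: algebra_simps)

text \<open>The coefficient of \<open>1 / (x + 2 * k)\<close> in the partial fractions of \<open>1 / (2 * i - x)\<close> on the odd nodes \<open>x\<close>.\<close>

definition mix_coeff :: "nat \<Rightarrow> nat \<Rightarrow> nat \<Rightarrow> real" where
  "mix_coeff d i k = value_ratio d i * node_weight d k * (1 / (2 * real i + 2 * real k))"

text \<open>By \<open>interpolation\<close>, the rows at \<open>t\<close> are combinations of the rows at \<open>0\<close>. For odd \<open>d\<close> the constant term of the expansion
is a multiple of the last row, which does not depend on \<open>t\<close>; the transition matrix is block triangular.\<close>

lemma det_moment_mat:
  assumes t: "0 \<le> t" "t \<le> 1"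
  shows "jdet (moment_mat d t) =
    (\<Sum>K\<in>Pow {1..d div 2}. (1 - t) ^ (d div 2 - card K) * t ^ card K * det_on K (mix_coeff d)) * jdet (moment_mat d 0)"
proof -
  define n where "n = d div 2"
  define k where "k = d - n - n"
  have d: "d - n = n + k" and k1: "k \<le> 1" and ev: "even d \<longleftrightarrow> k = 0" unfolding k_def n_def by presburger+
  define A where "A = mat n n (\<lambda>(i, l). (1 - t) * of_bool (i = l) + t * mix_coeff d (Suc i) (Suc l))"
  define B where "B = mat n k (\<lambda>(i, l). 2 * t * value_ratio d (Suc i))"
  define L where "L = four_block_mat A B (0\<^sub>m k n) (1\<^sub>m k)"
  have L: "L \<in> carrier_mat (n + k) (n + k)" unfolding L_def A_def B_def by (intro four_block_carrier_mat) auto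
  have M: "moment_mat d s \<in> carrier_mat (n + k) (n + k)" for s
    unfolding moment_mat_def n_def[symmetric] d by simp
  have Ment: "moment_mat d s $$ (i, l) = (if i < n then skew_moment s l i else 2 / (2 * real l + 1))"
    if "i < n + k" "l < n + k" for s i l
    unfolding moment_mat_def n_def[symmetric] d using that by simp
  have sk0: "skew_moment 0 l i = 4 / (2 * real l + 1) * (1 / (2 * real l + 1 + 2 * real (Suc i)))" for l i
    using skew_moment_eq[of 0 l i] by simp
  have "moment_mat d t = L * moment_mat d 0"
  proof (rule eq_matI)
    fix i l assume "i < dim_row (L * moment_mat d 0)" "l < dim_col (L * moment_mat d 0)"
    then have il: "i < n + k" "l < n + k" using L M[of 0] by auto
    have "(L * moment_mat d 0) $$ (i, l) = (\<Sum>j = 0..<n + k. L $$ (i, j) * moment_mat d 0 $$ (j, l))"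
      using il L M[of 0] by (auto simp: scalar_prod_def)
    also have "\<dots> = (\<Sum>j = 0..<n. L $$ (i, j) * moment_mat d 0 $$ (j, l)) + (\<Sum>j = n..<n + k. L $$ (i, j) * moment_mat d 0 $$ (j, l))"
      by (simp add: sum.atLeastLessThan_concat)
    also have "(\<Sum>j = n..<n + k. L $$ (i, j) * moment_mat d 0 $$ (j, l)) =
       (if k = 0 then 0 else L $$ (i, n) * (2 / (2 * real l + 1)))"
      using k1 il Ment[of n l 0] by (cases "k = 0") (auto simp: le_Suc_eq One_nat_def)
    also have "(\<Sum>j = 0..<n. L $$ (i, j) * moment_mat d 0 $$ (j, l)) =
       (\<Sum>j = 0..<n. L $$ (i, j) * skew_moment 0 l j)"
      using il by (intro sum.cong refl) (simp add: Ment)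
    also have "\<dots> + (if k = 0 then 0 else L $$ (i, n) * (2 / (2 * real l + 1))) = moment_mat d t $$ (i, l)"
    proof (cases "i < n")
      case True
      let ?x = "2 * real l + 1" and ?y = "\<lambda>j. 2 * real j"
      have aux: "((1 - t) * b + t * m) * (c * (1 / D)) = b * ((1 - t) * (c * (1 / D))) + c * t * (m / D)" for b m c D :: real
        by (simp add: divide_inverse algebra_simps)
      have aux2: "(\<Sum>j = 0..<n. of_bool (i = j) * h j) = h i" for h :: "nat \<Rightarrow> real"
        using True by (simp add: of_bool_def mult_delta_left)
      have "(\<Sum>j = 0..<n. L $$ (i, j) * skew_moment 0 l j) =
         (\<Sum>j = 0..<n. ((1 - t) * of_bool (i = j) + t * mix_coeff d (Suc i) (Suc j)) * (4 / ?x * (1 / (?x + ?y (Suc j)))))"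
        using True by (intro sum.cong refl) (simp add: L_def A_def B_def sk0)
      also have "\<dots> = (\<Sum>j = 0..<n. of_bool (i = j) * ((1 - t) * (4 / ?x * (1 / (?x + ?y (Suc j)))))) +
         4 / ?x * t * (\<Sum>j = 0..<n. mix_coeff d (Suc i) (Suc j) / (?x + ?y (Suc j)))"
        unfolding sum_distrib_left sum.distrib[symmetric] by (intro sum.cong refl) (rule aux)
      also have "(\<Sum>j = 0..<n. of_bool (i = j) * ((1 - t) * (4 / ?x * (1 / (?x + ?y (Suc j)))))) =
         (1 - t) * (4 / ?x * (1 / (?x + ?y (Suc i))))" by (rule aux2)
      also have "(\<Sum>j = 0..<n. mix_coeff d (Suc i) (Suc j) / (?x + ?y (Suc j))) = (\<Sum>j\<in>{1..n}. mix_coeff d (Suc i) j / (?x + ?y j))"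
        unfolding One_nat_def sum.atLeast1_atMost_eq lessThan_atLeast0 ..
      also have "\<dots> = 1 / (?y (Suc i) - ?x) - (if k = 0 then 0 else value_ratio d (Suc i))"
        using interpolation[of "Suc i" d l] True il d ev unfolding n_def[symmetric] mix_coeff_def by simp
      finally have 1: "(\<Sum>j = 0..<n. L $$ (i, j) * skew_moment 0 l j) = (1 - t) * (4 / ?x * (1 / (?x + ?y (Suc i)))) +
         4 / ?x * t * (1 / (?y (Suc i) - ?x) - (if k = 0 then 0 else value_ratio d (Suc i)))" .
      have 2: "L $$ (i, n) = 2 * t * value_ratio d (Suc i)" if "k \<noteq> 0"
        using True that by (simp add: L_def A_def B_def)
      show ?thesis unfolding 1 Ment[OF il] skew_moment_eq[OF t, of l i] using True 2
        by (cases "k = 0") (simp_all add: algebra_simps)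
    next
      case False
      then have "k = 1" "i = n" using k1 il by auto
      then have "L $$ (i, j) = of_bool (j = n)" if "j < n + k" for j
        using that by (auto simp: L_def A_def B_def)
      then show ?thesis using \<open>k = 1\<close> \<open>i = n\<close> il by (simp add: Ment)
    qed
    finally show "moment_mat d t $$ (i, l) = (L * moment_mat d 0) $$ (i, l)" ..
  qed (use L M[of 0] M[of t] in auto)
  then have "jdet (moment_mat d t) = jdet L * jdet (moment_mat d 0)"
    using det_mult[OF L M[of 0]] by simp
  moreover have "jdet L = jdet A * jdet (1\<^sub>m k :: real mat)"
    unfolding L_def by (rule det_four_block_mat_lower_left_zero) (auto simp: A_def B_def)
  moreover have "jdet A = (\<Sum>K\<in>Pow {1..n}. (1 - t) ^ (n - card K) * t ^ card K * det_on K (mix_coeff d))"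
    unfolding A_def by (rule det_affine)
  ultimately show ?thesis by (simp add: n_def)
qed

lemma det_cauchy_nonzero:
  fixes x y :: "nat \<Rightarrow> real"
  assumes "\<And>i l. i < m \<Longrightarrow> l < m \<Longrightarrow> x i + y l \<noteq> 0"
    and "\<And>i l. i < l \<Longrightarrow> l < m \<Longrightarrow> x i \<noteq> x l \<and> y i \<noteq> y l"
  shows "jdet (mat m m (\<lambda>(i, l). 1 / (x i + y l))) \<noteq> 0"
  by (subst det_cauchy) (use assms in \<open>auto simp: prod_zero_iff\<close>)

text \<open>For even \<open>d\<close> this is a Cauchy matrix with scaled columns. For odd \<open>d\<close> the pivot on the constant last row reduces it to
one.\<close>

lemma det_moment_mat_0_nonzero: "jdet (moment_mat d 0) \<noteq> 0"
proof -
  define n where "n = d div 2"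
  define x where "x i = 2 * real (Suc i)" for i
  define y where "y l = 2 * real l + 1" for l
  have sk: "skew_moment 0 l i = 4 / y l * (1 / (x i + y l))" for i l
    using skew_moment_eq[of 0 l i] unfolding x_def y_def by (simp add: add.commute)
  have pos: "x i + y l \<noteq> 0" "y l \<noteq> 0" for i l unfolding x_def y_def by (auto simp: add_nonneg_eq_0_iff)
  have inj: "x i \<noteq> x l \<and> y i \<noteq> y l" if "i < l" for i l using that unfolding x_def y_def by simp
  show ?thesis
  proof (cases "even d")
    case True
    then have "d - d div 2 = n" "d div 2 = n" unfolding n_def by auto
    then have "moment_mat d 0 = mat n n (\<lambda>(i, l). 1 * (4 / y l) * (1 / (x i + y l)))"
      unfolding moment_mat_def by (intro cong_mat) (auto simp: sk)
    then have "jdet (moment_mat d 0) = (\<Prod>i = 0..<n. 1) * (\<Prod>i = 0..<n. 4 / y i) * jdet (mat n n (\<lambda>(i, l). 1 / (x i + y l)))"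
      by (simp only: det_scale)
    moreover have "jdet (mat n n (\<lambda>(i, l). 1 / (x i + y l))) \<noteq> 0"
      by (rule det_cauchy_nonzero) (use pos inj in auto)
    ultimately show ?thesis using pos by simp
  next
    case False
    then have d: "d - d div 2 = Suc n" "d div 2 = n" unfolding n_def by (auto elim!: oddE)
    then have "moment_mat d 0 = mat (Suc n) (Suc n) (\<lambda>(i, l). 1 * (4 / y l) * (if i < n then 1 / (x i + y l) else 1 / 2))"
      unfolding moment_mat_def by (intro cong_mat) (auto simp: sk y_def)
    then have "jdet (moment_mat d 0) = (\<Prod>i = 0..<Suc n. 1) * (\<Prod>i = 0..<Suc n. 4 / y i) *
        jdet (mat (Suc n) (Suc n) (\<lambda>(i, l). if i < n then 1 / (x i + y l) else 1 / 2))"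
      by (simp only: det_scale)
    moreover have "jdet (mat (Suc n) (Suc n) (\<lambda>(i, l). if i < n then 1 / (x i + y l) else 1 / 2)) = 1 / 2 * 
       jdet (mat n n (\<lambda>(i, l). (1 / (x i + y n)) * (y n - y l) * (1 / (x i + y l))))"
    proof (subst det_pivot)
      have "mat n n (\<lambda>(i, l). (if i < n then 1 / (x i + y l) else 1 / 2) - (if i < n then 1 / (x i + y n) else 1 / 2) *
          (if n < n then 1 / (x n + y l) else 1 / 2) / (if n < n then 1 / (x n + y n) else 1 / 2)) =
         mat n n (\<lambda>(i, l). (1 / (x i + y n)) * (y n - y l) * (1 / (x i + y l)))"
        by (intro cong_mat refl) (use pos in \<open>auto simp: divide_simps\<close>)
      then show "(if n < n then 1 / (x n + y n) else 1 / 2) * jdet (mat n n (\<lambda>(i, l). (if i < n then 1 / (x i + y l) else 1 / 2) - (if i < n then 1 / (x i + y n) else 1 / 2) *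
          (if n < n then 1 / (x n + y l) else 1 / 2) / (if n < n then 1 / (x n + y n) else 1 / 2))) =
          1 / 2 * jdet (mat n n (\<lambda>(i, l). (1 / (x i + y n)) * (y n - y l) * (1 / (x i + y l))))" by (simp only: less_irrefl if_False)
    qed simp
    moreover have "jdet (mat n n (\<lambda>(i, l). 1 / (x i + y n) * (y n - y l) * (1 / (x i + y l)))) =
       (\<Prod>i = 0..<n. 1 / (x i + y n)) * (\<Prod>i = 0..<n. y n - y i) * jdet (mat n n (\<lambda>(i, l). 1 / (x i + y l)))"
      by (rule det_scale)
    moreover have "jdet (mat n n (\<lambda>(i, l). 1 / (x i + y l))) \<noteq> 0"
      by (rule det_cauchy_nonzero) (use pos inj in auto)
    moreover have "(\<Prod>i = 0..<n. y n - y i) \<noteq> 0" unfolding y_def by simp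
    ultimately show ?thesis using pos by simp
  qed
qed

section \<open>Closed forms and the volumes\<close>

lemma prod_odd_even:
  fixes h :: "nat \<Rightarrow> real"
  shows "(\<Prod>r = 1..d. h r) = (\<Prod>l<d - d div 2. h (2 * l + 1)) * (\<Prod>m = 1..d div 2. h (2 * m))"
proof (induction d)
  case (Suc d)
  have "(\<Prod>r = 1..Suc d. h r) = (\<Prod>r = 1..d. h r) * h (Suc d)" by simp
  also note Suc.IH
  also have "(\<Prod>l<d - d div 2. h (2 * l + 1)) * (\<Prod>m = 1..d div 2. h (2 * m)) * h (Suc d) =
      (\<Prod>l<Suc d - Suc d div 2. h (2 * l + 1)) * (\<Prod>m = 1..Suc d div 2. h (2 * m))"
  proof (cases "even d")
    case True
    then obtain c where "d = 2 * c" by (rule evenE)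
    then have "d div 2 = c" "Suc d div 2 = c" "d - c = c" "Suc d - c = Suc c" "Suc d = 2 * c + 1" by auto
    moreover have e: "h (Suc (2 * c)) = h (2 * c + 1)" by (rule arg_cong[where f = h]) simp
    ultimately show ?thesis using e by (simp add: mult.assoc)
  next
    case False
    then obtain c where "d = 2 * c + 1" by (rule oddE)
    then have "d div 2 = c" "Suc d div 2 = Suc c" "d - c = Suc c" "Suc d - Suc c = Suc c" "Suc d = 2 * Suc c" by auto
    then show ?thesis by simp
  qed
  finally show ?case .
qed simp

lemma prod_shift_fact: "(\<Prod>r = 1..d. real (a + r)) = fact (a + d) / fact a"
proof (induction d)
  case (Suc d)
  have "(\<Prod>r = 1..Suc d. real (a + r)) = (\<Prod>r = 1..d. real (a + r)) * real (Suc (a + d))" by simp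
  then show ?case unfolding Suc.IH by (simp only: add_Suc_right fact_Suc) simp
qed simp

text \<open>The factors below \<open>a\<close> give \<open>fact (a - 1)\<close>, and those above \<open>a\<close> are negative.\<close>

lemma prod_diff_fact:
  assumes "1 \<le> a" "a \<le> d"
  shows "(\<Prod>r = 1..d. if r = a then 1 else real a - real r) = (-1) ^ (d - a) * fact (a - 1) * fact (d - a)"
proof -
  have low: "(\<Prod>r = 1..a - 1. if r = a then 1 else real a - real r) = fact (a - 1)"
  proof -
    have "(\<Prod>r = 1..a - 1. if r = a then 1 else real a - real r) = (\<Prod>r = 1..a - 1. real r)"
      by (rule prod.reindex_bij_witness[where i = "\<lambda>r. a - r" and j = "\<lambda>r. a - r"])
        (use assms in \<open>auto simp: of_nat_diff\<close>)
    then show ?thesis by (simp add: fact_prod)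
  qed
  have "(\<Prod>r = 1..a + e. if r = a then 1 else real a - real r) = (-1) ^ e * fact (a - 1) * fact e" for e
  proof (induction e)
    case 0
    have "{1..a} = insert a {1..a - 1}" using assms by auto
    then show ?case using low assms by (simp add: prod.insert)
  next
    case (Suc e)
    have "(\<Prod>r = 1..a + Suc e. if r = a then 1 else real a - real r) =
        (\<Prod>r = 1..a + e. if r = a then 1 else real a - real r) * (- real (Suc e))" by simp
    then show ?case unfolding Suc.IH fact_Suc[of e] by (simp only: power_Suc of_nat_id) (simp only: mult_ac mult_minus_left mult_minus_right mult_1)
  qed
  from this[of "d - a"] show ?thesis using assms by simp
qed

definition fact_ratio :: "nat \<Rightarrow> nat \<Rightarrow> real" where
  "fact_ratio d k = fact (d + 2 * k) / (fact (d - 2 * k) * fact (2 * k - 1) * fact (2 * k))"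

text \<open>Numerators and denominators combine to products over consecutive integers: the odd nodes and the even nodes together are the
integers from \<open>1\<close> to \<open>d\<close>, so that shifted by \<open>2 k\<close> in either direction they give factorials. The signs cancel.\<close>

lemma value_ratio_node_weight:
  assumes k: "k \<in> {1..d div 2}"
  shows "value_ratio d k * node_weight d k = fact_ratio d k"
proof -
  define n where "n = d div 2"
  define E where "E = d - n"
  have dE: "d = E + n" unfolding E_def n_def by simp
  have kn: "k \<in> {1..n}" "2 * k \<le> d" "1 \<le> 2 * k" using k by (auto simp: n_def)
  have num: "odd_prod d (- 2 * real k) * even_prod d (2 * real k) = (-1) ^ E * (fact (2 * k + d) / fact (2 * k))"
  proof -
    have "odd_prod d (- 2 * real k) = (\<Prod>l<E. (-1) * real (2 * k + (2 * l + 1)))"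
      unfolding odd_prod_def E_def n_def by (intro prod.cong refl) simp
    also have "\<dots> = (-1) ^ E * (\<Prod>l<E. real (2 * k + (2 * l + 1)))" unfolding prod.distrib by simp
    finally have o: "odd_prod d (- 2 * real k) = (-1) ^ E * (\<Prod>l<E. real (2 * k + (2 * l + 1)))" .
    have e: "even_prod d (2 * real k) = (\<Prod>m = 1..n. real (2 * k + 2 * m))"
      unfolding even_prod_def n_def by (intro prod.cong refl) simp
    have "fact (2 * k + d) / fact (2 * k) = (\<Prod>r = 1..d. real (2 * k + r))" by (rule prod_shift_fact[symmetric])
    also have "\<dots> = (\<Prod>l<E. real (2 * k + (2 * l + 1))) * (\<Prod>m = 1..n. real (2 * k + 2 * m))"
      unfolding E_def n_def by (rule prod_odd_even)
    finally show ?thesis unfolding o e by (simp only: mult.assoc)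
  qed
  \<comment> \<open>The factor \<open>r = 2 k\<close> is missing in the product; replacing it by \<open>1\<close> keeps the splitting into odd and even factors.\<close>
  have den: "odd_prod d (2 * real k) * (\<Prod>m\<in>{1..n} - {k}. 2 * real m - 2 * real k) =
      (-1) ^ (n - 1) * ((-1) ^ d * fact (2 * k - 1) * fact (d - 2 * k))"
  proof -
    define h where "h r = (if r = 2 * k then 1 else real (2 * k) - real r)" for r
    have "(\<Prod>m\<in>{1..n} - {k}. 2 * real m - 2 * real k) = (\<Prod>m\<in>{1..n} - {k}. (-1) * h (2 * m))"
      by (intro prod.cong refl) (auto simp: h_def)
    also have "\<dots> = (-1) ^ (n - 1) * (\<Prod>m\<in>{1..n} - {k}. h (2 * m))" unfolding prod.distrib using kn by simp
    also have "(\<Prod>m\<in>{1..n} - {k}. h (2 * m)) = (\<Prod>m = 1..n. h (2 * m))"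
      by (rule prod.mono_neutral_left) (auto simp: h_def)
    finally have e: "(\<Prod>m\<in>{1..n} - {k}. 2 * real m - 2 * real k) = (-1) ^ (n - 1) * (\<Prod>m = 1..n. h (2 * m))" .
    have o: "odd_prod d (2 * real k) = (\<Prod>l<E. h (2 * l + 1))"
      unfolding odd_prod_def E_def n_def h_def by (intro prod.cong refl) (auto, presburger)
    have "(\<Prod>l<E. h (2 * l + 1)) * (\<Prod>m = 1..n. h (2 * m)) = (-1) ^ (d - 2 * k) * fact (2 * k - 1) * fact (d - 2 * k)"
      unfolding E_def n_def prod_odd_even[symmetric] unfolding h_def by (rule prod_diff_fact) (use kn in auto)
    moreover have "(-1 :: real) ^ (d - 2 * k) = (-1) ^ d" using kn(2) by (simp add: minus_one_power_iff)
    ultimately show ?thesis unfolding o e by (simp add: mult_ac)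
  qed
  have "value_ratio d k * node_weight d k = - (odd_prod d (- 2 * real k) * even_prod d (2 * real k)) /
      (odd_prod d (2 * real k) * (\<Prod>m\<in>{1..n} - {k}. 2 * real m - 2 * real k))"
    unfolding value_ratio_def node_weight_def n_def by (simp add: mult_ac)
  also have "\<dots> = - ((-1) ^ E * (fact (2 * k + d) / fact (2 * k))) / ((-1) ^ (n - 1) * ((-1) ^ d * fact (2 * k - 1) * fact (d - 2 * k)))"
    unfolding num den ..
  also have "\<dots> = fact_ratio d k"
  proof -
    obtain m where m: "n = Suc m" using kn by (cases n) auto
    have "- ((-1) ^ E) = ((-1) ^ (n - 1) * (-1) ^ d :: real)" unfolding dE m by (simp add: power_add)
    then have "- ((-1) ^ E * (fact (2 * k + d) / fact (2 * k))) = ((-1) ^ (n - 1) * (-1) ^ d) * (fact (2 * k + d) / fact (2 * k) :: real)"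
      by (metis mult_minus_left)
    then show ?thesis unfolding fact_ratio_def by (simp add: add.commute mult.commute)
  qed
  finally show ?thesis .
qed

lemma det_mix_coeff:
  assumes K: "K \<subseteq> {1..d div 2}"
  shows "det_on K (mix_coeff d) = (\<Prod>k\<in>K. fact_ratio d k) * det_on K (\<lambda>j k. 1 / (2 * real j + 2 * real k))"
proof -
  have fin: "finite K" using K by (rule finite_subset) simp
  have "det_on K (mix_coeff d) = (\<Prod>k\<in>K. value_ratio d k * node_weight d k) * det_on K (\<lambda>j k. 1 / (2 * real j + 2 * real k))"
    unfolding mix_coeff_def by (rule det_on_scale[OF fin])
  also have "(\<Prod>k\<in>K. value_ratio d k * node_weight d k) = (\<Prod>k\<in>K. fact_ratio d k)"
    by (intro prod.cong refl value_ratio_node_weight) (use K in auto)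
  finally show ?thesis .
qed

lemma det_mix_coeff_half:
  assumes K: "K \<subseteq> {1..d div 2}"
  shows "det_on K (mix_coeff d) = (\<Prod>k\<in>K. fact_ratio d k / 2) * det_on K (\<lambda>j k. 1 / (real j + real k))"
proof -
  have fin: "finite K" using K by (rule finite_subset) simp
  have "(\<lambda>j k. 1 / (2 * real j + 2 * real k)) = (\<lambda>j k. (1 / 2) * 1 * (1 / (real j + real k)))"
    by (simp add: fun_eq_iff divide_simps)
  then have "det_on K (\<lambda>j k. 1 / (2 * real j + 2 * real k)) = (\<Prod>k\<in>K. 1 / 2 * 1) * det_on K (\<lambda>j k. 1 / (real j + real k))"
    using det_on_scale[OF fin, of "\<lambda>_. 1 / 2" "\<lambda>_. 1" "\<lambda>j k. 1 / (real j + real k)"] by simp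
  then show ?thesis unfolding det_mix_coeff[OF K] by (simp add: prod_dividef power_one_over)
qed

lemma det_mix_coeff_product:
  assumes K: "K \<subseteq> {1..d div 2}"
  shows "det_on K (mix_coeff d) = (\<Prod>k\<in>K. 1 / 2 * trinomial (d - 2 * k) (2 * k) (2 * k)) *
    (\<Prod>(j, k) | j \<in> K \<and> k \<in> K \<and> j < k. (real k - real j)\<^sup>2 / (real k + real j)\<^sup>2)"
proof -
  have fin: "finite K" using K by (rule finite_subset) simp
  have "(\<Prod>k\<in>K. 1 / 2 * trinomial (d - 2 * k) (2 * k) (2 * k)) = (\<Prod>k\<in>K. (fact_ratio d k / 2) * (1 / (2 * real k)))"
  proof (rule prod.cong[OF refl])
    fix k assume "k \<in> K"
    then have "k \<in> {1..d div 2}" using K by auto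
    then have k: "1 \<le> k" "2 * k \<le> d" by auto
    have "fact (2 * k) = real (2 * k) * fact (2 * k - 1)" using k by (subst fact_reduce) auto
    moreover have "d - 2 * k + 2 * k + 2 * k = d + 2 * k" using k by simp
    ultimately show "1 / 2 * trinomial (d - 2 * k) (2 * k) (2 * k) = (fact_ratio d k / 2) * (1 / (2 * real k))"
      using k unfolding trinomial_def fact_ratio_def by (simp add: divide_simps)
  qed
  moreover have nz: "0 \<notin> K" using K by auto
  ultimately show ?thesis
    unfolding det_mix_coeff_half[OF K] by (simp only: det_on_cauchy[OF fin nz] prod.distrib mult.assoc)
qed

lemma det_mix_coeff_second:
  assumes K: "K \<subseteq> {1..d div 2}"
  shows "det_on K (mix_coeff d) = (\<Prod>k\<in>K. real ((d + 2 * k) choose (4 * k)) * real ((4 * k - 1) choose (2 * k - 1)) * real (2 * k)) *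
    det_on K (\<lambda>j k. 1 / real (j + k))"
proof -
  have "(\<Prod>k\<in>K. real ((d + 2 * k) choose (4 * k)) * real ((4 * k - 1) choose (2 * k - 1)) * real (2 * k)) = (\<Prod>k\<in>K. fact_ratio d k / 2)"
  proof (rule prod.cong[OF refl])
    fix k assume "k \<in> K"
    then have "k \<in> {1..d div 2}" using K by auto
    then have k: "1 \<le> k" "2 * k \<le> d" by auto
    have f: "fact (4 * k) = real (4 * k) * fact (4 * k - 1)" using k by (subst fact_reduce) auto
    have "d + 2 * k - 4 * k = d - 2 * k" "4 * k - 1 - (2 * k - 1) = 2 * k" using k by simp_all
    then have c: "real ((d + 2 * k) choose (4 * k)) = fact (d + 2 * k) / (fact (4 * k) * fact (d - 2 * k))"
      and c2: "real ((4 * k - 1) choose (2 * k - 1)) = fact (4 * k - 1) / (fact (2 * k - 1) * fact (2 * k))"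
      using k by (simp_all add: binomial_fact)
    show "real ((d + 2 * k) choose (4 * k)) * real ((4 * k - 1) choose (2 * k - 1)) * real (2 * k) = fact_ratio d k / 2"
      using k unfolding c c2 f fact_ratio_def by (simp add: divide_simps)
  qed
  then show ?thesis unfolding det_mix_coeff_half[OF K] by simp
qed

text \<open>The scaling factor is split between rows and columns as \<open>fact (d + 2 j) / fact (2 j - 1)\<close> and
\<open>1 / (fact (d - 2 k) * fact (2 k))\<close>, which makes all entries products of binomial coefficients.\<close>

lemma det_mix_coeff_binomial:
  assumes K: "K \<subseteq> {1..d div 2}"
  shows "det_on K (mix_coeff d) = det_on K (\<lambda>j k. real ((d + 2 * j) choose (2 * j + 2 * k)) * real ((2 * j + 2 * k - 1) choose (2 * j - 1)))"
proof -
  have fin: "finite K" using K by (rule finite_subset) simp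
  have "det_on K (\<lambda>j k. real ((d + 2 * j) choose (2 * j + 2 * k)) * real ((2 * j + 2 * k - 1) choose (2 * j - 1))) =
     det_on K (\<lambda>j k. (fact (d + 2 * j) / fact (2 * j - 1)) * (1 / (fact (d - 2 * k) * fact (2 * k))) * (1 / (2 * real j + 2 * real k)))"
  proof (rule det_on_cong[OF fin])
    fix j k assume "j \<in> K" "k \<in> K"
    then have "j \<in> {1..d div 2}" "k \<in> {1..d div 2}" using K by auto
    then have k: "1 \<le> j" "1 \<le> k" "2 * k \<le> d" by auto
    have f: "fact (2 * j + 2 * k) = real (2 * j + 2 * k) * fact (2 * j + 2 * k - 1)" using k by (subst fact_reduce) auto
    have "d + 2 * j - (2 * j + 2 * k) = d - 2 * k" "2 * j + 2 * k - 1 - (2 * j - 1) = 2 * k" using k by simp_all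
    then have c: "real ((d + 2 * j) choose (2 * j + 2 * k)) = fact (d + 2 * j) / (fact (2 * j + 2 * k) * fact (d - 2 * k))"
      and c2: "real ((2 * j + 2 * k - 1) choose (2 * j - 1)) = fact (2 * j + 2 * k - 1) / (fact (2 * j - 1) * fact (2 * k))"
      using k by (simp_all add: binomial_fact)
    show "real ((d + 2 * j) choose (2 * j + 2 * k)) * real ((2 * j + 2 * k - 1) choose (2 * j - 1)) =
       (fact (d + 2 * j) / fact (2 * j - 1)) * (1 / (fact (d - 2 * k) * fact (2 * k))) * (1 / (2 * real j + 2 * real k))"
      using k unfolding c c2 f by (simp add: divide_simps)
  qed
  also have "\<dots> = (\<Prod>k\<in>K. (fact (d + 2 * k) / fact (2 * k - 1)) * (1 / (fact (d - 2 * k) * fact (2 * k)))) * det_on K (\<lambda>j k. 1 / (2 * real j + 2 * real k))"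
    by (rule det_on_scale[OF fin])
  also have "(\<Prod>k\<in>K. (fact (d + 2 * k) / fact (2 * k - 1)) * (1 / (fact (d - 2 * k) * fact (2 * k)))) = (\<Prod>k\<in>K. fact_ratio d k)"
    unfolding fact_ratio_def by (simp add: mult_ac)
  finally show ?thesis unfolding det_mix_coeff[OF K] by simp
qed

lemma coeff_bernstein:
  assumes "k \<le> n"
  shows "coeff ([:1, -1:] ^ (n - k) * monom 1 k) s = binom (n - k) (int s - int k) * (-1) ^ (s + k)"
proof (cases "k \<le> s")
  case False
  then show ?thesis by (simp add: binom_def mult.commute[of _ "monom _ _"] coeff_monom_mult)
next
  case True
  then obtain e where s: "s = k + e" using le_Suc_ex by blast
  have "coeff ([:1, -1:] ^ (n - k) * monom 1 k) s = coeff ([:1, -1:] ^ (n - k) :: real poly) e"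
    unfolding s by (simp add: mult.commute[of _ "monom _ _"] coeff_monom_mult)
  also have "\<dots> = real ((n - k) choose e) * (-1) ^ e"
  proof (cases "e \<le> n - k")
    case True
    then show ?thesis by (subst coeff_linear_poly_power) auto
  next
    case False
    have "degree ([:1, -1:] ^ (n - k) :: real poly) \<le> n - k" using degree_power_le[of "[:1, -1 :: real:]" "n - k"] by simp
    then show ?thesis using False by (simp add: coeff_eq_0 binomial_eq_0)
  qed
  also have "\<dots> = binom (n - k) (int s - int k) * (-1) ^ (s + k)"
    unfolding s binom_def by (simp add: power_add flip: power_mult_distrib)
  finally show ?thesis .
qed

text \<open>Both sides of the identity between generating functions are polynomials in \<open>t\<close> that agree on the unit interval, so their
coefficients agree. For \<open>s = 0\<close> only the empty set contributes, which identifies the constant as \<open>vol d 0\<close>.\<close>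

theorem vol_ratio:
  assumes "d \<ge> 1" "s \<le> d div 2"
  shows "vol d s / vol d 0 = (\<Sum>K\<in>Pow {1..d div 2}. binom (d div 2 - card K) (int s - int (card K)) * (-1) ^ (s + card K) * det_on K (mix_coeff d))"
proof -
  define n where "n = d div 2"
  obtain C where C: "C \<noteq> 0" "\<And>t. 0 \<le> t \<Longrightarrow> t \<le> 1 \<Longrightarrow> weighted_integral t d (\<lambda>_. 1) = C * jdet (moment_mat d t)"
    using weighted_integral_eq_det[OF assms(1)] by blast
  define c where "c = C * jdet (moment_mat d 0)"
  have c0: "c \<noteq> 0" using C(1) det_moment_mat_0_nonzero by (simp add: c_def)
  define p where "p = (\<Sum>s\<le>n. monom (vol d s) s)"
  define q where "q = (\<Sum>K\<in>Pow {1..n}. smult (det_on K (mix_coeff d)) ([:1, -1:] ^ (n - card K) * monom 1 (card K)))"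
  have eq: "poly p t = poly (smult c q) t" if "0 \<le> t" "t \<le> 1" for t
  proof -
    have "poly p t = weighted_integral t d (\<lambda>_. 1)"
      unfolding weighted_integral_one[OF assms(1)] by (simp add: p_def poly_sum poly_monom n_def)
    also have "\<dots> = poly (smult c q) t"
      unfolding C(2)[OF that] det_moment_mat[OF that] c_def q_def n_def[symmetric]
      by (simp add: poly_sum poly_monom mult_ac)
    finally show ?thesis .
  qed
  have "p - smult c q = 0"
  proof (rule ccontr)
    assume "p - smult c q \<noteq> 0"
    then have "finite {t. poly (p - smult c q) t = 0}" by (rule poly_roots_finite)
    moreover have "{0..1} \<subseteq> {t. poly (p - smult c q) t = 0}" using eq by auto
    ultimately have "finite {0..1 :: real}" by (rule rev_finite_subset)
    then show False using infinite_Icc[of 0 "1 :: real"] by simp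
  qed
  then have pq: "p = smult c q" by simp
  have card: "card K \<le> n" if "K \<subseteq> {1..n}" for K using card_mono[OF _ that] by simp
  have vol: "vol d r = c * (\<Sum>K\<in>Pow {1..n}. binom (n - card K) (int r - int (card K)) * (-1) ^ (r + card K) * det_on K (mix_coeff d))"
    if "r \<le> n" for r
  proof -
    have "vol d r = coeff p r" using that by (simp add: p_def coeff_sum)
    also have "\<dots> = c * (\<Sum>K\<in>Pow {1..n}. det_on K (mix_coeff d) * coeff ([:1, -1:] ^ (n - card K) * monom 1 (card K)) r)"
      unfolding pq q_def by (simp add: coeff_sum)
    also have "\<dots> = c * (\<Sum>K\<in>Pow {1..n}. binom (n - card K) (int r - int (card K)) * (-1) ^ (r + card K) * det_on K (mix_coeff d))"
    proof (intro arg_cong[where f = "(*) c"] sum.cong refl)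
      fix K assume "K \<in> Pow {1..n}"
      then show "det_on K (mix_coeff d) * coeff ([:1, -1:] ^ (n - card K) * monom 1 (card K)) r =
          binom (n - card K) (int r - int (card K)) * (-1) ^ (r + card K) * det_on K (mix_coeff d)"
        using coeff_bernstein[OF card[of K], of r] by (simp only: PowD mult.commute)
    qed
    finally show ?thesis .
  qed
  have "(\<Sum>K\<in>Pow {1..n}. binom (n - card K) (int 0 - int (card K)) * (-1) ^ (0 + card K) * det_on K (mix_coeff d)) =
     (\<Sum>K\<in>Pow {1..n}. if K = {} then 1 else 0)"
  proof (intro sum.cong refl)
    fix K assume "K \<in> Pow {1..n}"
    then have "finite K" by (auto intro: finite_subset)
    then show "binom (n - card K) (int 0 - int (card K)) * (-1) ^ (0 + card K) * det_on K (mix_coeff d) = (if K = {} then 1 else 0)"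
      by (auto simp: binom_def mat_on_def card_gt_0_iff)
  qed
  then have "vol d 0 = c" using vol[of 0] by simp
  then show ?thesis using vol[of s] assms(2) c0 by (simp add: n_def)
qed

theorem theorem5p1:
  fixes d s :: nat
  assumes "d \<ge> 1" and "s \<le> d div 2"
  shows "vol d s / vol d 0 =
      (\<Sum>K\<in>Pow {1..d div 2}.
        binom (d div 2 - card K) (int s - int (card K)) * (-1) ^ (s + card K) *
        (\<Prod>k\<in>K. 1 / 2 * trinomial (d - 2 * k) (2 * k) (2 * k)) *
        (\<Prod>(j, k) | j \<in> K \<and> k \<in> K \<and> j < k. (real k - real j)\<^sup>2 / (real k + real j)\<^sup>2))
    \<and> vol d s / vol d 0 =
      (\<Sum>K\<in>Pow {1..d div 2}.
        binom (d div 2 - card K) (int s - int (card K)) * (-1) ^ (s + card K) *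
        (\<Prod>k\<in>K. real ((d + 2 * k) choose (4 * k)) * real ((4 * k - 1) choose (2 * k - 1)) *
           real (2 * k)) *
        det_on K (\<lambda>j k. 1 / real (j + k)))
    \<and> vol d s / vol d 0 =
      (\<Sum>K\<in>Pow {1..d div 2}.
        binom (d div 2 - card K) (int s - int (card K)) * (-1) ^ (s + card K) *
        det_on K (\<lambda>j k. real ((d + 2 * j) choose (2 * j + 2 * k)) *
           real ((2 * j + 2 * k - 1) choose (2 * j - 1))))
    \<and> vol d s / vol d 0 \<in> \<int>"
proof (intro conjI)
  show "vol d s / vol d 0 =
      (\<Sum>K\<in>Pow {1..d div 2}.
        binom (d div 2 - card K) (int s - int (card K)) * (-1) ^ (s + card K) *
        (\<Prod>k\<in>K. 1 / 2 * trinomial (d - 2 * k) (2 * k) (2 * k)) *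
        (\<Prod>(j, k) | j \<in> K \<and> k \<in> K \<and> j < k. (real k - real j)\<^sup>2 / (real k + real j)\<^sup>2))"
    unfolding vol_ratio[OF assms] by (intro sum.cong refl) (subst det_mix_coeff_product, simp, simp only: mult.assoc)
  show "vol d s / vol d 0 =
      (\<Sum>K\<in>Pow {1..d div 2}.
        binom (d div 2 - card K) (int s - int (card K)) * (-1) ^ (s + card K) *
        (\<Prod>k\<in>K. real ((d + 2 * k) choose (4 * k)) * real ((4 * k - 1) choose (2 * k - 1)) *
           real (2 * k)) *
        det_on K (\<lambda>j k. 1 / real (j + k)))"
    unfolding vol_ratio[OF assms] by (intro sum.cong refl) (subst det_mix_coeff_second, simp, simp only: mult.assoc)
  show third: "vol d s / vol d 0 =
      (\<Sum>K\<in>Pow {1..d div 2}.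
        binom (d div 2 - card K) (int s - int (card K)) * (-1) ^ (s + card K) *
        det_on K (\<lambda>j k. real ((d + 2 * j) choose (2 * j + 2 * k)) *
           real ((2 * j + 2 * k - 1) choose (2 * j - 1))))"
    unfolding vol_ratio[OF assms] by (intro sum.cong refl arg_cong2[where f = "(*)"] det_mix_coeff_binomial) simp
  show "vol d s / vol d 0 \<in> \<int>"
    unfolding third
    by (intro Ints_sum Ints_mult Ints_power Ints_minus Ints_1 det_on_Ints) (auto simp: binom_def intro: finite_subset)
qed

end
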